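(* Let $(E,\pi)$ be a left-resolving labelled graph such that $E$ is row-finite, $(E,\pi)$ is label-finite, and $\{v\}\in\mathcal{E}^0$ for all $v\in E^0$. Then $C^*(E,\pi,\mathcal{E}^0)\cong C^*(E)$. Moreover, if $\{v\}\in\mathcal{E}^0_-$ for all $v\in E^0$, then $C^*(E,\pi,\mathcal{E}^0_-)\cong C^*(E)$.
   Context: A directed graph $E=(E^0,E^1,r,s)$ consists of countable sets $E^0$ (vertices), $E^1$ (edges) and maps $r,s:E^1\to E^0$; it is row-finite if every vertex emits finitely many edges. $C^*(E)$ is the graph $C^*$-algebra: the universal $C^*$-algebra generated by mutually orthogonal projections $\{p_v:v\in E^0\}$ and partial isometries $\{s_e:e\in E^1\}$ with mutually orthogonal ranges such that $s_e^*s_e=p_{r(e)}$, $s_es_e^*\le p_{s(e)}$, and $p_v=\sum_{s(e)=v}s_es_e^*$ whenever $0<|s^{-1}(v)|<\infty$. A path of length $n\ge 1$ is $\lambda=e_1\cdots e_n$ with $r(e_i)=s(e_{i+1})$; $E^n$ is the set of these; $s(\lambda)=s(e_1)$, $r(\lambda)=r(e_n)$. A labelled graph $(E,\pi)$ over an alphabet $\mathcal{A}$ is a directed graph $E$ with a surjective map $\pi:E^1\to\mathcal{A}$, extended to paths by $\pi(e_1\cdots e_n)=\pi(e_1)\cdots\pi(e_n)$. It is left-resolving if $\pi$ is injective on $r^{-1}(v)$ for all $v\in E^0$, and label-finite if $|\pi^{-1}(a)|<\infty$ for all $a\in\mathcal{A}$. Put $\mathcal{L}^n(E,\pi)=\pi(E^n)$,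 $\mathcal{L}(E,\pi)=\bigcup_{n\ge1}\mathcal{L}^n(E,\pi)$. For $\alpha\in\mathcal{L}(E,\pi)$: $s(\alpha)=\{s(\lambda):\pi(\lambda)=\alpha\}$, $r(\alpha)=\{r(\lambda):\pi(\lambda)=\alpha\}$, and for $A\subseteq E^0$, $r(A,\alpha)=\{r(\lambda):\pi(\lambda)=\alpha,\ s(\lambda)\in A\}$. A collection $\mathcal{C}\subseteq 2^{E^0}$ is accommodating for $(E,\pi)$ if $r(A,\alpha)\in\mathcal{C}$ for all $A\in\mathcal{C}$, $\alpha\in\mathcal{L}(E,\pi)$, $r(\alpha)\in\mathcal{C}$ for all $\alpha\in\mathcal{L}(E,\pi)$, and $\mathcal{C}$ is closed under finite intersections and unions. A labelled space $(E,\pi,\mathcal{C})$ is a labelled graph with an accommodating collection; it is weakly left-resolving if $r(A,\alpha)\cap r(B,\alpha)=r(A\cap B,\alpha)$ for all $A,B\in\mathcal{C}$, $\alpha\in\mathcal{L}(E,\pi)$ (automatic if $(E,\pi)$ is left-resolving). $\mathcal{E}^0$ is the smallest accommodating collection containing $\{v\}$ for every source (vertex receiving no edge) or sink (vertex emitting no edge) $v$ and all $r(\alpha)$, $s(\alpha)$, $\alpha\in\mathcal{L}(E,\pi)$; $\mathcal{E}^0_-$ is the smallest accommodating collection containing $\{v\}$ for every sink $v$ and all $r(\alpha)$, $\alpha\in\mathcal{L}(E,\pi)$. For $A\subseteq E^0$, $L^1_A=\{a\in\mathcal{L}^1(E,\pi): A\cap s(a)\ne\emptyset\}$. A representation of a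 weakly left-resolving labelled space $(E,\pi,\mathcal{C})$ consists of projections $\{p_A:A\in\mathcal{C}\}$ and partial isometries $\{s_a:a\in\mathcal{L}^1(E,\pi)\}$ such that: (i) $p_Ap_B=p_{A\cap B}$ and $p_{A\cup B}=p_A+p_B-p_{A\cap B}$, where $p_\emptyset=0$; (ii) $p_As_a=s_ap_{r(A,a)}$; (iii) $s_a^*s_a=p_{r(a)}$ and $s_a^*s_b=0$ unless $a=b$; (iv) for $A\in\mathcal{C}$ with $L^1_A$ finite and non-empty, $p_A=\sum_{a\in L^1_A}s_ap_{r(A,a)}s_a^*$. $C^*(E,\pi,\mathcal{C})$ is the universal $C^*$-algebra generated by a representation of $(E,\pi,\mathcal{C})$.
   Formalization: Relation (iv) in the definition of a representation is imposed only on sets A containing no sinks; as literally stated it forces p_{w}=0 at a sink w (one edge v→w gives the zero algebra, while C*(E)=M_2(C)). If E has no sinks nothing changes. *)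

theory Defs
  imports "HOL-Algebra.Module" "Graph_Theory.Arc_Walk" "HOL-Library.Countable_Set" Complex_Main
begin

section \<open>C*-algebras\<close>

text \<open>
  The field \<open>one\<close> of the ring record is never used: C*-algebras are not assumed to be unital.
\<close>

record 'a cstar = "(complex, 'a) module" +
  adj :: "'a \<Rightarrow> 'a" (\<open>_\<^sup>\<star>\<index>\<close> [1000] 999)
  cnorm :: "'a \<Rightarrow> real" (\<open>\<parallel>_\<parallel>\<index>\<close>)

locale star_algebra = abelian_group A for A :: "'a cstar" (structure) +
  assumes m_closed: "\<lbrakk>x \<in> carrier A; y \<in> carrier A\<rbrakk> \<Longrightarrow> x \<otimes> y \<in> carrier A"
    and smult_closed: "x \<in> carrier A \<Longrightarrow> c \<odot> x \<in> carrier A"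
    and adj_closed: "x \<in> carrier A \<Longrightarrow> x\<^sup>\<star> \<in> carrier A"
    and smult_l_distr: "x \<in> carrier A \<Longrightarrow> (c + d) \<odot> x = c \<odot> x \<oplus> d \<odot> x"
    and smult_r_distr: "\<lbrakk>x \<in> carrier A; y \<in> carrier A\<rbrakk> \<Longrightarrow> c \<odot> (x \<oplus> y) = c \<odot> x \<oplus> c \<odot> y"
    and smult_assoc: "x \<in> carrier A \<Longrightarrow> (c * d) \<odot> x = c \<odot> (d \<odot> x)"
    and smult_one: "x \<in> carrier A \<Longrightarrow> 1 \<odot> x = x"
    and m_assoc: "\<lbrakk>x \<in> carrier A; y \<in> carrier A; z \<in> carrier A\<rbrakk> \<Longrightarrow> (x \<otimes> y) \<otimes> z = x \<otimes> (y \<otimes> z)"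
    and l_distr: "\<lbrakk>x \<in> carrier A; y \<in> carrier A; z \<in> carrier A\<rbrakk> \<Longrightarrow> (x \<oplus> y) \<otimes> z = x \<otimes> z \<oplus> y \<otimes> z"
    and r_distr: "\<lbrakk>x \<in> carrier A; y \<in> carrier A; z \<in> carrier A\<rbrakk> \<Longrightarrow> z \<otimes> (x \<oplus> y) = z \<otimes> x \<oplus> z \<otimes> y"
    and smult_m_l: "\<lbrakk>x \<in> carrier A; y \<in> carrier A\<rbrakk> \<Longrightarrow> (c \<odot> x) \<otimes> y = c \<odot> (x \<otimes> y)"
    and smult_m_r: "\<lbrakk>x \<in> carrier A; y \<in> carrier A\<rbrakk> \<Longrightarrow> x \<otimes> (c \<odot> y) = c \<odot> (x \<otimes> y)"
    and adj_add: "\<lbrakk>x \<in> carrier A; y \<in> carrier A\<rbrakk> \<Longrightarrow> (x \<oplus> y)\<^sup>\<star> = x\<^sup>\<star> \<oplus> y\<^sup>\<star>"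
    and adj_smult: "x \<in> carrier A \<Longrightarrow> (c \<odot> x)\<^sup>\<star> = cnj c \<odot> x\<^sup>\<star>"
    and adj_mult: "\<lbrakk>x \<in> carrier A; y \<in> carrier A\<rbrakk> \<Longrightarrow> (x \<otimes> y)\<^sup>\<star> = y\<^sup>\<star> \<otimes> x\<^sup>\<star>"
    and adj_adj: "x \<in> carrier A \<Longrightarrow> (x\<^sup>\<star>)\<^sup>\<star> = x"

definition cstar_Cauchy :: "'a cstar \<Rightarrow> (nat \<Rightarrow> 'a) \<Rightarrow> bool" where
  "cstar_Cauchy A X \<longleftrightarrow> (\<forall>e>0. \<exists>M. \<forall>m\<ge>M. \<forall>n\<ge>M. \<parallel>X m \<ominus>\<^bsub>A\<^esub> X n\<parallel>\<^bsub>A\<^esub> < e)"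

definition cstar_lim :: "'a cstar \<Rightarrow> (nat \<Rightarrow> 'a) \<Rightarrow> 'a \<Rightarrow> bool" where
  "cstar_lim A X x \<longleftrightarrow> (\<lambda>n. \<parallel>X n \<ominus>\<^bsub>A\<^esub> x\<parallel>\<^bsub>A\<^esub>) \<longlonglongrightarrow> 0"

locale cstar_algebra = star_algebra A for A :: "'a cstar" (structure) +
  assumes norm_eq_0: "x \<in> carrier A \<Longrightarrow> \<parallel>x\<parallel> = 0 \<longleftrightarrow> x = \<zero>"
    and norm_triangle: "\<lbrakk>x \<in> carrier A; y \<in> carrier A\<rbrakk> \<Longrightarrow> \<parallel>x \<oplus> y\<parallel> \<le> \<parallel>x\<parallel> + \<parallel>y\<parallel>"
    and norm_smult: "x \<in> carrier A \<Longrightarrow> \<parallel>c \<odot> x\<parallel> = cmod c * \<parallel>x\<parallel>"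
    and norm_mult: "\<lbrakk>x \<in> carrier A; y \<in> carrier A\<rbrakk> \<Longrightarrow> \<parallel>x \<otimes> y\<parallel> \<le> \<parallel>x\<parallel> * \<parallel>y\<parallel>"
    and cstar_identity: "x \<in> carrier A \<Longrightarrow> \<parallel>x\<^sup>\<star> \<otimes> x\<parallel> = \<parallel>x\<parallel>\<^sup>2"
    and complete: "\<lbrakk>\<And>n. X n \<in> carrier A; cstar_Cauchy A X\<rbrakk> \<Longrightarrow> \<exists>x\<in>carrier A. cstar_lim A X x"

definition star_hom :: "'a cstar \<Rightarrow> 'b cstar \<Rightarrow> ('a \<Rightarrow> 'b) \<Rightarrow> bool" where
  "star_hom A B h \<longleftrightarrow>
    h \<in> carrier A \<rightarrow> carrier B \<and>
    (\<forall>x\<in>carrier A. \<forall>y\<in>carrier A. h (x \<oplus>\<^bsub>A\<^esub> y) = h x \<oplus>\<^bsub>B\<^esub> h y) \<and>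
    (\<forall>x\<in>carrier A. \<forall>y\<in>carrier A. h (x \<otimes>\<^bsub>A\<^esub> y) = h x \<otimes>\<^bsub>B\<^esub> h y) \<and>
    (\<forall>c. \<forall>x\<in>carrier A. h (c \<odot>\<^bsub>A\<^esub> x) = c \<odot>\<^bsub>B\<^esub> h x) \<and>
    (\<forall>x\<in>carrier A. h (x\<^sup>\<star>\<^bsub>A\<^esub>) = (h x)\<^sup>\<star>\<^bsub>B\<^esub>)"

definition cstar_iso :: "'a cstar \<Rightarrow> 'b cstar \<Rightarrow> bool" (infix \<open>\<cong>\<^sub>C\<close> 50) where
  "A \<cong>\<^sub>C B \<longleftrightarrow> (\<exists>h. star_hom A B h \<and> bij_betw h (carrier A) (carrier B))"

definition projection :: "'a cstar \<Rightarrow> 'a \<Rightarrow> bool" where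
  "projection A p \<longleftrightarrow> p \<in> carrier A \<and> p\<^sup>\<star>\<^bsub>A\<^esub> = p \<and> p \<otimes>\<^bsub>A\<^esub> p = p"

definition partial_isometry :: "'a cstar \<Rightarrow> 'a \<Rightarrow> bool" where
  "partial_isometry A s \<longleftrightarrow> s \<in> carrier A \<and> s \<otimes>\<^bsub>A\<^esub> s\<^sup>\<star>\<^bsub>A\<^esub> \<otimes>\<^bsub>A\<^esub> s = s"

text \<open>The order \<open>q \<le> p\<close> of projections.\<close>

definition subprojection :: "'a cstar \<Rightarrow> 'a \<Rightarrow> 'a \<Rightarrow> bool" where
  "subprojection A q p \<longleftrightarrow> projection A q \<and> projection A p \<and> p \<otimes>\<^bsub>A\<^esub> q = q"


section \<open>Universal C*-algebras\<close>

inductive_set cstar_span :: "'a cstar \<Rightarrow> 'a set \<Rightarrow> 'a set" for A G where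
  gen: "x \<in> G \<Longrightarrow> x \<in> cstar_span A G"
| zero: "\<zero>\<^bsub>A\<^esub> \<in> cstar_span A G"
| add: "\<lbrakk>x \<in> cstar_span A G; y \<in> cstar_span A G\<rbrakk> \<Longrightarrow> x \<oplus>\<^bsub>A\<^esub> y \<in> cstar_span A G"
| mult: "\<lbrakk>x \<in> cstar_span A G; y \<in> cstar_span A G\<rbrakk> \<Longrightarrow> x \<otimes>\<^bsub>A\<^esub> y \<in> cstar_span A G"
| smult: "x \<in> cstar_span A G \<Longrightarrow> c \<odot>\<^bsub>A\<^esub> x \<in> cstar_span A G"
| adj: "x \<in> cstar_span A G \<Longrightarrow> x\<^sup>\<star>\<^bsub>A\<^esub> \<in> cstar_span A G"
| lim: "\<lbrakk>\<And>n. X n \<in> cstar_span A G; x \<in> carrier A; cstar_lim A X x\<rbrakk> \<Longrightarrow> x \<in> cstar_span A G"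

definition cstar_generated :: "'a cstar \<Rightarrow> 'a set \<Rightarrow> 'a cstar" where
  "cstar_generated A G = A\<lparr>carrier := cstar_span A G\<rparr>"

text \<open>The \<open>\<ell>\<^sup>\<infinity>\<close>-product; the \<open>insert 0\<close> only matters for an empty family.\<close>

definition cstar_prod :: "'i set \<Rightarrow> ('i \<Rightarrow> 'a cstar) \<Rightarrow> ('i \<Rightarrow> 'a) cstar" where
  "cstar_prod I B =
    \<lparr>carrier = {f \<in> (\<Pi>\<^sub>E i\<in>I. carrier (B i)). bdd_above ((\<lambda>i. \<parallel>f i\<parallel>\<^bsub>B i\<^esub>) ` I)},
     mult = (\<lambda>f g. \<lambda>i\<in>I. f i \<otimes>\<^bsub>B i\<^esub> g i),
     one = (\<lambda>i\<in>I. \<zero>\<^bsub>B i\<^esub>),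
     zero = (\<lambda>i\<in>I. \<zero>\<^bsub>B i\<^esub>),
     add = (\<lambda>f g. \<lambda>i\<in>I. f i \<oplus>\<^bsub>B i\<^esub> g i),
     smult = (\<lambda>c f. \<lambda>i\<in>I. c \<odot>\<^bsub>B i\<^esub> f i),
     adj = (\<lambda>f. \<lambda>i\<in>I. (f i)\<^sup>\<star>\<^bsub>B i\<^esub>),
     cnorm = (\<lambda>f. Sup (insert 0 ((\<lambda>i. \<parallel>f i\<parallel>\<^bsub>B i\<^esub>) ` I)))\<rparr>"

text \<open>
  The universal C*-algebra generated by a family indexed by \<open>G\<close> subject to \<open>Rep\<close> is
  the C*-subalgebra generated by the diagonal family in the product of all pairs of a C*-algebra
  and a family in it satisfying \<open>Rep\<close>, so that its norm is the supremum over all representations.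
  HOL cannot quantify over C*-algebras of all types. It suffices to use those carried by the
  type \<open>'g star_poly \<Rightarrow> real\<close>: if a C*-algebra is generated by a family indexed by \<open>'g\<close>,
  each of its elements is determined by its distances to the values of the *-polynomials in the
  generators. The universal property with respect to C*-algebras of any type is proved below
  (\<open>graph_cstar_universal\<close>, \<open>labelled_cstar_universal\<close>).
\<close>

datatype 'g star_poly =
    PGen 'g
  | PZero
  | PAdd "'g star_poly" "'g star_poly"
  | PMult "'g star_poly" "'g star_poly"
  | PSmult complex "'g star_poly"
  | PAdj "'g star_poly"

type_synonym 'g universe = "'g star_poly \<Rightarrow> real"

type_synonym 'g family = "'g universe cstar \<times> ('g \<Rightarrow> 'g universe)"

definition reps :: "'g set \<Rightarrow> ('g universe cstar \<Rightarrow> ('g \<Rightarrow> 'g universe) \<Rightarrow> bool) \<Rightarrow> 'g family set"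
  where "reps G Rep = {(B, \<rho>). cstar_algebra B \<and> \<rho> \<in> G \<rightarrow> carrier B \<and> Rep B \<rho>}"

definition universal_gen ::
    "'g set \<Rightarrow> ('g universe cstar \<Rightarrow> ('g \<Rightarrow> 'g universe) \<Rightarrow> bool) \<Rightarrow> 'g \<Rightarrow> 'g family \<Rightarrow> 'g universe"
  where "universal_gen G Rep x = (\<lambda>i\<in>reps G Rep. snd i x)"

definition universal_cstar ::
    "'g set \<Rightarrow> ('g universe cstar \<Rightarrow> ('g \<Rightarrow> 'g universe) \<Rightarrow> bool) \<Rightarrow> ('g family \<Rightarrow> 'g universe) cstar"
  where "universal_cstar G Rep =
    cstar_generated (cstar_prod (reps G Rep) fst) (universal_gen G Rep ` G)"


section \<open>Graph C*-algebras\<close>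

text \<open>In a \<open>pre_digraph\<close>, \<open>tail\<close> is the source map and \<open>head\<close> is the range map.\<close>

definition row_finite :: "('v, 'e) pre_digraph \<Rightarrow> bool" where
  "row_finite E \<longleftrightarrow> (\<forall>v\<in>verts E. finite (out_arcs E v))"

definition sinks :: "('v, 'e) pre_digraph \<Rightarrow> 'v set" where
  "sinks E = {v \<in> verts E. out_arcs E v = {}}"

definition sources :: "('v, 'e) pre_digraph \<Rightarrow> 'v set" where
  "sources E = {v \<in> verts E. in_arcs E v = {}}"

definition cuntz_krieger_family ::
    "('v, 'e) pre_digraph \<Rightarrow> 'a cstar \<Rightarrow> ('v \<Rightarrow> 'a) \<Rightarrow> ('e \<Rightarrow> 'a) \<Rightarrow> bool" where
  "cuntz_krieger_family E A p s \<longleftrightarrow>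
    (\<forall>v\<in>verts E. projection A (p v)) \<and>
    (\<forall>v\<in>verts E. \<forall>w\<in>verts E. v \<noteq> w \<longrightarrow> p v \<otimes>\<^bsub>A\<^esub> p w = \<zero>\<^bsub>A\<^esub>) \<and>
    (\<forall>e\<in>arcs E. partial_isometry A (s e)) \<and>
    (\<forall>e\<in>arcs E. \<forall>f\<in>arcs E. e \<noteq> f \<longrightarrow>
      (s e \<otimes>\<^bsub>A\<^esub> (s e)\<^sup>\<star>\<^bsub>A\<^esub>) \<otimes>\<^bsub>A\<^esub> (s f \<otimes>\<^bsub>A\<^esub> (s f)\<^sup>\<star>\<^bsub>A\<^esub>) = \<zero>\<^bsub>A\<^esub>) \<and>
    (\<forall>e\<in>arcs E. (s e)\<^sup>\<star>\<^bsub>A\<^esub> \<otimes>\<^bsub>A\<^esub> s e = p (head E e)) \<and>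
    (\<forall>e\<in>arcs E. subprojection A (s e \<otimes>\<^bsub>A\<^esub> (s e)\<^sup>\<star>\<^bsub>A\<^esub>) (p (tail E e))) \<and>
    (\<forall>v\<in>verts E. finite (out_arcs E v) \<and> out_arcs E v \<noteq> {} \<longrightarrow>
      p v = (\<Oplus>\<^bsub>A\<^esub>e\<in>out_arcs E v. s e \<otimes>\<^bsub>A\<^esub> (s e)\<^sup>\<star>\<^bsub>A\<^esub>))"

definition graph_gens :: "('v, 'e) pre_digraph \<Rightarrow> ('v + 'e) set" where
  "graph_gens E = verts E <+> arcs E"

definition graph_rep ::
    "('v, 'e) pre_digraph \<Rightarrow> 'a cstar \<Rightarrow> ('v + 'e \<Rightarrow> 'a) \<Rightarrow> bool" where
  "graph_rep E A \<rho> \<longleftrightarrow> cuntz_krieger_family E A (\<rho> \<circ> Inl) (\<rho> \<circ> Inr)"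

definition graph_cstar ::
    "('v, 'e) pre_digraph \<Rightarrow> (('v + 'e) family \<Rightarrow> ('v + 'e) universe) cstar" where
  "graph_cstar E = universal_cstar (graph_gens E) (graph_rep E)"


section \<open>Labelled graphs and labelled spaces\<close>

locale labelled_graph = wf_digraph E for E :: "('v, 'e) pre_digraph" +
  fixes lab :: "'e \<Rightarrow> 'l" and alphabet :: "'l set"
  assumes countable_verts: "countable (verts E)"
    and countable_arcs: "countable (arcs E)"
    and lab_surj: "lab ` arcs E = alphabet"

definition left_resolving :: "('v, 'e) pre_digraph \<Rightarrow> ('e \<Rightarrow> 'l) \<Rightarrow> bool" where
  "left_resolving E lab \<longleftrightarrow> (\<forall>v\<in>verts E. inj_on lab (in_arcs E v))"

definition label_finite :: "('v, 'e) pre_digraph \<Rightarrow> ('e \<Rightarrow> 'l) \<Rightarrow> 'l set \<Rightarrow> bool" where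
  "label_finite E lab alphabet \<longleftrightarrow> (\<forall>a\<in>alphabet. finite {e \<in> arcs E. lab e = a})"

definition is_path :: "('v, 'e) pre_digraph \<Rightarrow> 'v \<Rightarrow> 'e list \<Rightarrow> 'v \<Rightarrow> bool" where
  "is_path E u l v \<longleftrightarrow> l \<noteq> [] \<and> pre_digraph.awalk E u l v"

definition words :: "('v, 'e) pre_digraph \<Rightarrow> ('e \<Rightarrow> 'l) \<Rightarrow> 'l list set" where
  "words E lab = {map lab l | u l v. is_path E u l v}"

definition letters :: "('v, 'e) pre_digraph \<Rightarrow> ('e \<Rightarrow> 'l) \<Rightarrow> 'l set" where
  "letters E lab = {a. [a] \<in> words E lab}"

definition word_src :: "('v, 'e) pre_digraph \<Rightarrow> ('e \<Rightarrow> 'l) \<Rightarrow> 'l list \<Rightarrow> 'v set" where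
  "word_src E lab \<alpha> = {u. \<exists>l v. is_path E u l v \<and> map lab l = \<alpha>}"

definition word_rng :: "('v, 'e) pre_digraph \<Rightarrow> ('e \<Rightarrow> 'l) \<Rightarrow> 'l list \<Rightarrow> 'v set" where
  "word_rng E lab \<alpha> = {v. \<exists>u l. is_path E u l v \<and> map lab l = \<alpha>}"

definition rel_rng :: "('v, 'e) pre_digraph \<Rightarrow> ('e \<Rightarrow> 'l) \<Rightarrow> 'v set \<Rightarrow> 'l list \<Rightarrow> 'v set" where
  "rel_rng E lab X \<alpha> = {v. \<exists>u\<in>X. \<exists>l. is_path E u l v \<and> map lab l = \<alpha>}"

definition accommodating :: "('v, 'e) pre_digraph \<Rightarrow> ('e \<Rightarrow> 'l) \<Rightarrow> 'v set set \<Rightarrow> bool" where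
  "accommodating E lab \<C> \<longleftrightarrow>
    \<C> \<subseteq> Pow (verts E) \<and>
    (\<forall>X\<in>\<C>. \<forall>\<alpha>\<in>words E lab. rel_rng E lab X \<alpha> \<in> \<C>) \<and>
    (\<forall>\<alpha>\<in>words E lab. word_rng E lab \<alpha> \<in> \<C>) \<and>
    (\<forall>X\<in>\<C>. \<forall>Y\<in>\<C>. X \<inter> Y \<in> \<C> \<and> X \<union> Y \<in> \<C>)"

definition E_zero :: "('v, 'e) pre_digraph \<Rightarrow> ('e \<Rightarrow> 'l) \<Rightarrow> 'v set set" where
  "E_zero E lab = \<Inter>{\<C>. accommodating E lab \<C> \<and>
    (\<forall>v\<in>sources E \<union> sinks E. {v} \<in> \<C>) \<and>
    (\<forall>\<alpha>\<in>words E lab. word_rng E lab \<alpha> \<in> \<C> \<and> word_src E lab \<alpha> \<in> \<C>)}"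

definition E_zero_minus :: "('v, 'e) pre_digraph \<Rightarrow> ('e \<Rightarrow> 'l) \<Rightarrow> 'v set set" where
  "E_zero_minus E lab = \<Inter>{\<C>. accommodating E lab \<C> \<and>
    (\<forall>v\<in>sinks E. {v} \<in> \<C>) \<and> (\<forall>\<alpha>\<in>words E lab. word_rng E lab \<alpha> \<in> \<C>)}"

definition letters_from :: "('v, 'e) pre_digraph \<Rightarrow> ('e \<Rightarrow> 'l) \<Rightarrow> 'v set \<Rightarrow> 'l set" where
  "letters_from E lab X = {a \<in> letters E lab. X \<inter> word_src E lab [a] \<noteq> {}}"


section \<open>C*-algebras of labelled spaces\<close>

text \<open>
  The summation relation is imposed only on sets \<open>X\<close> that contain no sinks. Imposed on every
  \<open>X\<close> for which \<open>letters_from E lab X\<close> is finite and non-empty, it would force \<open>p {w} = 0\<close> for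
  every sink \<open>w\<close> with \<open>{w} \<in> \<C>\<close> as soon as \<open>\<C>\<close> has such an \<open>X\<close> with \<open>w \<notin> X\<close>, since \<open>X\<close> and
  \<open>X \<union> {w}\<close> have the same right-hand side (\<open>unrestricted_relation_sink\<close> below). For the graph
  with a single edge \<open>v \<rightarrow> w\<close> the C*-algebra of the labelled space \<open>E_zero\<close> would then be zero,
  whereas the graph C*-algebra is the algebra of 2 by 2 matrices. If \<open>E\<close> has no sinks the
  restriction is void.
\<close>

definition labelled_representation ::
    "('v, 'e) pre_digraph \<Rightarrow> ('e \<Rightarrow> 'l) \<Rightarrow> 'v set set \<Rightarrow> 'a cstar \<Rightarrow>
      ('v set \<Rightarrow> 'a) \<Rightarrow> ('l \<Rightarrow> 'a) \<Rightarrow> bool" where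
  "labelled_representation E lab \<C> A p s \<longleftrightarrow>
    (\<forall>X\<in>\<C>. projection A (p X)) \<and>
    (\<forall>a\<in>letters E lab. partial_isometry A (s a)) \<and>
    ({} \<in> \<C> \<longrightarrow> p {} = \<zero>\<^bsub>A\<^esub>) \<and>
    (\<forall>X\<in>\<C>. \<forall>Y\<in>\<C>. p X \<otimes>\<^bsub>A\<^esub> p Y = p (X \<inter> Y) \<and>
      p (X \<union> Y) = (p X \<oplus>\<^bsub>A\<^esub> p Y) \<ominus>\<^bsub>A\<^esub> p (X \<inter> Y)) \<and>
    (\<forall>X\<in>\<C>. \<forall>a\<in>letters E lab. p X \<otimes>\<^bsub>A\<^esub> s a = s a \<otimes>\<^bsub>A\<^esub> p (rel_rng E lab X [a])) \<and>
    (\<forall>a\<in>letters E lab. (s a)\<^sup>\<star>\<^bsub>A\<^esub> \<otimes>\<^bsub>A\<^esub> s a = p (word_rng E lab [a])) \<and>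
    (\<forall>a\<in>letters E lab. \<forall>b\<in>letters E lab. a \<noteq> b \<longrightarrow> (s a)\<^sup>\<star>\<^bsub>A\<^esub> \<otimes>\<^bsub>A\<^esub> s b = \<zero>\<^bsub>A\<^esub>) \<and>
    (\<forall>X\<in>\<C>. finite (letters_from E lab X) \<and> letters_from E lab X \<noteq> {} \<and> X \<inter> sinks E = {} \<longrightarrow>
      p X = (\<Oplus>\<^bsub>A\<^esub>a\<in>letters_from E lab X. s a \<otimes>\<^bsub>A\<^esub> p (rel_rng E lab X [a]) \<otimes>\<^bsub>A\<^esub> (s a)\<^sup>\<star>\<^bsub>A\<^esub>))"

definition labelled_gens :: "('v, 'e) pre_digraph \<Rightarrow> ('e \<Rightarrow> 'l) \<Rightarrow> 'v set set \<Rightarrow> ('v set + 'l) set" where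
  "labelled_gens E lab \<C> = \<C> <+> letters E lab"

definition labelled_rep ::
    "('v, 'e) pre_digraph \<Rightarrow> ('e \<Rightarrow> 'l) \<Rightarrow> 'v set set \<Rightarrow> 'a cstar \<Rightarrow> ('v set + 'l \<Rightarrow> 'a) \<Rightarrow> bool" where
  "labelled_rep E lab \<C> A \<rho> \<longleftrightarrow> labelled_representation E lab \<C> A (\<rho> \<circ> Inl) (\<rho> \<circ> Inr)"

definition labelled_cstar ::
    "('v, 'e) pre_digraph \<Rightarrow> ('e \<Rightarrow> 'l) \<Rightarrow> 'v set set \<Rightarrow>
      (('v set + 'l) family \<Rightarrow> ('v set + 'l) universe) cstar" where
  "labelled_cstar E lab \<C> = universal_cstar (labelled_gens E lab \<C>) (labelled_rep E lab \<C>)"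


section \<open>Universal properties\<close>

context star_algebra begin

lemma smult_zero_l: "x \<in> carrier A \<Longrightarrow> 0 \<odot> x = \<zero>"
proof -
  assume x: "x \<in> carrier A"
  have "0 \<odot> x \<oplus> 0 \<odot> x = 0 \<odot> x" using smult_l_distr[OF x, of 0 0] by simp
  then show ?thesis using x by (metis smult_closed r_neg1 add.r_cancel_one' add.r_cancel_one)
qed

lemma a_inv_smult: "x \<in> carrier A \<Longrightarrow> \<ominus> x = (-1) \<odot> x"
proof -
  assume x: "x \<in> carrier A"
  have "(-1) \<odot> x \<oplus> x = \<zero>"
    using smult_l_distr[OF x, of "-1" 1] smult_one[OF x] smult_zero_l[OF x] by simp
  then show ?thesis using x by (metis smult_closed minus_equality)
qed

lemma minus_smult: "\<lbrakk>x \<in> carrier A; y \<in> carrier A\<rbrakk> \<Longrightarrow> x \<ominus> y = x \<oplus> (-1) \<odot> y"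
  by (simp add: a_minus_def a_inv_smult)

lemma smult_zero_r: "c \<odot> \<zero> = \<zero>"
proof -
  have "c \<odot> \<zero> = c \<odot> (0 \<odot> \<zero>)" by (simp add: smult_zero_l)
  also have "\<dots> = (c * 0) \<odot> \<zero>" by (rule smult_assoc[symmetric]) simp
  finally show ?thesis by (simp add: smult_zero_l)
qed

lemma adj_zero: "\<zero>\<^sup>\<star> = \<zero>"
proof -
  have "\<zero>\<^sup>\<star> = (0 \<odot> \<zero>)\<^sup>\<star>" by (simp add: smult_zero_l)
  also have "\<dots> = 0 \<odot> \<zero>\<^sup>\<star>" by (simp add: adj_smult)
  finally show ?thesis by (simp add: smult_zero_l adj_closed)
qed

end

lemma star_homD:
  assumes "star_hom A B h"
  shows "x \<in> carrier A \<Longrightarrow> h x \<in> carrier B"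
    "x \<in> carrier A \<Longrightarrow> y \<in> carrier A \<Longrightarrow> h (x \<oplus>\<^bsub>A\<^esub> y) = h x \<oplus>\<^bsub>B\<^esub> h y"
    "x \<in> carrier A \<Longrightarrow> y \<in> carrier A \<Longrightarrow> h (x \<otimes>\<^bsub>A\<^esub> y) = h x \<otimes>\<^bsub>B\<^esub> h y"
    "x \<in> carrier A \<Longrightarrow> h (c \<odot>\<^bsub>A\<^esub> x) = c \<odot>\<^bsub>B\<^esub> h x"
    "x \<in> carrier A \<Longrightarrow> h (x\<^sup>\<star>\<^bsub>A\<^esub>) = (h x)\<^sup>\<star>\<^bsub>B\<^esub>"
  using assms unfolding star_hom_def by auto

lemma star_hom_comp:
  "\<lbrakk>star_hom A B f; star_hom B C g\<rbrakk> \<Longrightarrow> star_hom A C (\<lambda>x. g (f x))"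
  unfolding star_hom_def Pi_iff by simp

lemma star_hom_more:
  assumes "star_algebra A" "star_algebra B" "star_hom A B h"
  shows star_hom_zero: "h \<zero>\<^bsub>A\<^esub> = \<zero>\<^bsub>B\<^esub>"
    and star_hom_minus: "x \<in> carrier A \<Longrightarrow> y \<in> carrier A \<Longrightarrow> h (x \<ominus>\<^bsub>A\<^esub> y) = h x \<ominus>\<^bsub>B\<^esub> h y"
    and star_hom_finsum: "f \<in> I \<rightarrow> carrier A \<Longrightarrow> h (finsum A f I) = finsum B (\<lambda>i. h (f i)) I"
proof -
  interpret A: star_algebra A by fact
  interpret B: star_algebra B by fact
  note h = star_homD[OF assms(3)]
  have "h \<zero>\<^bsub>A\<^esub> = h (0 \<odot>\<^bsub>A\<^esub> \<zero>\<^bsub>A\<^esub>)" by (simp add: A.smult_zero_l)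
  also have "\<dots> = 0 \<odot>\<^bsub>B\<^esub> h \<zero>\<^bsub>A\<^esub>" by (simp add: h)
  also have "\<dots> = \<zero>\<^bsub>B\<^esub>" by (simp add: B.smult_zero_l h)
  finally show z: "h \<zero>\<^bsub>A\<^esub> = \<zero>\<^bsub>B\<^esub>" .
  show "h (x \<ominus>\<^bsub>A\<^esub> y) = h x \<ominus>\<^bsub>B\<^esub> h y" if "x \<in> carrier A" "y \<in> carrier A" for x y
    using that by (simp add: A.minus_smult B.minus_smult A.smult_closed h)
  show "f \<in> I \<rightarrow> carrier A \<Longrightarrow> h (finsum A f I) = finsum B (\<lambda>i. h (f i)) I"
  proof (induction I rule: infinite_finite_induct)
    case (insert i I)
    then have "f \<in> I \<rightarrow> carrier A" "f i \<in> carrier A" by auto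
    with insert show ?case
      by (simp add: h Pi_iff)
  qed (simp_all add: z A.finsum_infinite B.finsum_infinite)
qed

lemma star_algebra_reflect:
  fixes A :: "'a cstar" and B :: "'i \<Rightarrow> 'b cstar"
  assumes B: "\<And>i. i \<in> I \<Longrightarrow> star_algebra (B i)"
    and hom: "\<And>i. i \<in> I \<Longrightarrow> star_hom A (B i) (h i)"
    and zero: "\<zero>\<^bsub>A\<^esub> \<in> carrier A" "\<And>i. i \<in> I \<Longrightarrow> h i \<zero>\<^bsub>A\<^esub> = \<zero>\<^bsub>B i\<^esub>"
    and cl: "\<And>x y. x \<in> carrier A \<Longrightarrow> y \<in> carrier A \<Longrightarrow> x \<oplus>\<^bsub>A\<^esub> y \<in> carrier A"
      "\<And>x y. x \<in> carrier A \<Longrightarrow> y \<in> carrier A \<Longrightarrow> x \<otimes>\<^bsub>A\<^esub> y \<in> carrier A"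
      "\<And>c x. x \<in> carrier A \<Longrightarrow> c \<odot>\<^bsub>A\<^esub> x \<in> carrier A"
      "\<And>x. x \<in> carrier A \<Longrightarrow> x\<^sup>\<star>\<^bsub>A\<^esub> \<in> carrier A"
    and inj: "\<And>x y. x \<in> carrier A \<Longrightarrow> y \<in> carrier A \<Longrightarrow> (\<And>i. i \<in> I \<Longrightarrow> h i x = h i y) \<Longrightarrow> x = y"
  shows "star_algebra A"
proof -
  note ax = star_algebra.smult_l_distr star_algebra.smult_r_distr star_algebra.smult_assoc
    star_algebra.smult_one star_algebra.m_assoc star_algebra.l_distr star_algebra.r_distr
    star_algebra.smult_m_l star_algebra.smult_m_r star_algebra.adj_add star_algebra.adj_smult
    star_algebra.adj_mult star_algebra.adj_adj
  note h = star_homD[OF hom]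
  have ab: "abelian_group (B i)" if "i \<in> I" for i
    using B[OF that] by (simp add: star_algebra_def)
  have mon: "abelian_monoid (B i)" if "i \<in> I" for i
    using ab[OF that] by (simp add: abelian_group_def)
  have "abelian_group A"
  proof (rule abelian_groupI)
    show "\<exists>y\<in>carrier A. y \<oplus>\<^bsub>A\<^esub> x = \<zero>\<^bsub>A\<^esub>" if x: "x \<in> carrier A" for x
    proof (intro bexI[of _ "(-1) \<odot>\<^bsub>A\<^esub> x"] inj)
      fix i assume i: "i \<in> I"
      interpret Bi: star_algebra "B i" by (rule B[OF i])
      show "h i ((-1) \<odot>\<^bsub>A\<^esub> x \<oplus>\<^bsub>A\<^esub> x) = h i \<zero>\<^bsub>A\<^esub>"
        using x i by (simp add: h cl zero Bi.a_inv_smult[symmetric] Bi.l_neg)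
    qed (use x cl zero in auto)
  qed (rule inj; simp add: cl zero h abelian_monoid.a_assoc[OF mon] abelian_monoid.a_comm[OF mon]
      abelian_monoid.l_zero[OF mon] | simp add: cl zero)+
  then show ?thesis
    by (intro star_algebra.intro star_algebra_axioms.intro)
      (assumption | (simp add: cl; fail) | (rule inj; simp add: cl h ax[OF B]))+
qed

context cstar_algebra begin

lemma norm_zero: "\<parallel>\<zero>\<parallel> = 0"
  using norm_eq_0[of \<zero>] by simp

lemma norm_minus_le: "\<lbrakk>x \<in> carrier A; y \<in> carrier A\<rbrakk> \<Longrightarrow> \<parallel>x \<ominus> y\<parallel> \<le> \<parallel>x\<parallel> + \<parallel>y\<parallel>"
  using norm_triangle[of x "(-1) \<odot> y"] norm_smult[of y "-1"]
  by (simp add: minus_smult smult_closed)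

lemma norm_nonneg: "x \<in> carrier A \<Longrightarrow> 0 \<le> \<parallel>x\<parallel>"
  using norm_minus_le[of x x] norm_zero by (simp add: a_minus_def r_neg)

lemma norm_minus_commute: "\<lbrakk>x \<in> carrier A; y \<in> carrier A\<rbrakk> \<Longrightarrow> \<parallel>x \<ominus> y\<parallel> = \<parallel>y \<ominus> x\<parallel>"
proof -
  assume xy: "x \<in> carrier A" "y \<in> carrier A"
  have "x \<ominus> y = (-1) \<odot> (y \<ominus> x)"
    using xy by (simp add: a_minus_def a_inv_smult[symmetric] minus_add minus_minus a_comm)
  then show ?thesis using norm_smult[of "y \<ominus> x" "-1"] xy by simp
qed

lemma norm_dist_triangle:
  "\<lbrakk>x \<in> carrier A; y \<in> carrier A; z \<in> carrier A\<rbrakk> \<Longrightarrow> \<parallel>x \<ominus> z\<parallel> \<le> \<parallel>x \<ominus> y\<parallel> + \<parallel>y \<ominus> z\<parallel>"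
proof -
  assume xyz: "x \<in> carrier A" "y \<in> carrier A" "z \<in> carrier A"
  have "x \<ominus> z = (x \<ominus> y) \<oplus> (y \<ominus> z)"
    using xyz by (simp add: a_minus_def a_assoc r_neg1)
  then show ?thesis using norm_triangle[of "x \<ominus> y" "y \<ominus> z"] xyz by simp
qed

lemma norm_le_dist: "\<lbrakk>x \<in> carrier A; y \<in> carrier A\<rbrakk> \<Longrightarrow> \<parallel>x\<parallel> \<le> \<parallel>x \<ominus> y\<parallel> + \<parallel>y\<parallel>"
  using norm_triangle[of "x \<ominus> y" y] by (simp add: a_minus_def a_assoc l_neg)

lemma norm_adj: "x \<in> carrier A \<Longrightarrow> \<parallel>x\<^sup>\<star>\<parallel> = \<parallel>x\<parallel>"
proof -
  have le: "\<parallel>x\<parallel> \<le> \<parallel>x\<^sup>\<star>\<parallel>" if x: "x \<in> carrier A" for x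
  proof (cases "\<parallel>x\<parallel> = 0")
    case False
    then have "\<parallel>x\<parallel> > 0" using norm_nonneg[OF x] by simp
    moreover have "\<parallel>x\<parallel> * \<parallel>x\<parallel> \<le> \<parallel>x\<^sup>\<star>\<parallel> * \<parallel>x\<parallel>"
      using cstar_identity[OF x] norm_mult[of "x\<^sup>\<star>" x] x by (simp add: adj_closed power2_eq_square)
    ultimately show ?thesis by simp
  qed (use norm_nonneg x adj_closed in simp)
  assume x: "x \<in> carrier A"
  show ?thesis using le[OF x] le[of "x\<^sup>\<star>"] x by (simp add: adj_closed adj_adj)
qed

lemma norm_projection: "projection A p \<Longrightarrow> \<parallel>p\<parallel> \<le> 1"
proof -
  assume "projection A p"
  then have p: "p \<in> carrier A" "p\<^sup>\<star> \<otimes> p = p" by (auto simp: projection_def)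
  then have "\<parallel>p\<parallel> * \<parallel>p\<parallel> = 1 * \<parallel>p\<parallel>" using cstar_identity[of p] by (simp add: power2_eq_square)
  then have "\<parallel>p\<parallel> = 0 \<or> \<parallel>p\<parallel> = 1" by (simp only: mult_cancel_right)
  then show ?thesis by auto
qed

lemma norm_le_1:
  assumes x: "x \<in> carrier A" and p: "projection A (x\<^sup>\<star> \<otimes> x)" shows "\<parallel>x\<parallel> \<le> 1"
  using norm_projection[OF p] norm_nonneg[OF x] cstar_identity[OF x] by (simp add: power_le_one_iff)

lemma lim_unique:
  assumes X: "\<And>n. X n \<in> carrier A" and x: "x \<in> carrier A" and y: "y \<in> carrier A"
    and "cstar_lim A X x" "cstar_lim A X y"
  shows "x = y"
proof -
  have "(\<lambda>n. \<parallel>X n \<ominus> x\<parallel> + \<parallel>X n \<ominus> y\<parallel>) \<longlonglongrightarrow> 0 + 0"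
    using assms(4,5) unfolding cstar_lim_def by (rule tendsto_add)
  moreover have "\<parallel>x \<ominus> y\<parallel> \<le> \<parallel>X n \<ominus> x\<parallel> + \<parallel>X n \<ominus> y\<parallel>" for n
    using norm_dist_triangle[OF x X y, of n] norm_minus_commute[OF x X, of n] by simp
  ultimately have "\<parallel>x \<ominus> y\<parallel> \<le> 0"
    using LIMSEQ_le_const[of _ "0 + 0 :: real" "\<parallel>x \<ominus> y\<parallel>"] by simp
  then have "x \<ominus> y = \<zero>" using norm_nonneg[of "x \<ominus> y"] norm_eq_0[of "x \<ominus> y"] x y by simp
  then show ?thesis using x y
    by (metis a_minus_def add.inv_closed l_neg l_zero r_zero a_assoc)
qed

lemma cstar_span_closed: assumes "G \<subseteq> carrier A" shows "cstar_span A G \<subseteq> carrier A"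
proof
  fix x assume "x \<in> cstar_span A G"
  then show "x \<in> carrier A"
    by induction (use assms in \<open>auto simp: m_closed smult_closed adj_closed\<close>)
qed

end


lemma cstar_generated_sel [simp]:
  "carrier (cstar_generated A G) = cstar_span A G"
  "zero (cstar_generated A G) = zero A" "add (cstar_generated A G) = add A"
  "mult (cstar_generated A G) = mult A" "smult (cstar_generated A G) = smult A"
  "adj (cstar_generated A G) = adj A" "cnorm (cstar_generated A G) = cnorm A"
  by (simp_all add: cstar_generated_def)

lemma star_hom_generated_incl:
  assumes "cstar_algebra A" "G \<subseteq> carrier A"
  shows "star_hom (cstar_generated A G) A (\<lambda>x. x)"
  using cstar_algebra.cstar_span_closed[OF assms] by (auto simp: star_hom_def)

lemma cstar_generated_algebra:
  assumes A: "cstar_algebra A" and G: "G \<subseteq> carrier A"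
  shows "cstar_algebra (cstar_generated A G)"
proof -
  interpret A: cstar_algebra A by fact
  let ?S = "cstar_generated A G"
  have sub: "x \<in> carrier A" if "x \<in> cstar_span A G" for x
    using A.cstar_span_closed[OF G] that by auto
  have S: "star_algebra ?S"
    by (rule star_algebra_reflect[where I = "{()}" and B = "\<lambda>_. A" and h = "\<lambda>_ x. x"])
      (auto simp: A.star_algebra_axioms star_hom_generated_incl[OF A G] intro: cstar_span.intros)
  have minus: "x \<ominus>\<^bsub>?S\<^esub> y = x \<ominus>\<^bsub>A\<^esub> y" if "x \<in> cstar_span A G" "y \<in> cstar_span A G" for x y
    using star_hom_minus[OF S A.star_algebra_axioms star_hom_generated_incl[OF A G]] that by simp
  show ?thesis
  proof (intro cstar_algebra.intro[OF S] cstar_algebra_axioms.intro)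
    fix X assume X: "\<And>n. X n \<in> carrier ?S" and C: "cstar_Cauchy ?S X"
    have XA: "X n \<in> carrier A" for n using X sub by simp
    have "cstar_Cauchy A X" using C X by (simp add: cstar_Cauchy_def minus)
    then obtain x where x: "x \<in> carrier A" "cstar_lim A X x" using A.complete XA by blast
    have xs: "x \<in> cstar_span A G" by (rule cstar_span.lim[of X]) (use X x in auto)
    then show "\<exists>x\<in>carrier ?S. cstar_lim ?S X x"
      using X x(2) by (intro bexI[of _ x]) (simp_all add: cstar_lim_def minus)
  qed (auto simp: A.norm_eq_0 A.norm_triangle A.norm_smult A.norm_mult A.cstar_identity sub)
qed

lemma cstar_prod_sel [simp]:
  "carrier (cstar_prod I B) =
    {f \<in> (\<Pi>\<^sub>E i\<in>I. carrier (B i)). bdd_above ((\<lambda>i. \<parallel>f i\<parallel>\<^bsub>B i\<^esub>) ` I)}"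
  "zero (cstar_prod I B) = (\<lambda>i\<in>I. \<zero>\<^bsub>B i\<^esub>)"
  "add (cstar_prod I B) f g = (\<lambda>i\<in>I. f i \<oplus>\<^bsub>B i\<^esub> g i)"
  "mult (cstar_prod I B) f g = (\<lambda>i\<in>I. f i \<otimes>\<^bsub>B i\<^esub> g i)"
  "smult (cstar_prod I B) c f = (\<lambda>i\<in>I. c \<odot>\<^bsub>B i\<^esub> f i)"
  "adj (cstar_prod I B) f = (\<lambda>i\<in>I. (f i)\<^sup>\<star>\<^bsub>B i\<^esub>)"
  "cnorm (cstar_prod I B) f = Sup (insert 0 ((\<lambda>i. \<parallel>f i\<parallel>\<^bsub>B i\<^esub>) ` I))"
  by (simp_all add: cstar_prod_def)

lemma cstar_prod_norm_upper:
  "f \<in> carrier (cstar_prod I B) \<Longrightarrow> i \<in> I \<Longrightarrow> \<parallel>f i\<parallel>\<^bsub>B i\<^esub> \<le> \<parallel>f\<parallel>\<^bsub>cstar_prod I B\<^esub>"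
  by (auto intro!: cSup_upper)

lemma cstar_prod_norm_nonneg:
  "f \<in> carrier (cstar_prod I B) \<Longrightarrow> 0 \<le> \<parallel>f\<parallel>\<^bsub>cstar_prod I B\<^esub>"
  by (auto intro!: cSup_upper)

lemma cstar_prod_norm_least:
  "0 \<le> c \<Longrightarrow> (\<And>i. i \<in> I \<Longrightarrow> \<parallel>f i\<parallel>\<^bsub>B i\<^esub> \<le> c) \<Longrightarrow> \<parallel>f\<parallel>\<^bsub>cstar_prod I B\<^esub> \<le> c"
  by (auto intro!: cSup_least)

lemma cstar_prod_carrierI:
  "f \<in> (\<Pi>\<^sub>E i\<in>I. carrier (B i)) \<Longrightarrow> (\<And>i. i \<in> I \<Longrightarrow> \<parallel>f i\<parallel>\<^bsub>B i\<^esub> \<le> c) \<Longrightarrow>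
    f \<in> carrier (cstar_prod I B)"
  by (auto intro!: bdd_aboveI[of _ c])

lemma star_hom_prod_coord: "i \<in> I \<Longrightarrow> star_hom (cstar_prod I B) (B i) (\<lambda>f. f i)"
  by (auto simp: star_hom_def)

lemma cstar_prod_algebra:
  assumes B: "\<And>i. i \<in> I \<Longrightarrow> cstar_algebra (B i)"
  shows "cstar_algebra (cstar_prod I B)"
proof -
  let ?P = "cstar_prod I B"
  let ?n = "cnorm ?P"
  note up = cstar_prod_norm_upper[of _ I B] and nn = cstar_prod_norm_nonneg[of _ I B]
  have SB: "star_algebra (B i)" if "i \<in> I" for i
    using B[OF that] by (simp add: cstar_algebra_def)
  have AB: "abelian_monoid (B i)" if "i \<in> I" for i
    using SB[OF that] by (simp add: star_algebra_def abelian_group_def)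
  have co: "f i \<in> carrier (B i)" if "f \<in> carrier ?P" "i \<in> I" for f i using that by auto
  note cl = abelian_monoid.a_closed[OF AB] star_algebra.m_closed[OF SB]
    star_algebra.smult_closed[OF SB] star_algebra.adj_closed[OF SB] abelian_monoid.zero_closed[OF AB]
  have n_add: "\<parallel>(f \<oplus>\<^bsub>?P\<^esub> g) i\<parallel>\<^bsub>B i\<^esub> \<le> ?n f + ?n g"
    if "f \<in> carrier ?P" "g \<in> carrier ?P" "i \<in> I" for f g i
    using cstar_algebra.norm_triangle[OF B[OF that(3)] co[OF that(1,3)] co[OF that(2,3)]]
      up[OF that(1,3)] up[OF that(2,3)] that(3) by (simp del: cstar_prod_sel(7))
  have n_mult: "\<parallel>(f \<otimes>\<^bsub>?P\<^esub> g) i\<parallel>\<^bsub>B i\<^esub> \<le> ?n f * ?n g"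
    if "f \<in> carrier ?P" "g \<in> carrier ?P" "i \<in> I" for f g i
    using order_trans[OF cstar_algebra.norm_mult[OF B[OF that(3)] co[OF that(1,3)] co[OF that(2,3)]]
      mult_mono[OF up[OF that(1,3)] up[OF that(2,3)] nn[OF that(1)]
       cstar_algebra.norm_nonneg[OF B[OF that(3)] co[OF that(2,3)]]]] that(3)
    by (simp del: cstar_prod_sel(7))
  have n_smult: "\<parallel>(c \<odot>\<^bsub>?P\<^esub> f) i\<parallel>\<^bsub>B i\<^esub> \<le> cmod c * ?n f"
    if "f \<in> carrier ?P" "i \<in> I" for c f i
    using cstar_algebra.norm_smult[OF B[OF that(2)] co[OF that], of c] up[OF that]
      that(2) by (simp del: cstar_prod_sel(7) add: mult_left_mono)
  have n_adj: "\<parallel>(f\<^sup>\<star>\<^bsub>?P\<^esub>) i\<parallel>\<^bsub>B i\<^esub> \<le> ?n f"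
    if "f \<in> carrier ?P" "i \<in> I" for f i
    using cstar_algebra.norm_adj[OF B[OF that(2)] co[OF that]] up[OF that]
      that(2) by (simp del: cstar_prod_sel(7))
  have c_add: "f \<oplus>\<^bsub>?P\<^esub> g \<in> carrier ?P" if "f \<in> carrier ?P" "g \<in> carrier ?P" for f g
    by (rule cstar_prod_carrierI[OF _ n_add[OF that]]) (use cl co that in \<open>simp del: cstar_prod_sel(1) restrict_apply add: restrict_PiE_iff\<close>)
  have c_mult: "f \<otimes>\<^bsub>?P\<^esub> g \<in> carrier ?P" if "f \<in> carrier ?P" "g \<in> carrier ?P" for f g
    by (rule cstar_prod_carrierI[OF _ n_mult[OF that]]) (use cl co that in \<open>simp del: cstar_prod_sel(1) restrict_apply add: restrict_PiE_iff\<close>)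
  have c_smult: "c \<odot>\<^bsub>?P\<^esub> f \<in> carrier ?P" if "f \<in> carrier ?P" for c f
    by (rule cstar_prod_carrierI[OF _ n_smult[OF that]]) (use cl co that in \<open>simp del: cstar_prod_sel(1) restrict_apply add: restrict_PiE_iff\<close>)
  have c_adj: "f\<^sup>\<star>\<^bsub>?P\<^esub> \<in> carrier ?P" if "f \<in> carrier ?P" for f
    by (rule cstar_prod_carrierI[OF _ n_adj[OF that]]) (use cl co that in \<open>simp del: cstar_prod_sel(1) restrict_apply add: restrict_PiE_iff\<close>)
  have c_zero: "\<zero>\<^bsub>?P\<^esub> \<in> carrier ?P"
    by (rule cstar_prod_carrierI[where c = 0]) (use cl cstar_algebra.norm_zero[OF B] in auto)
  have ext: "f = g" if "f \<in> carrier ?P" "g \<in> carrier ?P" "\<And>i. i \<in> I \<Longrightarrow> f i = g i" for f g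
    using that by (auto intro: PiE_ext)
  have SP: "star_algebra ?P"
    by (rule star_algebra_reflect[where I = I and B = B and h = "\<lambda>i f. f i"])
      (use ext c_add c_mult c_smult c_adj c_zero SB star_hom_prod_coord[of _ I B]
        in \<open>simp_all del: cstar_prod_sel(1,3-7)\<close>)
  have minus: "(f \<ominus>\<^bsub>?P\<^esub> g) i = f i \<ominus>\<^bsub>B i\<^esub> g i" if "f \<in> carrier ?P" "g \<in> carrier ?P" "i \<in> I" for f g i
    by (rule star_hom_minus[OF SP SB star_hom_prod_coord]) fact+
  interpret P: star_algebra ?P by (rule SP)
  show ?thesis
  proof (intro cstar_algebra.intro[OF SP] cstar_algebra_axioms.intro)
    fix f assume f: "f \<in> carrier ?P"
    show "?n f = 0 \<longleftrightarrow> f = \<zero>\<^bsub>?P\<^esub>"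
    proof
      assume 0: "?n f = 0"
      show "f = \<zero>\<^bsub>?P\<^esub>"
      proof (rule ext[OF f c_zero])
        fix i assume i: "i \<in> I"
        have "\<parallel>f i\<parallel>\<^bsub>B i\<^esub> = 0"
          using up[OF f i] 0 cstar_algebra.norm_nonneg[OF B[OF i] co[OF f i]] by linarith
        then show "f i = \<zero>\<^bsub>?P\<^esub> i"
          using cstar_algebra.norm_eq_0[OF B[OF i] co[OF f i]] i by simp
      qed
    next
      assume z: "f = \<zero>\<^bsub>?P\<^esub>"
      have "?n f \<le> 0"
        by (rule cstar_prod_norm_least) (use z cstar_algebra.norm_zero[OF B] in auto)
      then show "?n f = 0" using nn[OF f] by linarith
    qed
    show "?n (c \<odot>\<^bsub>?P\<^esub> f) = cmod c * ?n f" for c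
    proof (rule antisym)
      show "?n (c \<odot>\<^bsub>?P\<^esub> f) \<le> cmod c * ?n f"
        by (rule cstar_prod_norm_least) (use n_smult[OF f] nn[OF f] in \<open>auto simp del: cstar_prod_sel\<close>)
      show "cmod c * ?n f \<le> ?n (c \<odot>\<^bsub>?P\<^esub> f)"
      proof (cases "c = 0")
        case False
        have "?n f \<le> ?n (c \<odot>\<^bsub>?P\<^esub> f) / cmod c"
        proof (rule cstar_prod_norm_least)
          fix i assume i: "i \<in> I"
          show "\<parallel>f i\<parallel>\<^bsub>B i\<^esub> \<le> ?n (c \<odot>\<^bsub>?P\<^esub> f) / cmod c"
            using up[OF c_smult[OF f] i, of c] cstar_algebra.norm_smult[OF B[OF i] co[OF f i], of c] False i
            by (simp del: cstar_prod_sel(1,7) add: field_simps)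
        qed (use nn[OF c_smult[OF f]] in \<open>simp del: cstar_prod_sel\<close>)
        then show ?thesis using False by (simp del: cstar_prod_sel add: field_simps)
      qed (use nn[OF c_smult[OF f]] in \<open>simp del: cstar_prod_sel\<close>)
    qed
    show "?n (f\<^sup>\<star>\<^bsub>?P\<^esub> \<otimes>\<^bsub>?P\<^esub> f) = (?n f)\<^sup>2"
    proof (rule antisym)
      have ci: "\<parallel>(f\<^sup>\<star>\<^bsub>?P\<^esub> \<otimes>\<^bsub>?P\<^esub> f) i\<parallel>\<^bsub>B i\<^esub> = \<parallel>f i\<parallel>\<^bsub>B i\<^esub>\<^sup>2" if "i \<in> I" for i
        using cstar_algebra.cstar_identity[OF B[OF that] co[OF f that]] that by simp
      show "?n (f\<^sup>\<star>\<^bsub>?P\<^esub> \<otimes>\<^bsub>?P\<^esub> f) \<le> (?n f)\<^sup>2"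
      proof (rule cstar_prod_norm_least)
        fix i assume i: "i \<in> I"
        show "\<parallel>(f\<^sup>\<star>\<^bsub>?P\<^esub> \<otimes>\<^bsub>?P\<^esub> f) i\<parallel>\<^bsub>B i\<^esub> \<le> (?n f)\<^sup>2"
          unfolding ci[OF i]
          by (rule power_mono[OF up[OF f i] cstar_algebra.norm_nonneg[OF B[OF i] co[OF f i]]])
      qed simp
      let ?N = "?n (f\<^sup>\<star>\<^bsub>?P\<^esub> \<otimes>\<^bsub>?P\<^esub> f)"
      have ff: "f\<^sup>\<star>\<^bsub>?P\<^esub> \<otimes>\<^bsub>?P\<^esub> f \<in> carrier ?P" by (rule c_mult[OF c_adj[OF f] f])
      have N: "0 \<le> ?N" by (rule nn[OF ff])
      have "?n f \<le> sqrt ?N"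
      proof (rule cstar_prod_norm_least)
        fix i assume i: "i \<in> I"
        show "\<parallel>f i\<parallel>\<^bsub>B i\<^esub> \<le> sqrt ?N"
          by (rule real_le_rsqrt) (use up[OF ff i] ci[OF i] in linarith)
      qed (use N in \<open>simp del: cstar_prod_sel\<close>)
      then have "(?n f)\<^sup>2 \<le> (sqrt ?N)\<^sup>2" by (rule power_mono[OF _ nn[OF f]])
      then show "(?n f)\<^sup>2 \<le> ?N" using N by simp
    qed
    fix g assume g: "g \<in> carrier ?P"
    show "?n (f \<oplus>\<^bsub>?P\<^esub> g) \<le> ?n f + ?n g"
      by (rule cstar_prod_norm_least[OF _ n_add[OF f g]]) (use nn[OF f] nn[OF g] in linarith)
    show "?n (f \<otimes>\<^bsub>?P\<^esub> g) \<le> ?n f * ?n g"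
      by (rule cstar_prod_norm_least[OF _ n_mult[OF f g]]) (use nn[OF f] nn[OF g] in \<open>rule mult_nonneg_nonneg\<close>)
  next
    fix X assume X: "\<And>n. X n \<in> carrier ?P" and C: "cstar_Cauchy ?P X"
    have Xi: "X n i \<in> carrier (B i)" if "i \<in> I" for n i using X co that by blast
    have mi: "X m \<ominus>\<^bsub>?P\<^esub> X n \<in> carrier ?P" for m n by (rule P.minus_closed[OF X X])
    have unif: "\<exists>M. \<forall>m\<ge>M. \<forall>n\<ge>M. \<forall>i\<in>I. \<parallel>X m i \<ominus>\<^bsub>B i\<^esub> X n i\<parallel>\<^bsub>B i\<^esub> < e" if e: "e > 0" for e
    proof -
      obtain M where M: "\<And>m n. m \<ge> M \<Longrightarrow> n \<ge> M \<Longrightarrow> ?n (X m \<ominus>\<^bsub>?P\<^esub> X n) < e"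
        using C e unfolding cstar_Cauchy_def by meson
      have "\<parallel>X m i \<ominus>\<^bsub>B i\<^esub> X n i\<parallel>\<^bsub>B i\<^esub> < e" if "m \<ge> M" "n \<ge> M" "i \<in> I" for m n i
        using M[OF that(1,2)] up[OF mi that(3), of m n] minus[OF X X that(3), of m n]
        by (simp del: cstar_prod_sel)
      then show ?thesis by blast
    qed
    have "\<exists>x\<in>carrier (B i). cstar_lim (B i) (\<lambda>n. X n i) x" if i: "i \<in> I" for i
    proof (rule cstar_algebra.complete[OF B[OF i] Xi[OF i]])
      show "cstar_Cauchy (B i) (\<lambda>n. X n i)"
        unfolding cstar_Cauchy_def using unif i by meson
    qed
    then obtain L where L: "\<And>i. i \<in> I \<Longrightarrow> L i \<in> carrier (B i)"
      "\<And>i. i \<in> I \<Longrightarrow> cstar_lim (B i) (\<lambda>n. X n i) (L i)" by metis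
    have lim: "\<exists>M. \<forall>n\<ge>M. \<forall>i\<in>I. \<parallel>X n i \<ominus>\<^bsub>B i\<^esub> L i\<parallel>\<^bsub>B i\<^esub> < e" if e: "e > 0" for e
    proof -
      obtain M where M: "\<And>m n i. m \<ge> M \<Longrightarrow> n \<ge> M \<Longrightarrow> i \<in> I \<Longrightarrow> \<parallel>X m i \<ominus>\<^bsub>B i\<^esub> X n i\<parallel>\<^bsub>B i\<^esub> < e/2"
        using unif[of "e/2"] e by auto
      have "\<parallel>X n i \<ominus>\<^bsub>B i\<^esub> L i\<parallel>\<^bsub>B i\<^esub> < e" if n: "n \<ge> M" and i: "i \<in> I" for n i
      proof -
        obtain K where K: "\<And>m. m \<ge> K \<Longrightarrow> \<bar>\<parallel>X m i \<ominus>\<^bsub>B i\<^esub> L i\<parallel>\<^bsub>B i\<^esub>\<bar> < e/2"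
          using L(2)[OF i] e unfolding cstar_lim_def LIMSEQ_iff
          by (metis half_gt_zero diff_zero real_norm_def)
        define m where "m = max M K"
        have "\<parallel>X n i \<ominus>\<^bsub>B i\<^esub> L i\<parallel>\<^bsub>B i\<^esub> \<le> \<parallel>X n i \<ominus>\<^bsub>B i\<^esub> X m i\<parallel>\<^bsub>B i\<^esub> + \<parallel>X m i \<ominus>\<^bsub>B i\<^esub> L i\<parallel>\<^bsub>B i\<^esub>"
          by (rule cstar_algebra.norm_dist_triangle[OF B[OF i] Xi[OF i] Xi[OF i] L(1)[OF i]])
        moreover have "\<parallel>X n i \<ominus>\<^bsub>B i\<^esub> X m i\<parallel>\<^bsub>B i\<^esub> < e/2" by (rule M) (use n i m_def in auto)
        moreover have "\<parallel>X m i \<ominus>\<^bsub>B i\<^esub> L i\<parallel>\<^bsub>B i\<^esub> < e/2" using K[of m] m_def by auto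
        ultimately show ?thesis by linarith
      qed
      then show ?thesis by blast
    qed
    define F where "F = (\<lambda>i\<in>I. L i)"
    obtain M where M: "\<And>i. i \<in> I \<Longrightarrow> \<parallel>X M i \<ominus>\<^bsub>B i\<^esub> L i\<parallel>\<^bsub>B i\<^esub> < 1" using lim[of 1] by auto
    have F: "F \<in> carrier ?P"
    proof (rule cstar_prod_carrierI)
      fix i assume i: "i \<in> I"
      have "\<parallel>L i\<parallel>\<^bsub>B i\<^esub> \<le> \<parallel>L i \<ominus>\<^bsub>B i\<^esub> X M i\<parallel>\<^bsub>B i\<^esub> + \<parallel>X M i\<parallel>\<^bsub>B i\<^esub>"
        by (rule cstar_algebra.norm_le_dist[OF B[OF i] L(1)[OF i] Xi[OF i]])
      then have "\<parallel>L i\<parallel>\<^bsub>B i\<^esub> \<le> 1 + ?n (X M)"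
        using M[OF i] up[OF X i, of M] cstar_algebra.norm_minus_commute[OF B[OF i] L(1)[OF i] Xi[OF i], of M]
        by linarith
      then show "\<parallel>F i\<parallel>\<^bsub>B i\<^esub> \<le> 1 + ?n (X M)" using i by (simp add: F_def del: cstar_prod_sel)
    qed (use L in \<open>auto simp: F_def\<close>)
    have "cstar_lim ?P X F"
      unfolding cstar_lim_def LIMSEQ_iff
    proof (intro allI impI)
      fix e :: real assume e: "e > 0"
      obtain M where M: "\<And>n i. n \<ge> M \<Longrightarrow> i \<in> I \<Longrightarrow> \<parallel>X n i \<ominus>\<^bsub>B i\<^esub> L i\<parallel>\<^bsub>B i\<^esub> < e/2"
        using lim[of "e/2"] e by auto
      have "\<bar>?n (X n \<ominus>\<^bsub>?P\<^esub> F)\<bar> < e" if n: "n \<ge> M" for n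
      proof -
        have "?n (X n \<ominus>\<^bsub>?P\<^esub> F) \<le> e/2"
        proof (rule cstar_prod_norm_least)
          fix i assume i: "i \<in> I"
          show "\<parallel>(X n \<ominus>\<^bsub>?P\<^esub> F) i\<parallel>\<^bsub>B i\<^esub> \<le> e/2"
            using M[OF n i] i minus[OF X F i, of n] by (simp add: F_def del: cstar_prod_sel)
        qed (use e in simp)
        then show ?thesis using e nn[OF P.minus_closed[OF X F], of n] by linarith
      qed
      then show "\<exists>no. \<forall>n\<ge>no. norm (?n (X n \<ominus>\<^bsub>?P\<^esub> F) - 0) < e" by auto
    qed
    with F show "\<exists>x\<in>carrier ?P. cstar_lim ?P X x" by blast
  qed
qed

lemma cstar_transport:
  fixes A :: "'a cstar" and j :: "'a \<Rightarrow> 'b"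
  assumes A: "cstar_algebra A" and j: "inj_on j (carrier A)"
  shows "\<exists>C :: 'b cstar. cstar_algebra C \<and> star_hom A C j \<and>
    star_hom C A (inv_into (carrier A) j) \<and> carrier C = j ` carrier A"
proof -
  interpret A: cstar_algebra A by fact
  define k where "k = inv_into (carrier A) j"
  have kj: "k (j x) = x" if "x \<in> carrier A" for x using that j by (simp add: k_def)
  define C :: "'b cstar" where "C =
    \<lparr>carrier = j ` carrier A,
     mult = (\<lambda>x y. j (k x \<otimes>\<^bsub>A\<^esub> k y)), one = j \<zero>\<^bsub>A\<^esub>, zero = j \<zero>\<^bsub>A\<^esub>,
     add = (\<lambda>x y. j (k x \<oplus>\<^bsub>A\<^esub> k y)), smult = (\<lambda>c x. j (c \<odot>\<^bsub>A\<^esub> k x)),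
     adj = (\<lambda>x. j ((k x)\<^sup>\<star>\<^bsub>A\<^esub>)), cnorm = (\<lambda>x. \<parallel>k x\<parallel>\<^bsub>A\<^esub>)\<rparr>"
  have C: "carrier C = j ` carrier A" "\<zero>\<^bsub>C\<^esub> = j \<zero>\<^bsub>A\<^esub>"
    "x \<oplus>\<^bsub>C\<^esub> y = j (k x \<oplus>\<^bsub>A\<^esub> k y)" "x \<otimes>\<^bsub>C\<^esub> y = j (k x \<otimes>\<^bsub>A\<^esub> k y)" "c \<odot>\<^bsub>C\<^esub> x = j (c \<odot>\<^bsub>A\<^esub> k x)"
    "x\<^sup>\<star>\<^bsub>C\<^esub> = j ((k x)\<^sup>\<star>\<^bsub>A\<^esub>)" "\<parallel>x\<parallel>\<^bsub>C\<^esub> = \<parallel>k x\<parallel>\<^bsub>A\<^esub>" for x y c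
    by (simp_all add: C_def)
  note cl = A.m_closed A.smult_closed A.adj_closed
  have hj: "star_hom A C j" by (auto simp: star_hom_def C kj)
  have hk: "star_hom C A k" by (auto simp: star_hom_def C kj cl)
  have SC: "star_algebra C"
    by (rule star_algebra_reflect[where I = "{()}" and B = "\<lambda>_. A" and h = "\<lambda>_. k"])
      (auto simp: A.star_algebra_axioms hk C kj cl)
  have kc: "k x \<in> carrier A" if "x \<in> carrier C" for x using that by (auto simp: C kj)
  have minus: "k (x \<ominus>\<^bsub>C\<^esub> y) = k x \<ominus>\<^bsub>A\<^esub> k y" if "x \<in> carrier C" "y \<in> carrier C" for x y
    by (rule star_hom_minus[OF SC A.star_algebra_axioms hk that])
  have "cstar_algebra C"
  proof (intro cstar_algebra.intro[OF SC] cstar_algebra_axioms.intro)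
    fix X assume X: "\<And>n. X n \<in> carrier C" and Ca: "cstar_Cauchy C X"
    have "cstar_Cauchy A (\<lambda>n. k (X n))"
      using Ca X by (simp add: cstar_Cauchy_def C(7) minus)
    then obtain x where x: "x \<in> carrier A" "cstar_lim A (\<lambda>n. k (X n)) x"
      using A.complete[of "\<lambda>n. k (X n)"] X kc by blast
    then have "j x \<in> carrier C" "cstar_lim C X (j x)"
      using X by (auto simp: cstar_lim_def C(7) minus C(1) kj)
    then show "\<exists>x\<in>carrier C. cstar_lim C X x" by blast
  qed (auto simp: C kj cl A.norm_eq_0 A.norm_triangle A.norm_smult A.norm_mult A.cstar_identity
      inj_on_eq_iff[OF j])
  with hj hk C(1) show ?thesis unfolding k_def by blast
qed

primrec poly_eval :: "'b cstar \<Rightarrow> 'g set \<Rightarrow> ('g \<Rightarrow> 'b) \<Rightarrow> 'g star_poly \<Rightarrow> 'b" where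
  "poly_eval A G \<rho> (PGen x) = (if x \<in> G then \<rho> x else \<zero>\<^bsub>A\<^esub>)"
| "poly_eval A G \<rho> PZero = \<zero>\<^bsub>A\<^esub>"
| "poly_eval A G \<rho> (PAdd t u) = poly_eval A G \<rho> t \<oplus>\<^bsub>A\<^esub> poly_eval A G \<rho> u"
| "poly_eval A G \<rho> (PMult t u) = poly_eval A G \<rho> t \<otimes>\<^bsub>A\<^esub> poly_eval A G \<rho> u"
| "poly_eval A G \<rho> (PSmult c t) = c \<odot>\<^bsub>A\<^esub> poly_eval A G \<rho> t"
| "poly_eval A G \<rho> (PAdj t) = (poly_eval A G \<rho> t)\<^sup>\<star>\<^bsub>A\<^esub>"

context cstar_algebra begin

lemma poly_eval_closed: "\<rho> \<in> G \<rightarrow> carrier A \<Longrightarrow> poly_eval A G \<rho> t \<in> carrier A"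
  by (induction t) (auto simp: m_closed smult_closed adj_closed)

lemma minus_self: "x \<in> carrier A \<Longrightarrow> x \<ominus> x = \<zero>"
  by (simp add: a_minus_def r_neg)

lemma minus_add_add:
  "\<lbrakk>x \<in> carrier A; y \<in> carrier A; u \<in> carrier A; v \<in> carrier A\<rbrakk> \<Longrightarrow>
    (x \<oplus> y) \<ominus> (u \<oplus> v) = (x \<ominus> u) \<oplus> (y \<ominus> v)"
  by (simp add: a_minus_def minus_add a_ac)

lemma smult_minus: "\<lbrakk>x \<in> carrier A; y \<in> carrier A\<rbrakk> \<Longrightarrow> c \<odot> (x \<ominus> y) = c \<odot> x \<ominus> c \<odot> y"
  by (simp add: minus_smult smult_closed smult_r_distr smult_assoc[symmetric] mult.commute)

lemma adj_minus: "\<lbrakk>x \<in> carrier A; y \<in> carrier A\<rbrakk> \<Longrightarrow> (x \<ominus> y)\<^sup>\<star> = x\<^sup>\<star> \<ominus> y\<^sup>\<star>"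
  by (simp add: minus_smult smult_closed adj_closed adj_add adj_smult)

lemma mult_minus_mult:
  assumes "x \<in> carrier A" "y \<in> carrier A" "u \<in> carrier A" "v \<in> carrier A"
  shows "x \<otimes> y \<ominus> u \<otimes> v = (x \<otimes> (y \<ominus> v)) \<oplus> ((x \<ominus> u) \<otimes> v)"
proof -
  have "x \<otimes> (y \<ominus> v) = x \<otimes> y \<ominus> x \<otimes> v" "(x \<ominus> u) \<otimes> v = x \<otimes> v \<ominus> u \<otimes> v"
    using assms by (simp_all add: minus_smult smult_closed m_closed l_distr r_distr smult_m_l smult_m_r)
  then show ?thesis
    using assms by (simp add: a_minus_def m_closed a_assoc r_neg1)
qed

lemma poly_dense:
  assumes \<rho>: "\<rho> \<in> G \<rightarrow> carrier A" and "b \<in> cstar_span A (\<rho> ` G)" and "e > 0"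
  shows "\<exists>t. \<parallel>b \<ominus> poly_eval A G \<rho> t\<parallel> < e"
proof -
  let ?v = "poly_eval A G \<rho>"
  note v = poly_eval_closed[OF \<rho>]
  have G: "\<rho> ` G \<subseteq> carrier A" using \<rho> by auto
  note sp = subsetD[OF cstar_span_closed[OF G]]
  show ?thesis using assms(2,3)
  proof (induction arbitrary: e)
    case (gen x)
    then obtain g where "g \<in> G" "x = \<rho> g" by auto
    with gen funcset_mem[OF \<rho>] show ?case
      by (intro exI[of _ "PGen g"]) (simp add: minus_self norm_zero)
  next
    case zero
    then show ?case by (intro exI[of _ PZero]) (simp add: minus_self norm_zero)
  next
    case (add x y)
    obtain t u where "\<parallel>x \<ominus> ?v t\<parallel> < e/2" "\<parallel>y \<ominus> ?v u\<parallel> < e/2"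
      using add.IH(1)[of "e/2"] add.IH(2)[of "e/2"] add.prems by auto
    moreover have "\<parallel>(x \<oplus> y) \<ominus> (?v t \<oplus> ?v u)\<parallel> \<le> \<parallel>x \<ominus> ?v t\<parallel> + \<parallel>y \<ominus> ?v u\<parallel>"
      using add.hyps[THEN sp] v by (simp add: minus_add_add norm_triangle)
    ultimately show ?case by (intro exI[of _ "PAdd t u"]) simp
  next
    case (mult x y)
    note xy = mult.hyps[THEN sp]
    define c where "c = \<parallel>x\<parallel> + \<parallel>y\<parallel> + 1"
    have c: "c > 0" using norm_nonneg[OF xy(1)] norm_nonneg[OF xy(2)] by (simp add: c_def)
    define d where "d = min 1 (e / c)"
    have d: "0 < d" "d \<le> 1" "d * c \<le> e" using c mult.prems by (auto simp: d_def min_def field_simps)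
    obtain t u where tu: "\<parallel>x \<ominus> ?v t\<parallel> < d" "\<parallel>y \<ominus> ?v u\<parallel> < d"
      using mult.IH(1)[OF d(1)] mult.IH(2)[OF d(1)] by auto
    have "\<parallel>x \<otimes> y \<ominus> ?v t \<otimes> ?v u\<parallel> \<le> \<parallel>x \<otimes> (y \<ominus> ?v u)\<parallel> + \<parallel>(x \<ominus> ?v t) \<otimes> ?v u\<parallel>"
      using xy v by (simp add: mult_minus_mult norm_triangle m_closed)
    also have "\<dots> \<le> \<parallel>x\<parallel> * \<parallel>y \<ominus> ?v u\<parallel> + \<parallel>x \<ominus> ?v t\<parallel> * \<parallel>?v u\<parallel>"
      using xy v by (intro add_mono norm_mult) auto
    also have "\<dots> \<le> \<parallel>x\<parallel> * d + \<parallel>x \<ominus> ?v t\<parallel> * (\<parallel>y\<parallel> + 1)"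
    proof (intro add_mono mult_left_mono)
      show "\<parallel>?v u\<parallel> \<le> \<parallel>y\<parallel> + 1"
        using norm_le_dist[OF v xy(2), of u] norm_minus_commute[OF v xy(2), of u] tu(2) d(2) by linarith
    qed (use tu xy v norm_nonneg in auto)
    also have "\<dots> < d * c"
    proof -
      have "\<parallel>x \<ominus> ?v t\<parallel> * (\<parallel>y\<parallel> + 1) < d * (\<parallel>y\<parallel> + 1)"
        using tu(1) norm_nonneg[OF xy(2)] by (intro mult_strict_right_mono) auto
      then show ?thesis by (simp add: c_def algebra_simps)
    qed
    finally show ?case using d(3) by (intro exI[of _ "PMult t u"]) simp
  next
    case (smult x c)
    obtain t where t: "\<parallel>x \<ominus> ?v t\<parallel> < e / (cmod c + 1)"
      using smult.IH[of "e / (cmod c + 1)"] smult.prems by (auto simp: add_nonneg_pos)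
    have "\<parallel>c \<odot> x \<ominus> c \<odot> ?v t\<parallel> = cmod c * \<parallel>x \<ominus> ?v t\<parallel>"
      using smult.hyps[THEN sp] v by (simp add: smult_minus[symmetric] norm_smult)
    also have "\<dots> \<le> (cmod c + 1) * \<parallel>x \<ominus> ?v t\<parallel>"
      using smult.hyps[THEN sp] v by (intro mult_right_mono norm_nonneg) auto
    also have "\<dots> < e"
      using t pos_less_divide_eq[of "cmod c + 1"] norm_ge_zero[of c] by (simp add: mult.commute)
    finally show ?case by (intro exI[of _ "PSmult c t"]) simp
  next
    case (adj x)
    then obtain t where "\<parallel>x \<ominus> ?v t\<parallel> < e" by auto
    then show ?case using adj.hyps[THEN sp] v
      by (intro exI[of _ "PAdj t"]) (simp add: adj_minus[symmetric] norm_adj)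
  next
    case (lim X x)
    obtain n where n: "\<parallel>X n \<ominus> x\<parallel> < e/2"
    proof -
      have "eventually (\<lambda>n. \<parallel>X n \<ominus> x\<parallel> < e/2) sequentially"
        using lim.hyps(3) lim.prems unfolding cstar_lim_def by (intro order_tendstoD(2)) auto
      then show ?thesis using that by (auto simp: eventually_sequentially)
    qed
    obtain t where t: "\<parallel>X n \<ominus> ?v t\<parallel> < e/2" using lim.IH[of "e/2"] lim.prems by auto
    have Xn: "X n \<in> carrier A" using lim.hyps(1) sp by blast
    show ?case
      using norm_dist_triangle[OF lim.hyps(2) Xn v, of t] norm_minus_commute[OF lim.hyps(2) Xn] n t
      by (intro exI[of _ t]) linarith
  qed
qed

lemma dist_poly_inj:
  assumes \<rho>: "\<rho> \<in> G \<rightarrow> carrier A"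
  shows "inj_on (\<lambda>b t. \<parallel>b \<ominus> poly_eval A G \<rho> t\<parallel>) (cstar_span A (\<rho> ` G))"
proof (rule inj_onI)
  fix b c assume bc: "b \<in> cstar_span A (\<rho> ` G)" "c \<in> cstar_span A (\<rho> ` G)"
    and eq: "(\<lambda>t. \<parallel>b \<ominus> poly_eval A G \<rho> t\<parallel>) = (\<lambda>t. \<parallel>c \<ominus> poly_eval A G \<rho> t\<parallel>)"
  note v = poly_eval_closed[OF \<rho>]
  have G: "\<rho> ` G \<subseteq> carrier A" using \<rho> by auto
  note cc = bc[THEN subsetD[OF cstar_span_closed[OF G]]]
  have "\<parallel>b \<ominus> c\<parallel> \<le> e" if e: "e > 0" for e
  proof -
    obtain t where t: "\<parallel>b \<ominus> poly_eval A G \<rho> t\<parallel> < e/2" using poly_dense[OF \<rho> bc(1), of "e/2"] e by auto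
    then have "\<parallel>c \<ominus> poly_eval A G \<rho> t\<parallel> < e/2" using fun_cong[OF eq, of t] by simp
    then show ?thesis
      using t norm_dist_triangle[OF cc(1) v cc(2), of t] norm_minus_commute[OF cc(2) v, of t] by simp
  qed
  then have "\<parallel>b \<ominus> c\<parallel> \<le> 0" by (rule field_le_epsilon[of _ 0, simplified])
  then have "b \<ominus> c = \<zero>" using norm_nonneg[of "b \<ominus> c"] norm_eq_0[of "b \<ominus> c"] cc by simp
  then show "b = c" using cc by (metis a_minus_def add.inv_closed l_neg l_zero r_zero a_assoc)
qed

end

theorem universal_cstar_hom:
  fixes B :: "'b cstar" and \<rho> :: "'g \<Rightarrow> 'b"
  assumes B: "cstar_algebra B" and \<rho>: "\<rho> \<in> G \<rightarrow> carrier B"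
    and bdd: "universal_gen G Rep ` G \<subseteq> carrier (cstar_prod (reps G Rep) fst)"
    and rep: "\<And>C j. \<lbrakk>cstar_algebra C; star_hom (cstar_generated B (\<rho> ` G)) C j\<rbrakk> \<Longrightarrow> Rep C (j \<circ> \<rho>)"
  shows "\<exists>h. star_hom (universal_cstar G Rep) B h \<and> (\<forall>x\<in>G. h (universal_gen G Rep x) = \<rho> x)"
proof -
  interpret B: cstar_algebra B by fact
  have G: "\<rho> ` G \<subseteq> carrier B" using \<rho> by auto
  let ?B0 = "cstar_generated B (\<rho> ` G)" and ?U = "universal_cstar G Rep"
  have B0: "cstar_algebra ?B0" by (rule cstar_generated_algebra[OF B G])
  have P: "cstar_algebra (cstar_prod (reps G Rep) fst)"
    by (rule cstar_prod_algebra) (auto simp: reps_def)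
  obtain j :: "'b \<Rightarrow> 'g universe" where j: "inj_on j (carrier ?B0)"
    using B.dist_poly_inj[OF \<rho>] by auto
  let ?k = "inv_into (carrier ?B0) j"
  obtain C :: "'g universe cstar" where C: "cstar_algebra C" "star_hom ?B0 C j" "star_hom C ?B0 ?k"
    "carrier C = j ` carrier ?B0"
    using cstar_transport[OF B0 j] by blast
  have \<rho>0: "\<rho> x \<in> carrier ?B0" if "x \<in> G" for x using that by (auto intro: cstar_span.gen)
  have i: "(C, j \<circ> \<rho>) \<in> reps G Rep"
    using C rep[OF C(1,2)] \<rho>0 by (auto simp: reps_def)
  let ?h = "\<lambda>f. ?k (f (C, j \<circ> \<rho>))"
  have sub: "cstar_span (cstar_prod (reps G Rep) fst) (universal_gen G Rep ` G)
      \<subseteq> carrier (cstar_prod (reps G Rep) fst)"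
    by (rule cstar_algebra.cstar_span_closed[OF P bdd])
  have h1: "star_hom ?U (cstar_prod (reps G Rep) fst) (\<lambda>f. f)"
    unfolding universal_cstar_def by (rule star_hom_generated_incl[OF P bdd])
  have h2: "star_hom (cstar_prod (reps G Rep) fst) C (\<lambda>f. f (C, j \<circ> \<rho>))"
    using star_hom_prod_coord[OF i, of fst] by simp
  have h3: "star_hom ?B0 B (\<lambda>x. x)" by (rule star_hom_generated_incl[OF B G])
  have "star_hom ?U B ?h"
    using star_hom_comp[OF star_hom_comp[OF star_hom_comp[OF h1 h2] C(3)] h3] .
  moreover have "?h (universal_gen G Rep x) = \<rho> x" if "x \<in> G" for x
    using that i \<rho>0[OF that] j by (simp add: universal_gen_def)
  ultimately show ?thesis by blast
qed

theorem universal_cstar_generated: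
  assumes bdd: "universal_gen G Rep ` G \<subseteq> carrier (cstar_prod (reps G Rep) fst)"
  shows "cstar_algebra (universal_cstar G Rep)"
    and "universal_gen G Rep ` G \<subseteq> carrier (universal_cstar G Rep)"
    and "cstar_span (universal_cstar G Rep) (universal_gen G Rep ` G) = carrier (universal_cstar G Rep)"
    and "\<And>i. i \<in> reps G Rep \<Longrightarrow> star_hom (universal_cstar G Rep) (fst i) (\<lambda>f. f i)"
    and "\<And>x y. \<lbrakk>x \<in> carrier (universal_cstar G Rep); y \<in> carrier (universal_cstar G Rep);
      \<And>i. i \<in> reps G Rep \<Longrightarrow> x i = y i\<rbrakk> \<Longrightarrow> x = y"
proof -
  let ?P = "cstar_prod (reps G Rep) fst" and ?U = "universal_cstar G Rep"
  let ?g = "universal_gen G Rep ` G"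
  have P: "cstar_algebra ?P"
    by (rule cstar_prod_algebra) (clarsimp simp: reps_def)
  show U: "cstar_algebra ?U"
    unfolding universal_cstar_def by (rule cstar_generated_algebra[OF P bdd])
  show gU: "?g \<subseteq> carrier ?U"
    unfolding universal_cstar_def cstar_generated_sel by (rule subsetI) (rule cstar_span.gen)
  have h1: "star_hom ?U ?P (\<lambda>f. f)"
    unfolding universal_cstar_def by (rule star_hom_generated_incl[OF P bdd])
  have minus: "x \<ominus>\<^bsub>?U\<^esub> y = x \<ominus>\<^bsub>?P\<^esub> y" if "x \<in> carrier ?U" "y \<in> carrier ?U" for x y
    by (rule star_hom_minus[OF cstar_algebra.axioms(1)[OF U] cstar_algebra.axioms(1)[OF P] h1 that])
  show "star_hom ?U (fst i) (\<lambda>f. f i)" if "i \<in> reps G Rep" for i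
    using star_hom_comp[OF h1 star_hom_prod_coord[OF that, of fst]] .
  show "x = y" if "x \<in> carrier ?U" "y \<in> carrier ?U" "\<And>i. i \<in> reps G Rep \<Longrightarrow> x i = y i" for x y
  proof (rule PiE_ext)
    show "x \<in> (\<Pi>\<^sub>E i\<in>reps G Rep. carrier (fst i))" using star_homD(1)[OF h1 that(1)] by simp
    show "y \<in> (\<Pi>\<^sub>E i\<in>reps G Rep. carrier (fst i))" using star_homD(1)[OF h1 that(2)] by simp
  qed (rule that(3))
  have ops: "zero ?P = zero ?U" "add ?P = add ?U" "mult ?P = mult ?U" "smult ?P = smult ?U"
    "adj ?P = adj ?U" "cnorm ?P = cnorm ?U"
    by (simp_all add: universal_cstar_def del: cstar_prod_sel)
  have car: "carrier ?U = cstar_span ?P ?g" by (simp add: universal_cstar_def)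
  show "cstar_span ?U ?g = carrier ?U"
  proof
    show "cstar_span ?U ?g \<subseteq> carrier ?U" by (rule cstar_algebra.cstar_span_closed[OF U gU])
    show "carrier ?U \<subseteq> cstar_span ?U ?g"
    proof
      fix x assume "x \<in> carrier ?U"
      then have "x \<in> cstar_span ?P ?g" by (simp only: car)
      then show "x \<in> cstar_span ?U ?g"
      proof induction
        case (gen x) then show ?case by (rule cstar_span.gen)
      next
        case zero show ?case unfolding ops by (rule cstar_span.zero)
      next
        case (add x y) show ?case unfolding ops by (rule cstar_span.add) fact+
      next
        case (mult x y) show ?case unfolding ops by (rule cstar_span.mult) fact+
      next
        case (smult x c) show ?case unfolding ops by (rule cstar_span.smult) fact
      next
        case (adj x) show ?case unfolding ops by (rule cstar_span.adj) fact
      next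
        case (lim X x)
        have X: "X n \<in> carrier ?U" for n unfolding car by (rule lim.hyps(1))
        have x: "x \<in> carrier ?U" unfolding car by (rule cstar_span.lim[OF lim.hyps])
        have "cstar_lim ?U X x"
          using lim.hyps(3) unfolding cstar_lim_def minus[OF X x] ops .
        then show ?case by (rule cstar_span.lim[OF lim.IH x])
      qed
    qed
  qed
qed

lemma projection_hom:
  assumes h: "star_hom A B h" and p: "projection A p"
  shows "projection B (h p)"
  using p star_homD(1)[OF h, of p] star_homD(3)[OF h, of p p] star_homD(5)[OF h, of p]
  by (simp add: projection_def)

lemma partial_isometry_hom:
  assumes A: "star_algebra A" and h: "star_hom A B h" and s: "partial_isometry A s"
  shows "partial_isometry B (h s)"
proof -
  interpret A: star_algebra A by fact
  have s': "s \<in> carrier A" "s \<otimes>\<^bsub>A\<^esub> s\<^sup>\<star>\<^bsub>A\<^esub> \<otimes>\<^bsub>A\<^esub> s = s"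
    using s by (auto simp: partial_isometry_def)
  have "h (s \<otimes>\<^bsub>A\<^esub> s\<^sup>\<star>\<^bsub>A\<^esub> \<otimes>\<^bsub>A\<^esub> s) = h s \<otimes>\<^bsub>B\<^esub> (h s)\<^sup>\<star>\<^bsub>B\<^esub> \<otimes>\<^bsub>B\<^esub> h s"
    using s'(1) by (simp add: star_homD[OF h] A.m_closed A.adj_closed)
  then show ?thesis using s' star_homD(1)[OF h] by (simp add: partial_isometry_def)
qed

lemma subprojection_hom:
  assumes h: "star_hom A B h" and s: "subprojection A q p"
  shows "subprojection B (h q) (h p)"
proof -
  have "h (p \<otimes>\<^bsub>A\<^esub> q) = h p \<otimes>\<^bsub>B\<^esub> h q"
    using s by (intro star_homD(3)[OF h]) (auto simp: subprojection_def projection_def)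
  then show ?thesis using s projection_hom[OF h] by (simp add: subprojection_def)
qed

lemma Pi_memD: "f \<in> I \<rightarrow> A \<Longrightarrow> i \<in> I \<Longrightarrow> f i \<in> A" by auto

locale jointly_injective =
  fixes A :: "'a cstar" and I :: "'i set" and B :: "'i \<Rightarrow> 'b cstar" and h :: "'i \<Rightarrow> 'a \<Rightarrow> 'b"
  assumes A: "star_algebra A" and B: "\<And>i. i \<in> I \<Longrightarrow> star_algebra (B i)"
    and hom: "\<And>i. i \<in> I \<Longrightarrow> star_hom A (B i) (h i)"
    and inj: "\<And>x y. \<lbrakk>x \<in> carrier A; y \<in> carrier A; \<And>i. i \<in> I \<Longrightarrow> h i x = h i y\<rbrakk> \<Longrightarrow> x = y"
begin

interpretation A: star_algebra A by (rule A)

lemmas h = star_homD[OF hom] star_hom_zero[OF A B hom] star_hom_minus[OF A B hom]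
  star_hom_finsum[OF A B hom]
lemmas cl = A.m_closed A.adj_closed A.smult_closed A.a_closed A.minus_closed A.zero_closed

lemma projection_refl:
  "\<lbrakk>p \<in> carrier A; \<And>i. i \<in> I \<Longrightarrow> projection (B i) (h i p)\<rbrakk> \<Longrightarrow> projection A p"
  unfolding projection_def by (auto intro!: inj simp: cl h)

lemma partial_isometry_refl:
  "\<lbrakk>s \<in> carrier A; \<And>i. i \<in> I \<Longrightarrow> partial_isometry (B i) (h i s)\<rbrakk> \<Longrightarrow> partial_isometry A s"
  unfolding partial_isometry_def by (auto intro!: inj simp: cl h)

lemma subprojection_refl:
  "\<lbrakk>p \<in> carrier A; q \<in> carrier A; \<And>i. i \<in> I \<Longrightarrow> subprojection (B i) (h i q) (h i p)\<rbrakk> \<Longrightarrow>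
    subprojection A q p"
  unfolding subprojection_def by (auto intro!: inj projection_refl simp: cl h)

lemma cuntz_krieger_refl:
  assumes E: "wf_digraph E" and p: "p \<in> verts E \<rightarrow> carrier A" and s: "s \<in> arcs E \<rightarrow> carrier A"
    and ck: "\<And>i. i \<in> I \<Longrightarrow> cuntz_krieger_family E (B i) (\<lambda>v. h i (p v)) (\<lambda>e. h i (s e))"
  shows "cuntz_krieger_family E A p s"
proof -
  note pc = Pi_memD[OF p] and sc = Pi_memD[OF s]
  note wf = wf_digraph.tail_in_verts[OF E] wf_digraph.head_in_verts[OF E]
  note c = ck[unfolded cuntz_krieger_family_def]
  have oa: "e \<in> arcs E" if "e \<in> out_arcs E v" for e v using that by auto
  show ?thesis
    unfolding cuntz_krieger_family_def
  proof (intro conjI ballI impI)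
    fix v assume "v \<in> verts E"
    then show "projection A (p v)" by (intro projection_refl) (use pc c in auto)
    fix w assume "w \<in> verts E" "v \<noteq> w"
    with \<open>v \<in> verts E\<close> show "p v \<otimes>\<^bsub>A\<^esub> p w = \<zero>\<^bsub>A\<^esub>"
      by (intro inj) (use pc c in \<open>simp_all add: cl h\<close>)
  next
    fix e assume e: "e \<in> arcs E"
    then show "partial_isometry A (s e)" by (intro partial_isometry_refl) (use sc c in auto)
    show "(s e)\<^sup>\<star>\<^bsub>A\<^esub> \<otimes>\<^bsub>A\<^esub> s e = p (head E e)"
      by (rule inj) (use e sc pc wf c in \<open>simp_all add: cl h\<close>)
    show "subprojection A (s e \<otimes>\<^bsub>A\<^esub> (s e)\<^sup>\<star>\<^bsub>A\<^esub>) (p (tail E e))"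
      by (rule subprojection_refl) (use e sc pc wf c in \<open>simp_all add: cl h\<close>)
    fix f assume "f \<in> arcs E" "e \<noteq> f"
    then show "(s e \<otimes>\<^bsub>A\<^esub> (s e)\<^sup>\<star>\<^bsub>A\<^esub>) \<otimes>\<^bsub>A\<^esub> (s f \<otimes>\<^bsub>A\<^esub> (s f)\<^sup>\<star>\<^bsub>A\<^esub>) = \<zero>\<^bsub>A\<^esub>"
      using e by (intro inj) (use sc c in \<open>simp_all add: cl h\<close>)
  next
    fix v assume v: "v \<in> verts E" and fin: "finite (out_arcs E v) \<and> out_arcs E v \<noteq> {}"
    let ?f = "\<lambda>e. s e \<otimes>\<^bsub>A\<^esub> (s e)\<^sup>\<star>\<^bsub>A\<^esub>"
    have f: "?f \<in> out_arcs E v \<rightarrow> carrier A" using sc oa by (auto simp: cl)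
    show "p v = finsum A ?f (out_arcs E v)"
    proof (rule inj)
      fix i assume i: "i \<in> I"
      interpret Bi: star_algebra "B i" by (rule B[OF i])
      have "h i (p v) = (\<Oplus>\<^bsub>B i\<^esub>e\<in>out_arcs E v. h i (s e) \<otimes>\<^bsub>B i\<^esub> (h i (s e))\<^sup>\<star>\<^bsub>B i\<^esub>)"
        using c[OF i] v fin by blast
      also have "\<dots> = (\<Oplus>\<^bsub>B i\<^esub>e\<in>out_arcs E v. h i (?f e))"
        by (rule Bi.finsum_cong') (use sc oa i in \<open>auto simp: cl h Bi.m_closed Bi.adj_closed\<close>)
      finally show "h i (p v) = h i (finsum A ?f (out_arcs E v))" using f i by (simp add: h)
    qed (use pc v f in auto)
  qed
qed

lemma labelled_representation_refl:
  assumes \<C>: "accommodating E lab \<C>"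
    and p: "p \<in> \<C> \<rightarrow> carrier A" and s: "s \<in> letters E lab \<rightarrow> carrier A"
    and lr: "\<And>i. i \<in> I \<Longrightarrow> labelled_representation E lab \<C> (B i) (\<lambda>X. h i (p X)) (\<lambda>a. h i (s a))"
  shows "labelled_representation E lab \<C> A p s"
proof -
  note pc = Pi_memD[OF p] and sc = Pi_memD[OF s]
  note c = lr[unfolded labelled_representation_def]
  have acc: "X \<inter> Y \<in> \<C>" "X \<union> Y \<in> \<C>" if "X \<in> \<C>" "Y \<in> \<C>" for X Y
    using \<C> that by (auto simp: accommodating_def)
  have rr: "rel_rng E lab X [a] \<in> \<C>" if "X \<in> \<C>" "a \<in> letters E lab" for X a
    using \<C> that by (auto simp: accommodating_def letters_def)
  have wr: "word_rng E lab [a] \<in> \<C>" if "a \<in> letters E lab" for a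
    using \<C> that by (auto simp: accommodating_def letters_def)
  have lf: "a \<in> letters E lab" if "a \<in> letters_from E lab X" for a X
    using that by (simp add: letters_from_def)
  show ?thesis
    unfolding labelled_representation_def
  proof (intro conjI ballI impI)
    fix X assume X: "X \<in> \<C>"
    then show "projection A (p X)" by (intro projection_refl) (use pc c in auto)
    fix Y assume "Y \<in> \<C>"
    with X show "p X \<otimes>\<^bsub>A\<^esub> p Y = p (X \<inter> Y)"
      by (intro inj) (use pc c acc in \<open>simp_all add: cl h\<close>)
    show "p (X \<union> Y) = (p X \<oplus>\<^bsub>A\<^esub> p Y) \<ominus>\<^bsub>A\<^esub> p (X \<inter> Y)"
      using X \<open>Y \<in> \<C>\<close> by (intro inj) (use pc c acc in \<open>simp_all add: cl h\<close>)
  next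
    fix X a assume "X \<in> \<C>" "a \<in> letters E lab"
    then show "p X \<otimes>\<^bsub>A\<^esub> s a = s a \<otimes>\<^bsub>A\<^esub> p (rel_rng E lab X [a])"
      by (intro inj) (use pc sc rr c in \<open>simp_all add: cl h\<close>)
  next
    assume "{} \<in> \<C>"
    then show "p {} = \<zero>\<^bsub>A\<^esub>" by (intro inj) (use pc c in \<open>simp_all add: cl h\<close>)
  next
    fix a assume a: "a \<in> letters E lab"
    then show "partial_isometry A (s a)" by (intro partial_isometry_refl) (use sc c in auto)
    show "(s a)\<^sup>\<star>\<^bsub>A\<^esub> \<otimes>\<^bsub>A\<^esub> s a = p (word_rng E lab [a])"
      by (rule inj) (use a sc pc wr c in \<open>simp_all add: cl h\<close>)
    fix b assume "b \<in> letters E lab" "a \<noteq> b"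
    then show "(s a)\<^sup>\<star>\<^bsub>A\<^esub> \<otimes>\<^bsub>A\<^esub> s b = \<zero>\<^bsub>A\<^esub>"
      using a by (intro inj) (use sc c in \<open>simp_all add: cl h\<close>)
  next
    fix X assume X: "X \<in> \<C>" and fin: "finite (letters_from E lab X) \<and> letters_from E lab X \<noteq> {}
      \<and> X \<inter> sinks E = {}"
    let ?r = "\<lambda>a. rel_rng E lab X [a]"
    let ?f = "\<lambda>a. s a \<otimes>\<^bsub>A\<^esub> p (?r a) \<otimes>\<^bsub>A\<^esub> (s a)\<^sup>\<star>\<^bsub>A\<^esub>"
    have sp: "s a \<in> carrier A" "p (?r a) \<in> carrier A" if "a \<in> letters_from E lab X" for a
      using sc pc lf[OF that] rr[OF X] by auto
    have f: "?f \<in> letters_from E lab X \<rightarrow> carrier A" using sp by (auto simp: cl)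
    show "p X = finsum A ?f (letters_from E lab X)"
    proof (rule inj)
      fix i assume i: "i \<in> I"
      interpret Bi: star_algebra "B i" by (rule B[OF i])
      have "h i (p X) = (\<Oplus>\<^bsub>B i\<^esub>a\<in>letters_from E lab X.
          h i (s a) \<otimes>\<^bsub>B i\<^esub> h i (p (?r a)) \<otimes>\<^bsub>B i\<^esub> (h i (s a))\<^sup>\<star>\<^bsub>B i\<^esub>)"
        using c[OF i] X fin by blast
      also have "\<dots> = (\<Oplus>\<^bsub>B i\<^esub>a\<in>letters_from E lab X. h i (?f a))"
        by (rule Bi.finsum_cong') (use sp i in \<open>auto simp: cl h Bi.m_closed Bi.adj_closed\<close>)
      finally show "h i (p X) = h i (finsum A ?f (letters_from E lab X))" using f i by (simp add: h)
    qed (use pc X f in auto)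
  qed
qed

end

lemma cuntz_krieger_closed:
  assumes "cuntz_krieger_family E A p s"
  shows "p \<in> verts E \<rightarrow> carrier A" "s \<in> arcs E \<rightarrow> carrier A"
  using assms by (auto simp: cuntz_krieger_family_def projection_def partial_isometry_def)

lemma labelled_representation_closed:
  assumes "labelled_representation E lab \<C> A p s"
  shows "p \<in> \<C> \<rightarrow> carrier A" "s \<in> letters E lab \<rightarrow> carrier A"
  using assms by (auto simp: labelled_representation_def projection_def partial_isometry_def)

lemma cuntz_krieger_hom:
  assumes A: "star_algebra A" and B: "star_algebra B" and hom: "star_hom A B h"
    and E: "wf_digraph E" and ck: "cuntz_krieger_family E A p s"
  shows "cuntz_krieger_family E B (\<lambda>v. h (p v)) (\<lambda>e. h (s e))"
proof -
  interpret A: star_algebra A by fact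
  interpret B: star_algebra B by fact
  note h = star_homD[OF hom] star_hom_zero[OF A B hom] star_hom_minus[OF A B hom]
    star_hom_finsum[OF A B hom]
  note cl = A.m_closed A.adj_closed A.smult_closed A.a_closed A.minus_closed A.zero_closed
  note pc = Pi_memD[OF cuntz_krieger_closed(1)[OF ck]] and sc = Pi_memD[OF cuntz_krieger_closed(2)[OF ck]]
  note wf = wf_digraph.tail_in_verts[OF E] wf_digraph.head_in_verts[OF E]
  note c = ck[unfolded cuntz_krieger_family_def]
  have oa: "e \<in> arcs E" if "e \<in> out_arcs E v" for e v using that by auto
  have [simp]: "h x \<otimes>\<^bsub>B\<^esub> h y = h (x \<otimes>\<^bsub>A\<^esub> y)"
    if "x \<in> carrier A" "y \<in> carrier A" for x y using that h by auto
  have [simp]: "(h x)\<^sup>\<star>\<^bsub>B\<^esub> = h (x\<^sup>\<star>\<^bsub>A\<^esub>)" if "x \<in> carrier A" for x using that h by auto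
  show ?thesis
    unfolding cuntz_krieger_family_def
  proof (intro conjI ballI impI)
    fix v assume "v \<in> verts E" then show "projection B (h (p v))" by (intro projection_hom[OF hom]) (use c in auto)
    fix w assume "w \<in> verts E" "v \<noteq> w"
    with \<open>v \<in> verts E\<close> show "h (p v) \<otimes>\<^bsub>B\<^esub> h (p w) = \<zero>\<^bsub>B\<^esub>" using pc c h by simp
  next
    fix e assume e: "e \<in> arcs E"
    then show "partial_isometry B (h (s e))" by (intro partial_isometry_hom[OF A hom]) (use c in auto)
    show "(h (s e))\<^sup>\<star>\<^bsub>B\<^esub> \<otimes>\<^bsub>B\<^esub> h (s e) = h (p (head E e))"
      using e sc c by (simp add: cl)
    show "subprojection B (h (s e) \<otimes>\<^bsub>B\<^esub> (h (s e))\<^sup>\<star>\<^bsub>B\<^esub>) (h (p (tail E e)))"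
      using subprojection_hom[OF hom] e sc c by (simp add: cl)
    fix f assume "f \<in> arcs E" "e \<noteq> f"
    then show "(h (s e) \<otimes>\<^bsub>B\<^esub> (h (s e))\<^sup>\<star>\<^bsub>B\<^esub>) \<otimes>\<^bsub>B\<^esub> (h (s f) \<otimes>\<^bsub>B\<^esub> (h (s f))\<^sup>\<star>\<^bsub>B\<^esub>) = \<zero>\<^bsub>B\<^esub>"
      using e sc c h(6) by (simp add: cl)
  next
    fix v assume v: "v \<in> verts E" and fin: "finite (out_arcs E v) \<and> out_arcs E v \<noteq> {}"
    let ?f = "\<lambda>e. s e \<otimes>\<^bsub>A\<^esub> (s e)\<^sup>\<star>\<^bsub>A\<^esub>"
    have f: "?f \<in> out_arcs E v \<rightarrow> carrier A" using sc oa by (auto simp: cl)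
    have "h (p v) = h (finsum A ?f (out_arcs E v))" using c v fin by auto
    also have "\<dots> = (\<Oplus>\<^bsub>B\<^esub>e\<in>out_arcs E v. h (?f e))" by (rule h(8)[OF f])
    also have "\<dots> = (\<Oplus>\<^bsub>B\<^esub>e\<in>out_arcs E v. h (s e) \<otimes>\<^bsub>B\<^esub> (h (s e))\<^sup>\<star>\<^bsub>B\<^esub>)"
      by (rule B.finsum_cong') (use sc oa in \<open>auto simp: cl star_homD(1)[OF hom]\<close>)
    finally show "h (p v) = \<dots>" .
  qed
qed

lemma labelled_representation_hom:
  assumes A: "star_algebra A" and B: "star_algebra B" and hom: "star_hom A B h"
    and \<C>: "accommodating E lab \<C>" and lr: "labelled_representation E lab \<C> A p s"
  shows "labelled_representation E lab \<C> B (\<lambda>X. h (p X)) (\<lambda>a. h (s a))"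
proof -
  interpret A: star_algebra A by fact
  interpret B: star_algebra B by fact
  note h = star_homD[OF hom] star_hom_zero[OF A B hom] star_hom_minus[OF A B hom]
    star_hom_finsum[OF A B hom]
  note cl = A.m_closed A.adj_closed A.smult_closed A.a_closed A.minus_closed A.zero_closed
  note pc = Pi_memD[OF labelled_representation_closed(1)[OF lr]]
    and sc = Pi_memD[OF labelled_representation_closed(2)[OF lr]]
  note c = lr[unfolded labelled_representation_def]
  have acc: "X \<inter> Y \<in> \<C>" "X \<union> Y \<in> \<C>" if "X \<in> \<C>" "Y \<in> \<C>" for X Y
    using \<C> that by (auto simp: accommodating_def)
  have rr: "rel_rng E lab X [a] \<in> \<C>" if "X \<in> \<C>" "a \<in> letters E lab" for X a
    using \<C> that by (auto simp: accommodating_def letters_def)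
  have lf: "a \<in> letters E lab" if "a \<in> letters_from E lab X" for a X
    using that by (simp add: letters_from_def)
  have [simp]: "h x \<otimes>\<^bsub>B\<^esub> h y = h (x \<otimes>\<^bsub>A\<^esub> y)"
    if "x \<in> carrier A" "y \<in> carrier A" for x y using that h by auto
  have [simp]: "(h x)\<^sup>\<star>\<^bsub>B\<^esub> = h (x\<^sup>\<star>\<^bsub>A\<^esub>)" if "x \<in> carrier A" for x using that h by auto
  show ?thesis
    unfolding labelled_representation_def
  proof (intro conjI ballI impI)
    fix X assume X: "X \<in> \<C>"
    then show "projection B (h (p X))" by (intro projection_hom[OF hom]) (use c in auto)
    fix Y assume Y: "Y \<in> \<C>"
    with X show "h (p X) \<otimes>\<^bsub>B\<^esub> h (p Y) = h (p (X \<inter> Y))" using pc c by simp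
    have "h (p (X \<union> Y)) = h ((p X \<oplus>\<^bsub>A\<^esub> p Y) \<ominus>\<^bsub>A\<^esub> p (X \<inter> Y))" using c X Y by simp
    then show "h (p (X \<union> Y)) = (h (p X) \<oplus>\<^bsub>B\<^esub> h (p Y)) \<ominus>\<^bsub>B\<^esub> h (p (X \<inter> Y))"
      using pc acc X Y by (simp add: cl h)
  next
    fix X a assume "X \<in> \<C>" "a \<in> letters E lab"
    then show "h (p X) \<otimes>\<^bsub>B\<^esub> h (s a) = h (s a) \<otimes>\<^bsub>B\<^esub> h (p (rel_rng E lab X [a]))"
      using pc sc rr c by simp
  next
    assume "{} \<in> \<C>" then show "h (p {}) = \<zero>\<^bsub>B\<^esub>" using c h(6) by simp
  next
    fix a assume a: "a \<in> letters E lab"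
    then show "partial_isometry B (h (s a))" by (intro partial_isometry_hom[OF A hom]) (use c in auto)
    show "(h (s a))\<^sup>\<star>\<^bsub>B\<^esub> \<otimes>\<^bsub>B\<^esub> h (s a) = h (p (word_rng E lab [a]))"
      using a sc c by (simp add: cl)
    fix b assume "b \<in> letters E lab" "a \<noteq> b"
    then show "(h (s a))\<^sup>\<star>\<^bsub>B\<^esub> \<otimes>\<^bsub>B\<^esub> h (s b) = \<zero>\<^bsub>B\<^esub>"
      using a sc c h(6) by (simp add: cl)
  next
    fix X assume X: "X \<in> \<C>" and fin: "finite (letters_from E lab X) \<and> letters_from E lab X \<noteq> {}
      \<and> X \<inter> sinks E = {}"
    let ?r = "\<lambda>a. rel_rng E lab X [a]"
    let ?f = "\<lambda>a. s a \<otimes>\<^bsub>A\<^esub> p (?r a) \<otimes>\<^bsub>A\<^esub> (s a)\<^sup>\<star>\<^bsub>A\<^esub>"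
    have sp: "s a \<in> carrier A" "p (?r a) \<in> carrier A" if "a \<in> letters_from E lab X" for a
      using sc pc lf[OF that] rr[OF X] by auto
    have f: "?f \<in> letters_from E lab X \<rightarrow> carrier A" using sp by (auto simp: cl)
    have "h (p X) = h (finsum A ?f (letters_from E lab X))" using c X fin by auto
    also have "\<dots> = (\<Oplus>\<^bsub>B\<^esub>a\<in>letters_from E lab X. h (?f a))" by (rule h(8)[OF f])
    also have "\<dots> = (\<Oplus>\<^bsub>B\<^esub>a\<in>letters_from E lab X. h (s a) \<otimes>\<^bsub>B\<^esub> h (p (?r a)) \<otimes>\<^bsub>B\<^esub> (h (s a))\<^sup>\<star>\<^bsub>B\<^esub>)"
      by (rule B.finsum_cong') (use sp in \<open>auto simp: cl star_homD(1)[OF hom]\<close>)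
    finally show "h (p X) = \<dots>" .
  qed
qed

lemma universal_gen_bounded:
  assumes "\<And>B \<rho> x. \<lbrakk>cstar_algebra B; Rep B \<rho>; x \<in> G\<rbrakk> \<Longrightarrow> \<parallel>\<rho> x\<parallel>\<^bsub>B\<^esub> \<le> 1"
  shows "universal_gen G Rep ` G \<subseteq> carrier (cstar_prod (reps G Rep) fst)"
proof
  fix f assume "f \<in> universal_gen G Rep ` G"
  then obtain x where x: "x \<in> G" "f = universal_gen G Rep x" by auto
  show "f \<in> carrier (cstar_prod (reps G Rep) fst)"
    by (rule cstar_prod_carrierI[where c = 1])
      (use x assms in \<open>auto simp: universal_gen_def reps_def Pi_iff\<close>)
qed

lemma jointly_injective_incl:
  assumes "cstar_algebra B" "G \<subseteq> carrier B"
  shows "jointly_injective (cstar_generated B G) {()} (\<lambda>_. B) (\<lambda>_ x. x)"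
proof (rule jointly_injective.intro)
  show "star_algebra (cstar_generated B G)"
    by (rule cstar_algebra.axioms(1)[OF cstar_generated_algebra[OF assms]])
  show "star_algebra B" by (rule cstar_algebra.axioms(1)[OF assms(1)])
  show "star_hom (cstar_generated B G) B (\<lambda>x. x)" by (rule star_hom_generated_incl[OF assms])
qed simp

theorem graph_cstar_universal:
  fixes E :: "('v, 'e) pre_digraph"
  assumes E: "wf_digraph E"
  defines "p \<equiv> \<lambda>v. universal_gen (graph_gens E) (graph_rep E) (Inl v)"
    and "s \<equiv> \<lambda>e. universal_gen (graph_gens E) (graph_rep E) (Inr e)"
  shows "cstar_algebra (graph_cstar E)"
    and "cuntz_krieger_family E (graph_cstar E) p s"
    and "cstar_span (graph_cstar E) (p ` verts E \<union> s ` arcs E) = carrier (graph_cstar E)"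
    and "\<And>(B :: 'b cstar) q t. \<lbrakk>cstar_algebra B; cuntz_krieger_family E B q t\<rbrakk> \<Longrightarrow>
      \<exists>h. star_hom (graph_cstar E) B h \<and> (\<forall>v\<in>verts E. h (p v) = q v) \<and> (\<forall>e\<in>arcs E. h (s e) = t e)"
proof -
  let ?G = "graph_gens E" and ?R = "graph_rep E :: _ \<Rightarrow> (_ \<Rightarrow> ('v + 'e) universe) \<Rightarrow> bool"
  let ?u = "universal_gen ?G ?R"
  have bdd: "?u ` ?G \<subseteq> carrier (cstar_prod (reps ?G ?R) fst)"
  proof (rule universal_gen_bounded)
    fix B :: "('v + 'e) universe cstar" and \<rho> x
    assume B: "cstar_algebra B" and R: "graph_rep E B \<rho>" and x: "x \<in> ?G"
    note c = R[unfolded graph_rep_def cuntz_krieger_family_def]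
    have pr: "projection B (\<rho> (Inl v))" if "v \<in> verts E" for v using c that by simp
    show "\<parallel>\<rho> x\<parallel>\<^bsub>B\<^esub> \<le> 1"
    proof (cases x)
      case (Inl v)
      with x show ?thesis by (auto simp: graph_gens_def intro: cstar_algebra.norm_projection[OF B] pr)
    next
      case (Inr e)
      with x have e: "e \<in> arcs E" by (auto simp: graph_gens_def)
      show ?thesis unfolding Inr
        by (rule cstar_algebra.norm_le_1[OF B])
          (use e c pr wf_digraph.head_in_verts[OF E] in \<open>auto simp: partial_isometry_def\<close>)
    qed
  qed
  note U = universal_cstar_generated[OF bdd, folded graph_cstar_def]
  have img: "?u ` ?G = p ` verts E \<union> s ` arcs E"
    unfolding p_def s_def graph_gens_def by auto
  show "cstar_algebra (graph_cstar E)" by (rule U(1))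
  show "cstar_span (graph_cstar E) (p ` verts E \<union> s ` arcs E) = carrier (graph_cstar E)"
    using U(3) img by simp
  interpret J: jointly_injective "graph_cstar E" "reps ?G ?R" fst "\<lambda>i f. f i"
  proof (rule jointly_injective.intro)
    fix i assume "i \<in> reps ?G ?R"
    then show "star_algebra (fst i)" by (auto simp: reps_def intro: cstar_algebra.axioms(1))
  qed (rule cstar_algebra.axioms(1)[OF U(1)], rule U(4), assumption, rule U(5))
  show "cuntz_krieger_family E (graph_cstar E) p s"
  proof (rule J.cuntz_krieger_refl[OF E])
    fix i assume i: "i \<in> reps ?G ?R"
    then have "cuntz_krieger_family E (fst i) (snd i \<circ> Inl) (snd i \<circ> Inr)"
      by (auto simp: reps_def graph_rep_def)
    then show "cuntz_krieger_family E (fst i) (\<lambda>v. p v i) (\<lambda>e. s e i)"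
      using i by (simp add: p_def s_def universal_gen_def comp_def)
  qed (use U(2) img in auto)
  fix B :: "'b cstar" and q t
  assume B: "cstar_algebra B" and ck: "cuntz_krieger_family E B q t"
  define \<rho> where "\<rho> = case_sum q t"
  note cl = cuntz_krieger_closed[OF ck]
  have \<rho>: "\<rho> \<in> ?G \<rightarrow> carrier B" using cl by (auto simp: \<rho>_def graph_gens_def)
  then have \<rho>': "\<rho> ` ?G \<subseteq> carrier B" by auto
  have g: "\<rho> x \<in> carrier (cstar_generated B (\<rho> ` ?G))" if "x \<in> ?G" for x
    using that by (auto intro: cstar_span.gen)
  have ck0: "cuntz_krieger_family E (cstar_generated B (\<rho> ` ?G)) q t"
    by (rule jointly_injective.cuntz_krieger_refl[OF jointly_injective_incl[OF B \<rho>'] E])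
      (use ck g[of "Inl _"] g[of "Inr _"] in \<open>auto simp: \<rho>_def graph_gens_def\<close>)
  have "\<exists>h. star_hom (universal_cstar ?G ?R) B h \<and> (\<forall>x\<in>?G. h (?u x) = \<rho> x)"
  proof (rule universal_cstar_hom[OF B \<rho> bdd])
    fix C :: "('v + 'e) universe cstar" and j
    assume C: "cstar_algebra C" "star_hom (cstar_generated B (\<rho> ` ?G)) C j"
    show "graph_rep E C (j \<circ> \<rho>)"
      using cuntz_krieger_hom[OF _ _ C(2) E ck0] C(1) cstar_generated_algebra[OF B \<rho>']
      by (simp add: cstar_algebra_def graph_rep_def comp_def \<rho>_def)
  qed
  then obtain h where h: "star_hom (graph_cstar E) B h" "\<And>x. x \<in> ?G \<Longrightarrow> h (?u x) = \<rho> x"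
    unfolding graph_cstar_def by blast
  have "h (p v) = q v" if "v \<in> verts E" for v
    using h(2)[of "Inl v"] that unfolding p_def \<rho>_def by (simp add: graph_gens_def InlI InrI)
  moreover have "h (s e) = t e" if "e \<in> arcs E" for e
    using h(2)[of "Inr e"] that unfolding s_def \<rho>_def by (simp add: graph_gens_def InlI InrI)
  ultimately show "\<exists>h. star_hom (graph_cstar E) B h \<and>
      (\<forall>v\<in>verts E. h (p v) = q v) \<and> (\<forall>e\<in>arcs E. h (s e) = t e)"
    using h(1) by blast
qed

theorem labelled_cstar_universal:
  fixes E :: "('v, 'e) pre_digraph" and lab :: "'e \<Rightarrow> 'l"
  assumes \<C>: "accommodating E lab \<C>"
  defines "p \<equiv> \<lambda>X. universal_gen (labelled_gens E lab \<C>) (labelled_rep E lab \<C>) (Inl X)"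
    and "s \<equiv> \<lambda>a. universal_gen (labelled_gens E lab \<C>) (labelled_rep E lab \<C>) (Inr a)"
  shows "cstar_algebra (labelled_cstar E lab \<C>)"
    and "labelled_representation E lab \<C> (labelled_cstar E lab \<C>) p s"
    and "cstar_span (labelled_cstar E lab \<C>) (p ` \<C> \<union> s ` letters E lab)
      = carrier (labelled_cstar E lab \<C>)"
    and "\<And>(B :: 'b cstar) q t. \<lbrakk>cstar_algebra B; labelled_representation E lab \<C> B q t\<rbrakk> \<Longrightarrow>
      \<exists>h. star_hom (labelled_cstar E lab \<C>) B h \<and>
        (\<forall>X\<in>\<C>. h (p X) = q X) \<and> (\<forall>a\<in>letters E lab. h (s a) = t a)"
proof -
  let ?G = "labelled_gens E lab \<C>"
  let ?R = "labelled_rep E lab \<C> :: _ \<Rightarrow> (_ \<Rightarrow> ('v set + 'l) universe) \<Rightarrow> bool"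
  let ?u = "universal_gen ?G ?R"
  have wr: "word_rng E lab [a] \<in> \<C>" if "a \<in> letters E lab" for a
    using \<C> that by (auto simp: accommodating_def letters_def)
  have bdd: "?u ` ?G \<subseteq> carrier (cstar_prod (reps ?G ?R) fst)"
  proof (rule universal_gen_bounded)
    fix B :: "('v set + 'l) universe cstar" and \<rho> x
    assume B: "cstar_algebra B" and R: "labelled_rep E lab \<C> B \<rho>" and x: "x \<in> ?G"
    note c = R[unfolded labelled_rep_def labelled_representation_def]
    have pr: "projection B (\<rho> (Inl X))" if "X \<in> \<C>" for X using c that by simp
    show "\<parallel>\<rho> x\<parallel>\<^bsub>B\<^esub> \<le> 1"
    proof (cases x)
      case (Inl v)
      with x show ?thesis by (auto simp: labelled_gens_def intro: cstar_algebra.norm_projection[OF B] pr)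
    next
      case (Inr e)
      with x have e: "e \<in> letters E lab" by (auto simp: labelled_gens_def)
      show ?thesis unfolding Inr
        by (rule cstar_algebra.norm_le_1[OF B])
          (use e c pr wr in \<open>auto simp: partial_isometry_def\<close>)
    qed
  qed
  note U = universal_cstar_generated[OF bdd, folded labelled_cstar_def]
  have img: "?u ` ?G = p ` \<C> \<union> s ` letters E lab"
    unfolding p_def s_def labelled_gens_def by auto
  show "cstar_algebra (labelled_cstar E lab \<C>)" by (rule U(1))
  show "cstar_span (labelled_cstar E lab \<C>) (p ` \<C> \<union> s ` letters E lab)
      = carrier (labelled_cstar E lab \<C>)"
    using U(3) img by simp
  interpret J: jointly_injective "labelled_cstar E lab \<C>" "reps ?G ?R" fst "\<lambda>i f. f i"
  proof (rule jointly_injective.intro)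
    fix i assume "i \<in> reps ?G ?R"
    then show "star_algebra (fst i)" by (auto simp: reps_def intro: cstar_algebra.axioms(1))
  qed (rule cstar_algebra.axioms(1)[OF U(1)], rule U(4), assumption, rule U(5))
  show "labelled_representation E lab \<C> (labelled_cstar E lab \<C>) p s"
  proof (rule J.labelled_representation_refl[OF \<C>])
    fix i assume i: "i \<in> reps ?G ?R"
    then have "labelled_representation E lab \<C> (fst i) (snd i \<circ> Inl) (snd i \<circ> Inr)"
      by (auto simp: reps_def labelled_rep_def)
    then show "labelled_representation E lab \<C> (fst i) (\<lambda>X. p X i) (\<lambda>a. s a i)"
      using i by (simp add: p_def s_def universal_gen_def comp_def)
  qed (use U(2) img in auto)
  fix B :: "'b cstar" and q t
  assume B: "cstar_algebra B" and lr: "labelled_representation E lab \<C> B q t"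
  define \<rho> where "\<rho> = case_sum q t"
  note cl = labelled_representation_closed[OF lr]
  have \<rho>: "\<rho> \<in> ?G \<rightarrow> carrier B" using cl by (auto simp: \<rho>_def labelled_gens_def)
  then have \<rho>': "\<rho> ` ?G \<subseteq> carrier B" by auto
  have g: "\<rho> x \<in> carrier (cstar_generated B (\<rho> ` ?G))" if "x \<in> ?G" for x
    using that by (auto intro: cstar_span.gen)
  have lr0: "labelled_representation E lab \<C> (cstar_generated B (\<rho> ` ?G)) q t"
    by (rule jointly_injective.labelled_representation_refl[OF jointly_injective_incl[OF B \<rho>'] \<C>])
      (use lr g[of "Inl _"] g[of "Inr _"] in \<open>auto simp: \<rho>_def labelled_gens_def\<close>)
  have "\<exists>h. star_hom (universal_cstar ?G ?R) B h \<and> (\<forall>x\<in>?G. h (?u x) = \<rho> x)"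
  proof (rule universal_cstar_hom[OF B \<rho> bdd])
    fix C :: "('v set + 'l) universe cstar" and j
    assume C: "cstar_algebra C" "star_hom (cstar_generated B (\<rho> ` ?G)) C j"
    show "labelled_rep E lab \<C> C (j \<circ> \<rho>)"
      using labelled_representation_hom[OF _ _ C(2) \<C> lr0] C(1) cstar_generated_algebra[OF B \<rho>']
      by (simp add: cstar_algebra_def labelled_rep_def comp_def \<rho>_def)
  qed
  then obtain h where h: "star_hom (labelled_cstar E lab \<C>) B h" "\<And>x. x \<in> ?G \<Longrightarrow> h (?u x) = \<rho> x"
    unfolding labelled_cstar_def by blast
  have "h (p X) = q X" if "X \<in> \<C>" for X
    using h(2)[of "Inl X"] that unfolding p_def \<rho>_def by (simp add: labelled_gens_def InlI InrI)
  moreover have "h (s a) = t a" if "a \<in> letters E lab" for a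
    using h(2)[of "Inr a"] that unfolding s_def \<rho>_def by (simp add: labelled_gens_def InlI InrI)
  ultimately show "\<exists>h. star_hom (labelled_cstar E lab \<C>) B h \<and>
      (\<forall>X\<in>\<C>. h (p X) = q X) \<and> (\<forall>a\<in>letters E lab. h (s a) = t a)"
    using h(1) by blast
qed

lemma is_path_verts:
  assumes "wf_digraph E" "is_path E u l v" shows "u \<in> verts E" "v \<in> verts E"
  using assms wf_digraph.awalk_last_in_verts[of E u l v] 
  by (auto simp: is_path_def pre_digraph.awalk_def)

lemma accommodating_Inter:
  assumes "\<And>\<C>. \<C> \<in> F \<Longrightarrow> accommodating E lab \<C>" "F \<noteq> {}"
  shows "accommodating E lab (\<Inter>F)"
proof -
  note acc = assms(1)[unfolded accommodating_def]
  obtain \<D> where "\<D> \<in> F" using assms(2) by auto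
  show ?thesis
    unfolding accommodating_def
  proof (intro conjI ballI subsetI InterI)
    fix X assume "X \<in> \<Inter>F"
    then have "X \<in> \<D>" using \<open>\<D> \<in> F\<close> by (rule InterD)
    then show "X \<in> Pow (verts E)" using conjunct1[OF acc[OF \<open>\<D> \<in> F\<close>]] by (rule rev_subsetD)
  qed (simp_all add: acc)
qed

lemma accommodating_Pow:
  assumes "wf_digraph E" shows "accommodating E lab (Pow (verts E))"
proof -
  have "rel_rng E lab X \<alpha> \<in> Pow (verts E)" "word_rng E lab \<alpha> \<in> Pow (verts E)" for X \<alpha>
    by (auto simp: rel_rng_def word_rng_def intro: is_path_verts(2)[OF assms])
  then show ?thesis unfolding accommodating_def by (simp del: Pow_iff) auto
qed

lemma
  assumes E: "wf_digraph E"
  shows E_zero_accommodating: "accommodating E lab (E_zero E lab)"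
    and E_zero_minus_accommodating: "accommodating E lab (E_zero_minus E lab)"
proof -
  have words: "word_src E lab \<alpha> \<in> Pow (verts E)" "word_rng E lab \<alpha> \<in> Pow (verts E)" for \<alpha>
    by (auto simp: word_src_def word_rng_def intro: is_path_verts[OF E])
  have vs: "{v} \<in> Pow (verts E)" if "v \<in> sources E \<union> sinks E" for v
    using that by (auto simp: sources_def sinks_def)
  show "accommodating E lab (E_zero E lab)"
    unfolding E_zero_def
  proof (rule accommodating_Inter)
    show "{\<C>. accommodating E lab \<C> \<and> (\<forall>v\<in>sources E \<union> sinks E. {v} \<in> \<C>) \<and>
      (\<forall>\<alpha>\<in>words E lab. word_rng E lab \<alpha> \<in> \<C> \<and> word_src E lab \<alpha> \<in> \<C>)} \<noteq> {}"
      using accommodating_Pow[OF E] words vs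
      by (intro ex_in_conv[THEN iffD1] exI[of _ "Pow (verts E)"]) (simp del: Pow_iff)
  qed simp
  show "accommodating E lab (E_zero_minus E lab)"
    unfolding E_zero_minus_def
  proof (rule accommodating_Inter)
    show "{\<C>. accommodating E lab \<C> \<and> (\<forall>v\<in>sinks E. {v} \<in> \<C>) \<and>
      (\<forall>\<alpha>\<in>words E lab. word_rng E lab \<alpha> \<in> \<C>)} \<noteq> {}"
      using accommodating_Pow[OF E] words vs
      by (intro ex_in_conv[THEN iffD1] exI[of _ "Pow (verts E)"]) (simp del: Pow_iff)
  qed simp
qed

lemma unrestricted_relation_sink:
  assumes A: "star_algebra A" and \<C>: "accommodating E lab \<C>"
    and lr: "labelled_representation E lab \<C> A p s"
    and unrestricted: "\<And>X. \<lbrakk>X \<in> \<C>; finite (letters_from E lab X); letters_from E lab X \<noteq> {}\<rbrakk> \<Longrightarrow>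
      p X = (\<Oplus>\<^bsub>A\<^esub>a\<in>letters_from E lab X. s a \<otimes>\<^bsub>A\<^esub> p (rel_rng E lab X [a]) \<otimes>\<^bsub>A\<^esub> (s a)\<^sup>\<star>\<^bsub>A\<^esub>)"
    and w: "w \<in> sinks E" "{w} \<in> \<C>"
    and X: "X \<in> \<C>" "w \<notin> X" "finite (letters_from E lab X)" "letters_from E lab X \<noteq> {}"
  shows "p {w} = \<zero>\<^bsub>A\<^esub>"
proof -
  interpret A: star_algebra A by fact
  have no: "\<not> (is_path E w l v \<and> map lab l = [a])" for l v a
    using w(1) by (cases l) (auto simp: is_path_def pre_digraph.awalk_def sinks_def pre_digraph.cas.simps)
  let ?Y = "X \<union> {w}"
  have "X \<inter> {w} \<in> \<C>" "?Y \<in> \<C>" using \<C> X(1) w(2) unfolding accommodating_def by blast+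
  moreover have "X \<inter> {w} = {}" using X(2) by blast
  ultimately have Y: "?Y \<in> \<C>" "X \<inter> {w} = {}" "{} \<in> \<C>" by simp_all
  have lf: "letters_from E lab ?Y = letters_from E lab X"
  proof -
    have "w \<notin> word_src E lab [a]" for a
      unfolding word_src_def by (rule notI, elim CollectE exE) (rule notE[OF no])
    then show ?thesis by (simp add: letters_from_def)
  qed
  have rr: "rel_rng E lab ?Y [a] = rel_rng E lab X [a]" for a
  proof -
    have "(\<exists>u\<in>?Y. \<exists>l. is_path E u l v \<and> map lab l = [a]) \<longleftrightarrow>
      (\<exists>u\<in>X. \<exists>l. is_path E u l v \<and> map lab l = [a])" for v
    proof -
      have "\<not> (\<exists>l. is_path E w l v \<and> map lab l = [a])"
        by (rule notI, elim exE) (rule notE[OF no])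
      then show ?thesis by (simp only: bex_simps Un_insert_right sup_bot_right simp_thms)
    qed
    then show ?thesis unfolding rel_rng_def by simp
  qed
  have eq: "p ?Y = p X"
    using unrestricted[OF Y(1)] unrestricted[OF X(1)] X(3,4) unfolding lf rr by simp
  have c: "p X \<in> carrier A" "p {w} \<in> carrier A"
    using Pi_memD[OF labelled_representation_closed(1)[OF lr]] X(1) w(2) by blast+
  have "p ?Y = (p X \<oplus>\<^bsub>A\<^esub> p {w}) \<ominus>\<^bsub>A\<^esub> p (X \<inter> {w})" "p {} = \<zero>\<^bsub>A\<^esub>"
    using lr X(1) w(2) Y(3) unfolding labelled_representation_def by blast+
  then have "(p X \<oplus>\<^bsub>A\<^esub> p {w}) \<ominus>\<^bsub>A\<^esub> \<zero>\<^bsub>A\<^esub> = p X" using eq Y(2) by simp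
  moreover have "\<ominus>\<^bsub>A\<^esub> \<zero>\<^bsub>A\<^esub> = \<zero>\<^bsub>A\<^esub>" by (simp add: A.a_inv_smult A.smult_zero_r)
  ultimately have "p X \<oplus>\<^bsub>A\<^esub> p {w} = p X" using c by (simp add: a_minus_def)
  then show ?thesis using c using A.add.l_cancel_one[of "p X" "p {w}"] by simp
qed

end

theory Submission
  imports Defs
begin

text \<open>
  Label-finiteness forces every set in \<open>E_zero\<close> and \<open>E_zero_minus\<close> to be finite, and the singletons
  then produce all nonempty finite sets of vertices. The two kinds of generators determine each
  other: \<open>p X = (\<Sum>v\<in>X. p v)\<close> and \<open>s a = (\<Sum>lab e = a. s e)\<close> in one direction, \<open>p v = p {v}\<close> and
  \<open>s e = s (lab e) p {r(e)}\<close> in the other. Left-resolving says that the edges with a given label have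
  distinct ranges, which makes the cross terms \<open>s e (s f)*\<close> vanish; the relation at a sink-free
  finite set is the sum of the Cuntz-Krieger relations at its vertices. The universal properties
  give homomorphisms both ways whose composites fix the generators.
\<close>

section \<open>Contractive homomorphisms out of universal C*-algebras\<close>

text \<open>The collection \<open>\<C>\<close> may lack \<open>{}\<close>: for one vertex with one
  loop it consists of the singleton alone. Hence unions have to start from a singleton, and
  \<open>p {} = \<zero>\<close> can be invoked only where \<open>{}\<close> is known to be a member.
  Left-resolving does more than remove cross terms. From edges to labels, it makes the initial
  projection of \<open>s a\<close> the sum of the vertex projections over the set r(a), each range
  vertex counted once, and it turns the relation between \<open>p X\<close> and \<open>s a\<close>
  into an equality of two edge sums. From labels to edges, it makes \<open>p {r(e)}\<close> single
  out e among the edges labelled \<open>lab e\<close>, which is why \<open>s (lab e)\<close> cut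
  down by \<open>p {r(e)}\<close> is the right candidate for \<open>s e\<close>.\<close>

definition contractive :: "'a cstar \<Rightarrow> 'b cstar \<Rightarrow> ('a \<Rightarrow> 'b) \<Rightarrow> bool" where
  "contractive A B h \<longleftrightarrow> (\<forall>x\<in>carrier A. \<parallel>h x\<parallel>\<^bsub>B\<^esub> \<le> \<parallel>x\<parallel>\<^bsub>A\<^esub>)"

lemma contractive_comp:
  assumes "star_hom A B f" "contractive A B f" "contractive B C g"
  shows "contractive A C (\<lambda>x. g (f x))"
  using assms star_homD(1)[OF assms(1)] unfolding contractive_def by (blast intro: order_trans)

text \<open>The fixed points of \<open>h\<close> are closed under the algebraic operations, and
  contractivity closes them under limits: if \<open>h\<close> fixes every \<open>X n\<close>, then
  \<open>h x\<close> is at most as far from \<open>X n\<close> as \<open>x\<close> is, so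
  \<open>h x\<close> is a limit of \<open>X\<close> too and equals \<open>x\<close>.\<close>

lemma contractive_star_hom_eq_id:
  assumes A: "cstar_algebra A" and h: "star_hom A A h" "contractive A A h"
    and G: "G \<subseteq> carrier A" "\<And>g. g \<in> G \<Longrightarrow> h g = g" and x: "x \<in> cstar_span A G"
  shows "h x = x"
proof -
  interpret A: cstar_algebra A by fact
  note sp = subsetD[OF A.cstar_span_closed[OF G(1)]]
  note hh = star_homD[OF h(1)]
  from x show ?thesis
  proof induction
    case (lim X x)
    have X: "X n \<in> carrier A" for n by (rule sp[OF lim.hyps(1)])
    note x = \<open>x \<in> carrier A\<close>
    have "\<parallel>X n \<ominus>\<^bsub>A\<^esub> h x\<parallel>\<^bsub>A\<^esub> \<le> \<parallel>X n \<ominus>\<^bsub>A\<^esub> x\<parallel>\<^bsub>A\<^esub>" for n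
    proof -
      have "h (X n \<ominus>\<^bsub>A\<^esub> x) = X n \<ominus>\<^bsub>A\<^esub> h x"
        using star_hom_minus[OF A.star_algebra_axioms A.star_algebra_axioms h(1) X x] lim.IH by simp
      then show ?thesis using h(2) A.minus_closed[OF X[of n] x] unfolding contractive_def by metis
    qed
    then have le: "\<forall>n. \<parallel>X n \<ominus>\<^bsub>A\<^esub> h x\<parallel>\<^bsub>A\<^esub> \<le> \<parallel>X n \<ominus>\<^bsub>A\<^esub> x\<parallel>\<^bsub>A\<^esub>" by blast
    have ge: "\<forall>n. 0 \<le> \<parallel>X n \<ominus>\<^bsub>A\<^esub> h x\<parallel>\<^bsub>A\<^esub>"
      using A.norm_nonneg[OF A.minus_closed[OF X hh(1)[OF x]]] by blast
    have "cstar_lim A X (h x)"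
      unfolding cstar_lim_def
      by (rule tendsto_sandwich[OF always_eventually[OF ge] always_eventually[OF le] tendsto_const
            lim.hyps(3)[unfolded cstar_lim_def]])
    from A.lim_unique[OF X hh(1)[OF x] x this lim.hyps(3)] show ?case .
  qed (simp_all add: hh sp G(2) star_hom_zero[OF A.star_algebra_axioms A.star_algebra_axioms h(1)])
qed

text \<open>Each composite is a contractive endomorphism fixing a generating set, hence the
  identity, so the two maps are mutually inverse.\<close>

lemma cstar_iso_contractive:
  assumes A: "cstar_algebra A" and B: "cstar_algebra B"
    and f: "star_hom A B f" "contractive A B f" and g: "star_hom B A g" "contractive B A g"
    and G: "G \<subseteq> carrier A" "cstar_span A G = carrier A" "\<And>x. x \<in> G \<Longrightarrow> g (f x) = x"
    and H: "H \<subseteq> carrier B" "cstar_span B H = carrier B" "\<And>y. y \<in> H \<Longrightarrow> f (g y) = y"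
  shows "A \<cong>\<^sub>C B"
proof -
  have "g (f x) = x" if "x \<in> carrier A" for x
    using contractive_star_hom_eq_id[OF A star_hom_comp[OF f(1) g(1)]
        contractive_comp[OF f g(2)] G(1,3)] G(2) that by simp
  moreover have "f (g y) = y" if "y \<in> carrier B" for y
    using contractive_star_hom_eq_id[OF B star_hom_comp[OF g(1) f(1)]
        contractive_comp[OF g f(2)] H(1,3)] H(2) that by simp
  ultimately have "bij_betw f (carrier A) (carrier B)"
    using star_homD(1)[OF f(1)] star_homD(1)[OF g(1)] by (intro bij_betw_byWitness[of _ g]) auto
  with f(1) show ?thesis unfolding cstar_iso_def by blast
qed

text \<open>\<open>cstar_transport\<close> yields the transported algebra but says nothing about its
  norm. Its operations are kept and only the norm is replaced, by the norm of \<open>A\<close>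
  pulled back along the inverse of \<open>j\<close>; this makes the inverse contractive by
  construction.\<close>

lemma cstar_transport_isometric:
  fixes A :: "'a cstar" and j :: "'a \<Rightarrow> 'b"
  assumes A: "cstar_algebra A" and j: "inj_on j (carrier A)"
  shows "\<exists>C :: 'b cstar. cstar_algebra C \<and> star_hom A C j \<and>
    star_hom C A (inv_into (carrier A) j) \<and> contractive C A (inv_into (carrier A) j)"
proof -
  interpret A: cstar_algebra A by fact
  define k where "k = inv_into (carrier A) j"
  have kj: "k (j x) = x" if "x \<in> carrier A" for x using that j by (simp add: k_def)
  obtain D :: "'b cstar" where D: "cstar_algebra D" "star_hom A D j" "star_hom D A k"
    "carrier D = j ` carrier A"
    using cstar_transport[OF A j] unfolding k_def by blast
  interpret D: cstar_algebra D by fact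
  note kD = star_homD[OF D(3)] star_hom_zero[OF D.star_algebra_axioms A.star_algebra_axioms D(3)]
  define C where "C = D\<lparr>cnorm := \<lambda>x. \<parallel>k x\<parallel>\<^bsub>A\<^esub>\<rparr>"
  have C: "carrier C = carrier D" "zero C = zero D" "add C = add D" "mult C = mult D"
    "smult C = smult D" "adj C = adj D" "cnorm C = (\<lambda>x. \<parallel>k x\<parallel>\<^bsub>A\<^esub>)"
    by (simp_all add: C_def)
  have hj: "star_hom A C j" and hk: "star_hom C A k" and hD: "star_hom C D (\<lambda>x. x)"
    using D(2,3) by (simp_all add: star_hom_def C)
  note cl = D.m_closed D.smult_closed D.adj_closed
  have SC: "star_algebra C"
    by (rule star_algebra_reflect[where I = "{()}" and B = "\<lambda>_. D" and h = "\<lambda>_ x. x"])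
      (auto simp: D.star_algebra_axioms hD C cl)
  \<comment> \<open>Definiteness of the pulled-back norm: every element of \<open>D\<close> is
    \<open>j\<close> of something, so \<open>k\<close> has trivial kernel.\<close>
  have k0: "k x = \<zero>\<^bsub>A\<^esub> \<longleftrightarrow> x = \<zero>\<^bsub>D\<^esub>" if "x \<in> carrier D" for x
    using that D(4) kj kD(6) star_hom_zero[OF A.star_algebra_axioms D.star_algebra_axioms D(2)] by auto
  have minus: "k (x \<ominus>\<^bsub>C\<^esub> y) = k x \<ominus>\<^bsub>A\<^esub> k y" if "x \<in> carrier C" "y \<in> carrier C" for x y
    by (rule star_hom_minus[OF SC A.star_algebra_axioms hk that])
  have "cstar_algebra C"
  proof (intro cstar_algebra.intro[OF SC] cstar_algebra_axioms.intro)
    fix X assume X: "\<And>n. X n \<in> carrier C" and "cstar_Cauchy C X"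
    then have "cstar_Cauchy A (\<lambda>n. k (X n))"
      by (simp add: cstar_Cauchy_def C(7) minus)
    then obtain x where x: "x \<in> carrier A" "cstar_lim A (\<lambda>n. k (X n)) x"
      using A.complete[of "\<lambda>n. k (X n)"] X star_homD(1)[OF hk] by blast
    then have "j x \<in> carrier C" "cstar_lim C X (j x)"
      using X star_homD(1)[OF hj] by (auto simp: cstar_lim_def C(7) minus kj)
    then show "\<exists>x\<in>carrier C. cstar_lim C X x" by blast
  qed (auto simp: C cl kD k0 A.norm_eq_0 A.norm_triangle A.norm_smult A.norm_mult A.cstar_identity)
  moreover have "contractive C A k" by (simp add: contractive_def C(7))
  ultimately show ?thesis using hj hk unfolding k_def by blast
qed

text \<open>
  The homomorphisms provided by \<open>universal_cstar_hom\<close> are coordinate projections followed by a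
  change of carrier. Recording that they are contractive makes them unique, without recourse to the
  spectral theory behind the automatic continuity of *-homomorphisms.
\<close>

lemma universal_cstar_contractive_hom:
  fixes B :: "'b cstar" and \<rho> :: "'g \<Rightarrow> 'b"
  assumes B: "cstar_algebra B" and \<rho>: "\<rho> \<in> G \<rightarrow> carrier B"
    and bound: "\<And>C \<sigma> x. \<lbrakk>cstar_algebra C; Rep C \<sigma>; x \<in> G\<rbrakk> \<Longrightarrow> \<parallel>\<sigma> x\<parallel>\<^bsub>C\<^esub> \<le> 1"
    and rep: "\<And>C j. \<lbrakk>cstar_algebra C; star_hom (cstar_generated B (\<rho> ` G)) C j\<rbrakk> \<Longrightarrow> Rep C (j \<circ> \<rho>)"
  shows "\<exists>h. star_hom (universal_cstar G Rep) B h \<and> contractive (universal_cstar G Rep) B h \<and>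
    (\<forall>x\<in>G. h (universal_gen G Rep x) = \<rho> x)"
proof -
  interpret B: cstar_algebra B by fact
  have G: "\<rho> ` G \<subseteq> carrier B" using \<rho> by auto
  let ?B0 = "cstar_generated B (\<rho> ` G)" and ?U = "universal_cstar G Rep"
  let ?P = "cstar_prod (reps G Rep) fst"
  have bdd: "universal_gen G Rep ` G \<subseteq> carrier ?P"
    by (rule universal_gen_bounded) (rule bound)
  have B0: "cstar_algebra ?B0" by (rule cstar_generated_algebra[OF B G])
  have P: "cstar_algebra ?P" by (rule cstar_prod_algebra) (auto simp: reps_def)
  \<comment> \<open>The subalgebra generated by the family, unlike \<open>B\<close>, always fits
    into the universe type: its elements are told apart by their distances to the values of
    *-polynomials.\<close>
  obtain j :: "'b \<Rightarrow> 'g universe" where j: "inj_on j (carrier ?B0)"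
    using B.dist_poly_inj[OF \<rho>] by auto
  let ?k = "inv_into (carrier ?B0) j"
  obtain C :: "'g universe cstar" where C: "cstar_algebra C" "star_hom ?B0 C j" "star_hom C ?B0 ?k"
    "contractive C ?B0 ?k"
    using cstar_transport_isometric[OF B0 j] by blast
  have \<rho>0: "\<rho> x \<in> carrier ?B0" if "x \<in> G" for x using that by (auto intro: cstar_span.gen)
  \<comment> \<open>This pair is one of the representations indexing the product. Evaluation at it
    is contractive because the norm of the product is a supremum over coordinates.\<close>
  let ?i = "(C, j \<circ> \<rho>)"
  have i: "?i \<in> reps G Rep"
    using C(1) rep[OF C(1,2)] star_homD(1)[OF C(2) \<rho>0] by (auto simp: reps_def)
  have h1: "star_hom ?U C (\<lambda>f. f ?i)" using universal_cstar_generated(4)[OF bdd i] by simp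
  have c1: "contractive ?U C (\<lambda>f. f ?i)"
    unfolding contractive_def
  proof
    fix f assume "f \<in> carrier ?U"
    then have "f \<in> carrier ?P"
      using cstar_algebra.cstar_span_closed[OF P bdd] by (auto simp: universal_cstar_def)
    then show "\<parallel>f ?i\<parallel>\<^bsub>C\<^esub> \<le> \<parallel>f\<parallel>\<^bsub>?U\<^esub>"
      using cstar_prod_norm_upper[of f "reps G Rep" fst ?i] i by (simp add: universal_cstar_def)
  qed
  have h: "star_hom ?U B (\<lambda>f. ?k (f ?i))"
    using star_hom_comp[OF star_hom_comp[OF h1 C(3)] star_hom_generated_incl[OF B G]] .
  have "contractive ?U B (\<lambda>f. ?k (f ?i))"
    using contractive_comp[OF h1 c1 C(4)] by (simp add: contractive_def)
  moreover have "?k (universal_gen G Rep x ?i) = \<rho> x" if "x \<in> G" for x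
    using that i \<rho>0[OF that] j by (simp add: universal_gen_def)
  ultimately show ?thesis using h by blast
qed

text \<open>The homomorphism of \<open>graph_cstar_universal\<close> is rebuilt here because its
  statement does not retain the norm estimate.\<close>

lemma graph_cstar_contractive_hom:
  fixes E :: "('v, 'e) pre_digraph" and B :: "'b cstar"
  assumes E: "wf_digraph E" and B: "cstar_algebra B" and ck: "cuntz_krieger_family E B q t"
  shows "\<exists>h. star_hom (graph_cstar E) B h \<and> contractive (graph_cstar E) B h \<and>
    (\<forall>v\<in>verts E. h (universal_gen (graph_gens E) (graph_rep E) (Inl v)) = q v) \<and>
    (\<forall>e\<in>arcs E. h (universal_gen (graph_gens E) (graph_rep E) (Inr e)) = t e)"
proof -
  let ?G = "graph_gens E" and ?R = "graph_rep E :: _ \<Rightarrow> (_ \<Rightarrow> ('v + 'e) universe) \<Rightarrow> bool"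
  define \<rho> where "\<rho> = case_sum q t"
  have \<rho>: "\<rho> \<in> ?G \<rightarrow> carrier B"
    using cuntz_krieger_closed[OF ck] by (auto simp: \<rho>_def graph_gens_def)
  then have \<rho>': "\<rho> ` ?G \<subseteq> carrier B" by auto
  have g: "\<rho> x \<in> carrier (cstar_generated B (\<rho> ` ?G))" if "x \<in> ?G" for x
    using that by (auto intro: cstar_span.gen)
  \<comment> \<open>The inclusion into \<open>B\<close> is injective, so the relations already hold
    in the generated subalgebra; from there they pass along any homomorphism into
    \<open>C\<close>.\<close>
  have ck0: "cuntz_krieger_family E (cstar_generated B (\<rho> ` ?G)) q t"
    by (rule jointly_injective.cuntz_krieger_refl[OF jointly_injective_incl[OF B \<rho>'] E])
      (use ck g[of "Inl _"] g[of "Inr _"] in \<open>auto simp: \<rho>_def graph_gens_def\<close>)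
  have "\<exists>h. star_hom (universal_cstar ?G ?R) B h \<and> contractive (universal_cstar ?G ?R) B h \<and>
    (\<forall>x\<in>?G. h (universal_gen ?G ?R x) = \<rho> x)"
  proof (rule universal_cstar_contractive_hom[OF B \<rho>])
    fix C :: "('v + 'e) universe cstar" and j
    assume C: "cstar_algebra C" "star_hom (cstar_generated B (\<rho> ` ?G)) C j"
    show "graph_rep E C (j \<circ> \<rho>)"
      using cuntz_krieger_hom[OF _ _ C(2) E ck0] C(1) cstar_generated_algebra[OF B \<rho>']
      by (simp add: cstar_algebra_def graph_rep_def comp_def \<rho>_def)
  next
    fix C :: "('v + 'e) universe cstar" and \<sigma> x
    assume C: "cstar_algebra C" and R: "graph_rep E C \<sigma>" and x: "x \<in> ?G"
    note c = R[unfolded graph_rep_def cuntz_krieger_family_def]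
    have pr: "projection C (\<sigma> (Inl v))" if "v \<in> verts E" for v using c that by simp
    from x show "\<parallel>\<sigma> x\<parallel>\<^bsub>C\<^esub> \<le> 1" unfolding graph_gens_def
    proof (elim PlusE)
      fix e assume "e \<in> arcs E" "x = Inr e"
      then show ?thesis
        using cstar_algebra.norm_le_1[OF C, of "\<sigma> (Inr e)"] c pr wf_digraph.head_in_verts[OF E]
        by (simp add: partial_isometry_def)
    qed (auto intro: cstar_algebra.norm_projection[OF C] pr)
  qed
  then show ?thesis
    unfolding graph_cstar_def[symmetric] by (auto simp: \<rho>_def graph_gens_def InlI InrI)
qed

lemma labelled_cstar_contractive_hom:
  fixes E :: "('v, 'e) pre_digraph" and lab :: "'e \<Rightarrow> 'l" and B :: "'b cstar"
  assumes \<C>: "accommodating E lab \<C>" and B: "cstar_algebra B"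
    and lr: "labelled_representation E lab \<C> B q t"
  shows "\<exists>h. star_hom (labelled_cstar E lab \<C>) B h \<and> contractive (labelled_cstar E lab \<C>) B h \<and>
    (\<forall>X\<in>\<C>. h (universal_gen (labelled_gens E lab \<C>) (labelled_rep E lab \<C>) (Inl X)) = q X) \<and>
    (\<forall>a\<in>letters E lab. h (universal_gen (labelled_gens E lab \<C>) (labelled_rep E lab \<C>) (Inr a)) = t a)"
proof -
  let ?G = "labelled_gens E lab \<C>"
  let ?R = "labelled_rep E lab \<C> :: _ \<Rightarrow> (_ \<Rightarrow> ('v set + 'l) universe) \<Rightarrow> bool"
  define \<rho> where "\<rho> = case_sum q t"
  have \<rho>: "\<rho> \<in> ?G \<rightarrow> carrier B"
    using labelled_representation_closed[OF lr] by (auto simp: \<rho>_def labelled_gens_def)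
  then have \<rho>': "\<rho> ` ?G \<subseteq> carrier B" by auto
  have g: "\<rho> x \<in> carrier (cstar_generated B (\<rho> ` ?G))" if "x \<in> ?G" for x
    using that by (auto intro: cstar_span.gen)
  have lr0: "labelled_representation E lab \<C> (cstar_generated B (\<rho> ` ?G)) q t"
    by (rule jointly_injective.labelled_representation_refl[OF jointly_injective_incl[OF B \<rho>'] \<C>])
      (use lr g[of "Inl _"] g[of "Inr _"] in \<open>auto simp: \<rho>_def labelled_gens_def\<close>)
  have "\<exists>h. star_hom (universal_cstar ?G ?R) B h \<and> contractive (universal_cstar ?G ?R) B h \<and>
    (\<forall>x\<in>?G. h (universal_gen ?G ?R x) = \<rho> x)"
  proof (rule universal_cstar_contractive_hom[OF B \<rho>])
    fix C :: "('v set + 'l) universe cstar" and j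
    assume C: "cstar_algebra C" "star_hom (cstar_generated B (\<rho> ` ?G)) C j"
    show "labelled_rep E lab \<C> C (j \<circ> \<rho>)"
      using labelled_representation_hom[OF _ _ C(2) \<C> lr0] C(1) cstar_generated_algebra[OF B \<rho>']
      by (simp add: cstar_algebra_def labelled_rep_def comp_def \<rho>_def)
  next
    fix C :: "('v set + 'l) universe cstar" and \<sigma> x
    assume C: "cstar_algebra C" and R: "labelled_rep E lab \<C> C \<sigma>" and x: "x \<in> ?G"
    note c = R[unfolded labelled_rep_def labelled_representation_def]
    have pr: "projection C (\<sigma> (Inl X))" if "X \<in> \<C>" for X using c that by simp
    \<comment> \<open>Membership of r(a) in \<open>\<C>\<close> makes the initial projection of the
      generator at a a projection of the family, which bounds that generator by 1.\<close>
    have wr: "word_rng E lab [a] \<in> \<C>" if "a \<in> letters E lab" for a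
      using \<C> that by (auto simp: accommodating_def letters_def)
    from x show "\<parallel>\<sigma> x\<parallel>\<^bsub>C\<^esub> \<le> 1" unfolding labelled_gens_def
    proof (elim PlusE)
      fix a assume "a \<in> letters E lab" "x = Inr a"
      then show ?thesis
        using cstar_algebra.norm_le_1[OF C, of "\<sigma> (Inr a)"] c pr wr
        by (simp add: partial_isometry_def)
    qed (auto intro: cstar_algebra.norm_projection[OF C] pr)
  qed
  then show ?thesis
    unfolding labelled_cstar_def[symmetric] by (auto simp: \<rho>_def labelled_gens_def InlI InrI)
qed

section \<open>Finite sums in *-algebras\<close>

context star_algebra begin

lemma mult_zero_left: "x \<in> carrier A \<Longrightarrow> \<zero> \<otimes> x = \<zero>"
  using smult_m_l[of \<zero> x 0] by (simp add: smult_zero_l m_closed)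

lemma mult_zero_right: "x \<in> carrier A \<Longrightarrow> x \<otimes> \<zero> = \<zero>"
  using smult_m_r[of x \<zero> 0] by (simp add: smult_zero_l m_closed)

text \<open>Over an infinite index set \<open>finsum\<close> is \<open>\<zero>\<close> by
  convention, and the adjoint preserves \<open>\<zero>\<close>, as do the multiplications in the
  next two lemmas; this settles the infinite case of the inductions.\<close>

lemma finsum_adj: "f \<in> I \<rightarrow> carrier A \<Longrightarrow> (finsum A f I)\<^sup>\<star> = (\<Oplus>i\<in>I. (f i)\<^sup>\<star>)"
  by (induction I rule: infinite_finite_induct)
    (simp_all add: finsum_infinite adj_zero adj_add adj_closed Pi_iff)

lemma finsum_mult_right:
  "\<lbrakk>f \<in> I \<rightarrow> carrier A; x \<in> carrier A\<rbrakk> \<Longrightarrow> finsum A f I \<otimes> x = (\<Oplus>i\<in>I. f i \<otimes> x)"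
  by (induction I rule: infinite_finite_induct)
    (simp_all add: finsum_infinite mult_zero_left l_distr m_closed Pi_iff)

lemma finsum_mult_left:
  "\<lbrakk>f \<in> I \<rightarrow> carrier A; x \<in> carrier A\<rbrakk> \<Longrightarrow> x \<otimes> finsum A f I = (\<Oplus>i\<in>I. x \<otimes> f i)"
  by (induction I rule: infinite_finite_induct)
    (simp_all add: finsum_infinite mult_zero_right r_distr m_closed Pi_iff)

lemma finsum_if:
  assumes "finite I" "f \<in> {i \<in> I. P i} \<rightarrow> carrier A"
  shows "(\<Oplus>i\<in>I. if P i then f i else \<zero>) = finsum A f {i \<in> I. P i}"
  using assms
proof (induction I rule: finite_induct)
  case (insert i I)
  have "{j \<in> insert i I. P j} = (if P i then insert i {j \<in> I. P j} else {j \<in> I. P j})" by auto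
  with insert show ?case by (simp add: Pi_iff)
qed simp

lemma finsum_delta:
  assumes "finite I" "x \<in> carrier A"
  shows "(\<Oplus>j\<in>I. if j = i then x else \<zero>) = (if i \<in> I then x else \<zero>)"
proof -
  have "(\<Oplus>j\<in>I. if j = i then x else \<zero>) = finsum A (\<lambda>_. x) {j \<in> I. j = i}"
    using assms by (intro finsum_if) auto
  also have "{j \<in> I. j = i} = (if i \<in> I then {i} else {})" by auto
  finally show ?thesis using assms by simp
qed

text \<open>All products of vertex sums and of edge sums with adjoint edge sums rest on this
  collapse of a double sum to its diagonal.\<close>

lemma finsum_mult_finsum_orthogonal:
  assumes fin: "finite I" "finite J" and f: "f \<in> I \<rightarrow> carrier A" and g: "g \<in> J \<rightarrow> carrier A"
    and orth: "\<And>i j. \<lbrakk>i \<in> I; j \<in> J; i \<noteq> j\<rbrakk> \<Longrightarrow> f i \<otimes> g j = \<zero>"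
  shows "finsum A f I \<otimes> finsum A g J = (\<Oplus>i\<in>I \<inter> J. f i \<otimes> g i)"
proof -
  note fc = Pi_memD[OF f] and gc = Pi_memD[OF g]
  have "finsum A f I \<otimes> finsum A g J = (\<Oplus>i\<in>I. f i \<otimes> finsum A g J)"
    using f g by (intro finsum_mult_right finsum_closed)
  also have "\<dots> = (\<Oplus>i\<in>I. if i \<in> J then f i \<otimes> g i else \<zero>)"
  proof (rule finsum_cong')
    fix i assume i: "i \<in> I"
    have "f i \<otimes> finsum A g J = (\<Oplus>j\<in>J. f i \<otimes> g j)"
      by (rule finsum_mult_left[OF g fc[OF i]])
    also have "\<dots> = (\<Oplus>j\<in>J. if j = i then f i \<otimes> g j else \<zero>)"
      using fc gc i orth[OF i] by (intro finsum_cong') (auto simp: m_closed)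
    also have "\<dots> = (\<Oplus>j\<in>{j \<in> J. j = i}. f i \<otimes> g j)"
      using fc gc i fin by (intro finsum_if) (auto simp: m_closed)
    also have "\<dots> = (if i \<in> J then f i \<otimes> g i else \<zero>)"
    proof -
      have "{j \<in> J. j = i} = (if i \<in> J then {i} else {})" by auto
      then show ?thesis using fc[OF i] gc by (simp add: m_closed)
    qed
    finally show "f i \<otimes> finsum A g J = (if i \<in> J then f i \<otimes> g i else \<zero>)" .
  qed (use fc gc in \<open>auto simp: m_closed\<close>)
  also have "\<dots> = (\<Oplus>i\<in>{i \<in> I. i \<in> J}. f i \<otimes> g i)"
    using fc gc fin by (intro finsum_if) (auto simp: m_closed)
  also have "{i \<in> I. i \<in> J} = I \<inter> J" by auto
  finally show ?thesis .
qed

end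

section \<open>Cuntz-Krieger families\<close>

locale cuntz_krieger = wf_digraph E + star_algebra A
  for E :: "('v, 'e) pre_digraph" and A :: "'a cstar" (structure)
    and p :: "'v \<Rightarrow> 'a" and s :: "'e \<Rightarrow> 'a" +
  assumes ck: "cuntz_krieger_family E A p s"
begin

lemmas ckD = ck[unfolded cuntz_krieger_family_def projection_def partial_isometry_def
    subprojection_def]

lemma vertex_closed [simp]: "v \<in> verts E \<Longrightarrow> p v \<in> carrier A"
  and edge_closed [simp]: "e \<in> arcs E \<Longrightarrow> s e \<in> carrier A"
  and edge_adj_closed [simp]: "e \<in> arcs E \<Longrightarrow> (s e)\<^sup>\<star> \<in> carrier A"
  using ckD by (auto simp: adj_closed)

lemma vertex_adj: "v \<in> verts E \<Longrightarrow> (p v)\<^sup>\<star> = p v"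
  using ckD by auto

lemma vertex_mult_vertex:
  "\<lbrakk>v \<in> verts E; w \<in> verts E\<rbrakk> \<Longrightarrow> p v \<otimes> p w = (if v = w then p v else \<zero>)"
  using ckD by auto

text \<open>The relations only make the range projections orthogonal. Writing P_e = s_e s_e^* and
  expanding both factors gives s_e^* s_f = s_e^* P_e P_f s_f, where the middle product vanishes for
  distinct edges.\<close>

lemma edge_adj_mult_edge:
  assumes "e \<in> arcs E" "f \<in> arcs E"
  shows "(s e)\<^sup>\<star> \<otimes> s f = (if e = f then p (head E e) else \<zero>)"
proof (cases "e = f")
  case False
  have "s e \<otimes> (s e)\<^sup>\<star> \<otimes> s e = s e" "s f \<otimes> (s f)\<^sup>\<star> \<otimes> s f = s f"
    using ckD assms by auto
  then have "(s e)\<^sup>\<star> \<otimes> s f = (s e \<otimes> (s e)\<^sup>\<star> \<otimes> s e)\<^sup>\<star> \<otimes> (s f \<otimes> (s f)\<^sup>\<star> \<otimes> s f)" by simp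
  also have "\<dots> = (s e)\<^sup>\<star> \<otimes> ((s e \<otimes> (s e)\<^sup>\<star>) \<otimes> (s f \<otimes> (s f)\<^sup>\<star>)) \<otimes> s f"
    using assms by (simp add: adj_mult m_closed adj_adj m_assoc)
  also have "(s e \<otimes> (s e)\<^sup>\<star>) \<otimes> (s f \<otimes> (s f)\<^sup>\<star>) = \<zero>" using ckD assms False by auto
  finally show ?thesis using False assms by (simp add: mult_zero_left mult_zero_right)
qed (use ckD assms in auto)

lemma edge_mult_head:
  assumes e: "e \<in> arcs E" shows "s e \<otimes> p (head E e) = s e"
proof -
  have *: "s e \<otimes> (s e)\<^sup>\<star> \<otimes> s e = s e" "(s e)\<^sup>\<star> \<otimes> s e = p (head E e)" using ckD e by auto
  have "s e \<otimes> ((s e)\<^sup>\<star> \<otimes> s e) = s e \<otimes> (s e)\<^sup>\<star> \<otimes> s e" using e by (simp add: m_assoc)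
  then show ?thesis unfolding * .
qed

lemma tail_mult_edge:
  assumes e: "e \<in> arcs E" shows "p (tail E e) \<otimes> s e = s e"
proof -
  have *: "s e \<otimes> (s e)\<^sup>\<star> \<otimes> s e = s e" "p (tail E e) \<otimes> (s e \<otimes> (s e)\<^sup>\<star>) = s e \<otimes> (s e)\<^sup>\<star>"
    using ckD e by auto
  have "p (tail E e) \<otimes> (s e \<otimes> (s e)\<^sup>\<star> \<otimes> s e) = p (tail E e) \<otimes> (s e \<otimes> (s e)\<^sup>\<star>) \<otimes> s e"
    using e by (simp add: m_assoc m_closed)
  then show ?thesis unfolding * .
qed

lemma vertex_mult_edge:
  assumes "v \<in> verts E" "e \<in> arcs E"
  shows "p v \<otimes> s e = (if v = tail E e then s e else \<zero>)"
proof -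
  have "p v \<otimes> s e = (p v \<otimes> p (tail E e)) \<otimes> s e"
    using assms by (simp add: m_assoc tail_mult_edge)
  then show ?thesis using assms by (simp add: vertex_mult_vertex tail_mult_edge mult_zero_left)
qed

lemma edge_mult_vertex:
  assumes "v \<in> verts E" "e \<in> arcs E"
  shows "s e \<otimes> p v = (if v = head E e then s e else \<zero>)"
proof -
  have "s e \<otimes> p v = s e \<otimes> (p (head E e) \<otimes> p v)"
    using assms by (simp add: m_assoc[symmetric] edge_mult_head)
  then show ?thesis using assms by (simp add: vertex_mult_vertex edge_mult_head mult_zero_right)
qed

text \<open>Insert the range projection of f: s_e s_f^* = s_e p_w s_f^* with w = r(f), and s_e p_w =
  0 since w differs from r(e).\<close>

lemma edge_mult_edge_adj:
  assumes "e \<in> arcs E" "f \<in> arcs E" "head E e \<noteq> head E f"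
  shows "s e \<otimes> (s f)\<^sup>\<star> = \<zero>"
proof -
  have "s e \<otimes> (s f)\<^sup>\<star> = s e \<otimes> (s f \<otimes> p (head E f))\<^sup>\<star>"
    using assms by (simp add: edge_mult_head)
  also have "\<dots> = s e \<otimes> p (head E f) \<otimes> (s f)\<^sup>\<star>"
    using assms by (simp add: adj_mult vertex_adj m_assoc)
  finally show ?thesis using assms by (simp add: edge_mult_vertex mult_zero_left)
qed

abbreviation vertex_sum :: "'v set \<Rightarrow> 'a" where
  "vertex_sum X \<equiv> \<Oplus>v\<in>X. p v"

abbreviation edge_sum :: "'e set \<Rightarrow> 'a" where
  "edge_sum F \<equiv> \<Oplus>e\<in>F. s e"

lemma vertex_sum_closed [simp]: "X \<subseteq> verts E \<Longrightarrow> vertex_sum X \<in> carrier A"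
  by (intro finsum_closed) auto

lemma edge_sum_closed [simp]: "F \<subseteq> arcs E \<Longrightarrow> edge_sum F \<in> carrier A"
  by (intro finsum_closed) auto

lemma vertex_sum_mult_vertex_sum:
  assumes "finite X" "finite Y" "X \<subseteq> verts E" "Y \<subseteq> verts E"
  shows "vertex_sum X \<otimes> vertex_sum Y = vertex_sum (X \<inter> Y)"
proof -
  have "vertex_sum X \<otimes> vertex_sum Y = (\<Oplus>v\<in>X \<inter> Y. p v \<otimes> p v)"
    using assms by (intro finsum_mult_finsum_orthogonal) (auto simp: vertex_mult_vertex subset_iff)
  also have "\<dots> = vertex_sum (X \<inter> Y)"
    using assms by (intro finsum_cong') (auto simp: vertex_mult_vertex)
  finally show ?thesis .
qed

lemma projection_vertex_sum:
  assumes "finite X" "X \<subseteq> verts E" shows "projection A (vertex_sum X)"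
proof -
  have "(vertex_sum X)\<^sup>\<star> = (\<Oplus>v\<in>X. (p v)\<^sup>\<star>)" using assms by (intro finsum_adj) auto
  also have "\<dots> = vertex_sum X" using assms by (intro finsum_cong') (auto simp: vertex_adj)
  finally show ?thesis
    using assms vertex_sum_mult_vertex_sum[of X X] by (simp add: projection_def)
qed

lemma vertex_sum_Un:
  assumes "finite X" "finite Y" "X \<subseteq> verts E" "Y \<subseteq> verts E"
  shows "vertex_sum (X \<union> Y) = (vertex_sum X \<oplus> vertex_sum Y) \<ominus> vertex_sum (X \<inter> Y)"
proof -
  have "vertex_sum (X \<union> Y) \<oplus> vertex_sum (X \<inter> Y) = vertex_sum X \<oplus> vertex_sum Y"
    using assms by (intro finsum_Un_Int) auto
  moreover have "vertex_sum (X \<union> Y) \<in> carrier A" "vertex_sum (X \<inter> Y) \<in> carrier A"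
    using assms by (intro vertex_sum_closed; blast)+
  ultimately show ?thesis by (metis a_assoc a_inv_closed minus_eq r_neg r_zero)
qed

text \<open>Left multiplication selects edges by source; the mirror lemma below selects them by
  range. Together they reduce the commutation relation of a labelled representation to an equality
  of edge sets.\<close>

lemma vertex_sum_mult_edge_sum:
  assumes X: "finite X" "X \<subseteq> verts E" and F: "finite F" "F \<subseteq> arcs E"
  shows "vertex_sum X \<otimes> edge_sum F = edge_sum {e \<in> F. tail E e \<in> X}"
proof -
  have "vertex_sum X \<otimes> edge_sum F = (\<Oplus>e\<in>F. vertex_sum X \<otimes> s e)"
    using X F by (intro finsum_mult_left) auto
  also have "\<dots> = (\<Oplus>e\<in>F. if tail E e \<in> X then s e else \<zero>)"
  proof (rule finsum_cong')
    fix e assume "e \<in> F"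
    then have e: "e \<in> arcs E" using F by auto
    have "vertex_sum X \<otimes> s e = (\<Oplus>v\<in>X. p v \<otimes> s e)"
      using X e by (intro finsum_mult_right) auto
    also have "\<dots> = (\<Oplus>v\<in>X. if v = tail E e then s e else \<zero>)"
      using X e by (intro finsum_cong') (auto simp: vertex_mult_edge)
    also have "\<dots> = (if tail E e \<in> X then s e else \<zero>)"
      using X e finsum_delta[of X "s e"] by simp
    finally show "vertex_sum X \<otimes> s e = (if tail E e \<in> X then s e else \<zero>)" .
  qed (use F in auto)
  also have "\<dots> = edge_sum {e \<in> F. tail E e \<in> X}" using F by (intro finsum_if) auto
  finally show ?thesis .
qed

lemma edge_sum_mult_vertex_sum:
  assumes X: "finite X" "X \<subseteq> verts E" and F: "finite F" "F \<subseteq> arcs E"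
  shows "edge_sum F \<otimes> vertex_sum X = edge_sum {e \<in> F. head E e \<in> X}"
proof -
  have "edge_sum F \<otimes> vertex_sum X = (\<Oplus>e\<in>F. s e \<otimes> vertex_sum X)"
    using X F by (intro finsum_mult_right) auto
  also have "\<dots> = (\<Oplus>e\<in>F. if head E e \<in> X then s e else \<zero>)"
  proof (rule finsum_cong')
    fix e assume "e \<in> F"
    then have e: "e \<in> arcs E" using F by auto
    have "s e \<otimes> vertex_sum X = (\<Oplus>v\<in>X. s e \<otimes> p v)"
      using X e by (intro finsum_mult_left) auto
    also have "\<dots> = (\<Oplus>v\<in>X. if v = head E e then s e else \<zero>)"
      using X e by (intro finsum_cong') (auto simp: edge_mult_vertex)
    also have "\<dots> = (if head E e \<in> X then s e else \<zero>)"
      using X e finsum_delta[of X "s e"] by simp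
    finally show "s e \<otimes> vertex_sum X = (if head E e \<in> X then s e else \<zero>)" .
  qed (use F in auto)
  also have "\<dots> = edge_sum {e \<in> F. head E e \<in> X}" using F by (intro finsum_if) auto
  finally show ?thesis .
qed

lemma edge_sum_adj: "F \<subseteq> arcs E \<Longrightarrow> (edge_sum F)\<^sup>\<star> = (\<Oplus>e\<in>F. (s e)\<^sup>\<star>)"
  by (intro finsum_adj) auto

text \<open>The diagonal terms are range projections indexed by edges. Injectivity of
  \<open>head E\<close> reindexes them by the set of range vertices, with no vertex repeated. For
  disjoint edge sets the value is zero.\<close>

lemma edge_sum_adj_mult_edge_sum:
  assumes "finite F" "F \<subseteq> arcs E" "finite G" "G \<subseteq> arcs E" "inj_on (head E) (F \<inter> G)"
  shows "(edge_sum F)\<^sup>\<star> \<otimes> edge_sum G = vertex_sum (head E ` (F \<inter> G))"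
proof -
  have "(edge_sum F)\<^sup>\<star> \<otimes> edge_sum G = (\<Oplus>e\<in>F \<inter> G. (s e)\<^sup>\<star> \<otimes> s e)"
    unfolding edge_sum_adj[OF assms(2)]
    using assms by (intro finsum_mult_finsum_orthogonal) (auto simp: edge_adj_mult_edge subset_iff)
  also have "\<dots> = (\<Oplus>e\<in>F \<inter> G. p (head E e))"
    using assms by (intro finsum_cong') (auto simp: edge_adj_mult_edge subset_iff)
  also have "\<dots> = vertex_sum (head E ` (F \<inter> G))"
    using assms by (intro finsum_reindex[symmetric]) auto
  finally show ?thesis .
qed

text \<open>Injectivity is required on the union because an off-diagonal term pairs an edge of
  \<open>F\<close> with an edge of \<open>G\<close>.\<close>

lemma edge_sum_mult_edge_sum_adj:
  assumes "finite F" "F \<subseteq> arcs E" "finite G" "G \<subseteq> arcs E" and inj: "inj_on (head E) (F \<union> G)"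
  shows "edge_sum F \<otimes> (edge_sum G)\<^sup>\<star> = (\<Oplus>e\<in>F \<inter> G. s e \<otimes> (s e)\<^sup>\<star>)"
  unfolding edge_sum_adj[OF assms(4)]
proof (rule finsum_mult_finsum_orthogonal)
  fix e f assume ef: "e \<in> F" "f \<in> G" "e \<noteq> f"
  then have "head E e \<noteq> head E f" using inj_onD[OF inj, of e f] by blast
  then show "s e \<otimes> (s f)\<^sup>\<star> = \<zero>" using ef assms by (intro edge_mult_edge_adj) auto
qed (use assms in auto)

lemma vertex_sum_eq_edges:
  assumes "finite X" "X \<subseteq> verts E" "X \<inter> sinks E = {}" "\<And>v. v \<in> X \<Longrightarrow> finite (out_arcs E v)"
  shows "vertex_sum X = (\<Oplus>e\<in>{e \<in> arcs E. tail E e \<in> X}. s e \<otimes> (s e)\<^sup>\<star>)"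
proof -
  have "vertex_sum X = (\<Oplus>v\<in>X. \<Oplus>e\<in>out_arcs E v. s e \<otimes> (s e)\<^sup>\<star>)"
  proof (rule finsum_cong')
    fix v assume "v \<in> X"
    then have "v \<in> verts E" "finite (out_arcs E v)" "out_arcs E v \<noteq> {}"
      using assms by (auto simp: sinks_def)
    then show "p v = (\<Oplus>e\<in>out_arcs E v. s e \<otimes> (s e)\<^sup>\<star>)"
      using ck unfolding cuntz_krieger_family_def by simp
  qed (auto intro!: finsum_closed simp: m_closed)
  also have "\<dots> = (\<Oplus>e\<in>(\<Union>v\<in>X. out_arcs E v). s e \<otimes> (s e)\<^sup>\<star>)"
    using assms by (intro add.finprod_UN_disjoint[folded finsum_def, symmetric]) (auto simp: m_closed pairwise_def disjnt_def)
  also have "(\<Union>v\<in>X. out_arcs E v) = {e \<in> arcs E. tail E e \<in> X}" by auto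
  finally show ?thesis .
qed

end

section \<open>Labelled spaces of finite sets containing the singletons\<close>

lemma (in labelled_graph) finite_edges_with_label:
  assumes "label_finite E lab alphabet"
  shows "finite {e \<in> arcs E. lab e = a}"
proof (cases "a \<in> alphabet")
  case False
  then have "{e \<in> arcs E. lab e = a} = {}" using lab_surj by auto
  then show ?thesis by (simp only: finite.emptyI)
qed (use assms in \<open>simp add: label_finite_def\<close>)

text \<open>The common ground of \<open>E_zero\<close> and \<open>E_zero_minus\<close> under the
  hypotheses, so that a single isomorphism theorem serves both. Whether \<open>{}\<close> belongs to
  \<open>\<C>\<close> is left open.\<close>

locale singleton_space = labelled_graph E lab alphabet
  for E :: "('v, 'e) pre_digraph" and lab :: "'e \<Rightarrow> 'l" and alphabet :: "'l set" +
  fixes \<C> :: "'v set set"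
  assumes left_resolving: "left_resolving E lab"
    and row_finite: "row_finite E"
    and label_finite: "label_finite E lab alphabet"
    and accommodating: "accommodating E lab \<C>"
    and finite_sets: "X \<in> \<C> \<Longrightarrow> finite X"
    and singletons: "v \<in> verts E \<Longrightarrow> {v} \<in> \<C>"
begin

abbreviation edges_labelled :: "'l \<Rightarrow> 'e set" where
  "edges_labelled a \<equiv> {e \<in> arcs E. lab e = a}"

abbreviation edges_from :: "'v set \<Rightarrow> 'l \<Rightarrow> 'e set" where
  "edges_from X a \<equiv> {e \<in> edges_labelled a. tail E e \<in> X}"

lemma sets_subset: "X \<in> \<C> \<Longrightarrow> X \<subseteq> verts E"
  and sets_Int: "X \<in> \<C> \<Longrightarrow> Y \<in> \<C> \<Longrightarrow> X \<inter> Y \<in> \<C>"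
  and sets_Un: "X \<in> \<C> \<Longrightarrow> Y \<in> \<C> \<Longrightarrow> X \<union> Y \<in> \<C>"
  and rel_rng_sets: "X \<in> \<C> \<Longrightarrow> a \<in> letters E lab \<Longrightarrow> rel_rng E lab X [a] \<in> \<C>"
  and word_rng_sets: "a \<in> letters E lab \<Longrightarrow> word_rng E lab [a] \<in> \<C>"
  using accommodating by (auto simp: accommodating_def letters_def)

lemma finite_nonempty_sets: "\<lbrakk>finite X; X \<noteq> {}; X \<subseteq> verts E\<rbrakk> \<Longrightarrow> X \<in> \<C>"
proof (induction X rule: finite_ne_induct)
  case (insert v X)
  then show ?case using sets_Un[OF singletons[of v], of X] by simp
qed (simp add: singletons)

lemma finite_edges_labelled: "finite (edges_labelled a)"
  by (rule finite_edges_with_label[OF label_finite])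

lemma finite_edges_from: "finite (edges_from X a)"
  by (rule finite_subset[OF _ finite_edges_labelled[of a]]) auto

text \<open>Left-resolving fixes the range and separates labels; this is the same condition with the
  label fixed and ranges separated, the form in which it is applied throughout.\<close>

lemma inj_on_head: "inj_on (head E) (edges_labelled a)"
proof (rule inj_onI)
  fix e f assume "e \<in> edges_labelled a" "f \<in> edges_labelled a" "head E e = head E f"
  then have "e \<in> in_arcs E (head E e)" "f \<in> in_arcs E (head E e)" "lab e = lab f" "e \<in> arcs E"
    by auto
  then show "e = f"
    using left_resolving unfolding left_resolving_def by (meson head_in_verts inj_onD)
qed

lemma is_path_single: "is_path E u [e] v \<longleftrightarrow> e \<in> arcs E \<and> tail E e = u \<and> head E e = v"
  by (auto simp: is_path_def awalk_def cas_simp)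

text \<open>The relations of a representation mention one-letter words only, and this equivalence
  replaces their paths by edges.\<close>

lemma path_single_label:
  "(\<exists>l. is_path E u l v \<and> map lab l = [a]) \<longleftrightarrow>
    (\<exists>e\<in>edges_labelled a. tail E e = u \<and> head E e = v)"
proof -
  have "(\<exists>l. is_path E u l v \<and> map lab l = [a]) \<longleftrightarrow> (\<exists>e. is_path E u [e] v \<and> lab e = a)"
    by (auto simp: map_eq_Cons_conv)
  then show ?thesis by (auto simp: is_path_single)
qed

lemma word_rng_single: "word_rng E lab [a] = head E ` edges_labelled a"
  unfolding word_rng_def path_single_label by auto

lemma rel_rng_single: "rel_rng E lab X [a] = head E ` edges_from X a"
  unfolding rel_rng_def path_single_label by auto

lemma letters_eq: "letters E lab = lab ` arcs E"
proof -
  have "a \<in> letters E lab \<longleftrightarrow> (\<exists>u v l. is_path E u l v \<and> map lab l = [a])" for a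
    unfolding letters_def words_def mem_Collect_eq by metis
  then show ?thesis unfolding path_single_label by auto
qed

lemma letters_from_eq: "letters_from E lab X = lab ` {e \<in> arcs E. tail E e \<in> X}"
proof -
  have "word_src E lab [a] = tail E ` edges_labelled a" for a
  proof -
    have "word_src E lab [a] = {u. \<exists>v l. is_path E u l v \<and> map lab l = [a]}"
      unfolding word_src_def by (subst ex_comm) rule
    then show ?thesis unfolding path_single_label by auto
  qed
  then show ?thesis unfolding letters_from_def letters_eq by (fastforce simp: image_iff)
qed

text \<open>An edge labelled \<open>a\<close> that ends in r(X,a) shares its range with an edge
  labelled \<open>a\<close> starting in \<open>X\<close>, and by left-resolving the two
  coincide.\<close>

lemma head_in_rel_rng:
  "{e \<in> edges_labelled a. head E e \<in> rel_rng E lab X [a]} = edges_from X a"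
  unfolding rel_rng_single using inj_on_head[of a] by (auto simp: inj_on_def)

lemma finite_out: "v \<in> verts E \<Longrightarrow> finite (out_arcs E v)"
  using row_finite by (simp add: row_finite_def)

section \<open>Passage between Cuntz-Krieger families and labelled representations\<close>

lemma labelled_representation_of_cuntz_krieger:
  fixes A :: "'a cstar"
  assumes A: "star_algebra A" and ck: "cuntz_krieger_family E A p s"
  shows "labelled_representation E lab \<C> A
    (\<lambda>X. \<Oplus>\<^bsub>A\<^esub>v\<in>X. p v) (\<lambda>a. \<Oplus>\<^bsub>A\<^esub>e\<in>edges_labelled a. s e)"
proof -
  interpret cuntz_krieger E A p s
    using A ck wf_digraph_axioms by (simp add: cuntz_krieger_def cuntz_krieger_axioms_def)
  let ?F = edges_labelled
  note [simp] = finite_sets sets_subset finite_edges_labelled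
  have F [simp]: "?F a \<subseteq> arcs E" for a by auto
  have range: "(edge_sum (?F a))\<^sup>\<star>\<^bsub>A\<^esub> \<otimes>\<^bsub>A\<^esub> edge_sum (?F a) = vertex_sum (word_rng E lab [a])" for a
    using edge_sum_adj_mult_edge_sum[of "?F a" "?F a"] inj_on_head by (simp add: word_rng_single)
  \<comment> \<open>Cutting down by r(X,a) on the right keeps exactly the edges that
    \<open>vertex_sum X\<close> keeps on the left.\<close>
  have mult_rel_rng:
    "edge_sum (?F a) \<otimes>\<^bsub>A\<^esub> vertex_sum (rel_rng E lab X [a]) = edge_sum (edges_from X a)"
    if "X \<in> \<C>" "a \<in> letters E lab" for X a
    using edge_sum_mult_vertex_sum[of "rel_rng E lab X [a]" "?F a"] rel_rng_sets[OF that]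
    by (simp only: head_in_rel_rng finite_sets sets_subset finite_edges_labelled F)
  show ?thesis
    unfolding labelled_representation_def
  proof (intro conjI ballI impI)
    fix X assume X: "X \<in> \<C>"
    then show "projection A (vertex_sum X)" by (intro projection_vertex_sum) auto
    fix Y assume "Y \<in> \<C>"
    with X show "vertex_sum X \<otimes>\<^bsub>A\<^esub> vertex_sum Y = vertex_sum (X \<inter> Y)"
      by (intro vertex_sum_mult_vertex_sum) auto
    show "vertex_sum (X \<union> Y) = (vertex_sum X \<oplus>\<^bsub>A\<^esub> vertex_sum Y) \<ominus>\<^bsub>A\<^esub> vertex_sum (X \<inter> Y)"
      using X \<open>Y \<in> \<C>\<close> by (intro vertex_sum_Un) auto
  next
    fix X a assume Xa: "X \<in> \<C>" "a \<in> letters E lab"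
    show "vertex_sum X \<otimes>\<^bsub>A\<^esub> edge_sum (?F a) = edge_sum (?F a) \<otimes>\<^bsub>A\<^esub> vertex_sum (rel_rng E lab X [a])"
      unfolding mult_rel_rng[OF Xa] using Xa by (intro vertex_sum_mult_edge_sum) auto
  next
    fix a assume a: "a \<in> letters E lab"
    \<comment> \<open>The initial projection is the vertex sum over r(a), and every edge labelled
      \<open>a\<close> ends there, so multiplying by it changes nothing.\<close>
    show "partial_isometry A (edge_sum (?F a))"
    proof -
      have "edge_sum (?F a) \<otimes>\<^bsub>A\<^esub> (edge_sum (?F a))\<^sup>\<star>\<^bsub>A\<^esub> \<otimes>\<^bsub>A\<^esub> edge_sum (?F a)
          = edge_sum (?F a) \<otimes>\<^bsub>A\<^esub> vertex_sum (word_rng E lab [a])"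
        using edge_sum_closed[OF F, of a] by (simp add: m_assoc adj_closed range)
      also have "\<dots> = edge_sum {e \<in> ?F a. head E e \<in> word_rng E lab [a]}"
        using word_rng_sets[OF a] by (intro edge_sum_mult_vertex_sum) auto
      also have "{e \<in> ?F a. head E e \<in> word_rng E lab [a]} = ?F a" by (auto simp: word_rng_single)
      finally show ?thesis using edge_sum_closed[OF F, of a] by (simp add: partial_isometry_def)
    qed
    show "(edge_sum (?F a))\<^sup>\<star>\<^bsub>A\<^esub> \<otimes>\<^bsub>A\<^esub> edge_sum (?F a) = vertex_sum (word_rng E lab [a])" by (rule range)
    fix b assume "a \<noteq> b"
    then have "?F a \<inter> ?F b = {}" by auto
    then show "(edge_sum (?F a))\<^sup>\<star>\<^bsub>A\<^esub> \<otimes>\<^bsub>A\<^esub> edge_sum (?F b) = \<zero>\<^bsub>A\<^esub>"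
      using edge_sum_adj_mult_edge_sum[of "?F a" "?F b"] by simp
  next
    fix X assume X: "X \<in> \<C>" and fin: "finite (letters_from E lab X) \<and>
      letters_from E lab X \<noteq> {} \<and> X \<inter> sinks E = {}"
    let ?r = "\<lambda>e. s e \<otimes>\<^bsub>A\<^esub> (s e)\<^sup>\<star>\<^bsub>A\<^esub>"
    have "vertex_sum X = (\<Oplus>\<^bsub>A\<^esub>e\<in>{e \<in> arcs E. tail E e \<in> X}. ?r e)"
      using fin finite_out subsetD[OF sets_subset[OF X]]
      by (intro vertex_sum_eq_edges finite_sets[OF X] sets_subset[OF X]) blast+
    \<comment> \<open>The edges leaving \<open>X\<close> are now regrouped by label instead of by
      source vertex.\<close>
    also have "{e \<in> arcs E. tail E e \<in> X} = (\<Union>a\<in>letters_from E lab X. edges_from X a)"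
      by (auto simp: letters_from_eq)
    also have "(\<Oplus>\<^bsub>A\<^esub>e\<in>\<dots>. ?r e) = (\<Oplus>\<^bsub>A\<^esub>a\<in>letters_from E lab X. \<Oplus>\<^bsub>A\<^esub>e\<in>edges_from X a. ?r e)"
      using fin by (intro add.finprod_UN_disjoint[folded finsum_def] finite_edges_from)
        (auto simp: m_closed pairwise_def disjnt_def)
    also have "\<dots> = (\<Oplus>\<^bsub>A\<^esub>a\<in>letters_from E lab X. edge_sum (?F a) \<otimes>\<^bsub>A\<^esub>
        vertex_sum (rel_rng E lab X [a]) \<otimes>\<^bsub>A\<^esub> (edge_sum (?F a))\<^sup>\<star>\<^bsub>A\<^esub>)"
    proof (rule finsum_cong')
      fix a assume "a \<in> letters_from E lab X"
      then have a: "a \<in> letters E lab" by (simp add: letters_from_def)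
      \<comment> \<open>The labelled summand is the edge sum of \<open>edges_from X a\<close> times
        the adjoint of the full edge sum of \<open>a\<close>; only the range projections of their
        common edges survive.\<close>
      have "edges_from X a \<union> ?F a = ?F a" "edges_from X a \<inter> ?F a = edges_from X a" by auto
      then show "(\<Oplus>\<^bsub>A\<^esub>e\<in>edges_from X a. ?r e) = edge_sum (?F a) \<otimes>\<^bsub>A\<^esub>
          vertex_sum (rel_rng E lab X [a]) \<otimes>\<^bsub>A\<^esub> (edge_sum (?F a))\<^sup>\<star>\<^bsub>A\<^esub>"
        unfolding mult_rel_rng[OF X a]
        using edge_sum_mult_edge_sum_adj[of "edges_from X a" "?F a"] inj_on_head[of a]
          finite_edges_from[of a X] by auto
    next
      have "edge_sum (?F a) \<otimes>\<^bsub>A\<^esub> vertex_sum (rel_rng E lab X [a]) \<otimes>\<^bsub>A\<^esub> (edge_sum (?F a))\<^sup>\<star>\<^bsub>A\<^esub>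
          \<in> carrier A" if "a \<in> letters E lab" for a
        using edge_sum_closed[OF F, of a] vertex_sum_closed[OF sets_subset[OF rel_rng_sets[OF X that]]]
        by (intro m_closed adj_closed)
      then show "(\<lambda>a. edge_sum (?F a) \<otimes>\<^bsub>A\<^esub> vertex_sum (rel_rng E lab X [a]) \<otimes>\<^bsub>A\<^esub>
          (edge_sum (?F a))\<^sup>\<star>\<^bsub>A\<^esub>) \<in> letters_from E lab X \<rightarrow> carrier A"
        by (simp add: letters_from_def Pi_iff)
    qed simp
    finally show "vertex_sum X = (\<Oplus>\<^bsub>A\<^esub>a\<in>letters_from E lab X. edge_sum (?F a) \<otimes>\<^bsub>A\<^esub>
        vertex_sum (rel_rng E lab X [a]) \<otimes>\<^bsub>A\<^esub> (edge_sum (?F a))\<^sup>\<star>\<^bsub>A\<^esub>)" .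
  qed simp
qed


text \<open>A set is built up by adjoining one vertex at a time, and \<open>q\<close> is additive
  over disjoint unions once \<open>q {}\<close> vanishes. Adjoining to the empty set is treated
  apart, since \<open>{}\<close> may lie outside \<open>\<C>\<close>.\<close>

lemma labelled_representation_eq_sum:
  fixes A :: "'a cstar"
  assumes A: "star_algebra A" and lr: "labelled_representation E lab \<C> A q t" and X: "X \<in> \<C>"
  shows "q X = (\<Oplus>\<^bsub>A\<^esub>v\<in>X. q {v})"
proof -
  interpret star_algebra A by fact
  note c = lr[unfolded labelled_representation_def]
  note qc = Pi_memD[OF labelled_representation_closed(1)[OF lr]]
  have "finite X" using X by (rule finite_sets)
  then show ?thesis using X
  proof (induction X rule: finite_induct)
    case empty
    then show ?case using c by simp
  next
    case (insert v X)
    have v: "{v} \<in> \<C>" and sub: "X \<subseteq> verts E"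
      using sets_subset[OF insert.prems] singletons by auto
    show ?case
    proof (cases "X = {}")
      case False
      then have X: "X \<in> \<C>" using insert.hyps(1) sub by (intro finite_nonempty_sets)
      have empty: "{v} \<inter> X = {}" using insert.hyps(2) by blast
      \<comment> \<open>Two disjoint members force \<open>{}\<close> into \<open>\<C>\<close>, so
        the relation at the empty set is available exactly when additivity calls for it.\<close>
      have "{} \<in> \<C>" using sets_Int[OF v X] unfolding empty .
      then have "q ({v} \<inter> X) = \<zero>\<^bsub>A\<^esub>" unfolding empty using c by blast
      moreover have "q ({v} \<union> X) = (q {v} \<oplus>\<^bsub>A\<^esub> q X) \<ominus>\<^bsub>A\<^esub> q ({v} \<inter> X)" using c v X by blast
      ultimately have "q (insert v X) = q {v} \<oplus>\<^bsub>A\<^esub> q X"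
        using qc[OF v] qc[OF X] by (simp add: a_minus_def)
      moreover have "(\<lambda>w. q {w}) \<in> X \<rightarrow> carrier A" using sub qc singletons by blast
      ultimately show ?thesis using insert.hyps insert.IH[OF X] qc[OF v] by simp
    qed (use qc[OF v] in simp)
  qed
qed

text \<open>Nearly everything follows from the products of an adjoint edge element with an edge
  element: different labels are separated by the relation for \<open>t\<close>, equal labels by the
  orthogonality of distinct range vertices.\<close>

lemma cuntz_krieger_of_labelled_representation:
  fixes A :: "'a cstar"
  assumes A: "star_algebra A" and lr: "labelled_representation E lab \<C> A q t"
  shows "cuntz_krieger_family E A (\<lambda>v. q {v}) (\<lambda>e. t (lab e) \<otimes>\<^bsub>A\<^esub> q {head E e})"
proof -
  interpret star_algebra A by fact
  note c = lr[unfolded labelled_representation_def]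
  note qc = Pi_memD[OF labelled_representation_closed(1)[OF lr]]
    and tc = Pi_memD[OF labelled_representation_closed(2)[OF lr]]
  let ?s = "\<lambda>e. t (lab e) \<otimes>\<^bsub>A\<^esub> q {head E e}"
  have L [simp]: "lab e \<in> letters E lab" if "e \<in> arcs E" for e using that by (simp add: letters_eq)
  have V: "q {v} \<in> carrier A" "(q {v})\<^sup>\<star>\<^bsub>A\<^esub> = q {v}" "q {v} \<otimes>\<^bsub>A\<^esub> q {v} = q {v}"
    if "v \<in> verts E" for v
    using c singletons[OF that] by (auto simp: projection_def)
  have qq: "q X \<otimes>\<^bsub>A\<^esub> q Y = q (X \<inter> Y)" if "X \<in> \<C>" "Y \<in> \<C>" for X Y using c that by blast
  have orth: "q {v} \<otimes>\<^bsub>A\<^esub> q {w} = \<zero>\<^bsub>A\<^esub>" if "v \<in> verts E" "w \<in> verts E" "v \<noteq> w" for v w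
  proof -
    have empty: "{v} \<inter> {w} = {}" using that(3) by blast
    have "q {v} \<otimes>\<^bsub>A\<^esub> q {w} = q ({v} \<inter> {w})" by (intro qq singletons that)
    moreover have "{} \<in> \<C>" using sets_Int[OF singletons singletons, OF that(1,2)] unfolding empty .
    ultimately show ?thesis unfolding empty using c by simp
  qed
  have S: "?s e \<in> carrier A" if "e \<in> arcs E" for e using that V tc[OF L] by (simp add: m_closed)
  have S_adj: "(?s e)\<^sup>\<star>\<^bsub>A\<^esub> = q {head E e} \<otimes>\<^bsub>A\<^esub> (t (lab e))\<^sup>\<star>\<^bsub>A\<^esub>" if "e \<in> arcs E" for e
    using that V tc[OF L] by (simp add: adj_mult)
  have S_adj_S: "(?s e)\<^sup>\<star>\<^bsub>A\<^esub> \<otimes>\<^bsub>A\<^esub> ?s f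
      = q {head E e} \<otimes>\<^bsub>A\<^esub> ((t (lab e))\<^sup>\<star>\<^bsub>A\<^esub> \<otimes>\<^bsub>A\<^esub> t (lab f)) \<otimes>\<^bsub>A\<^esub> q {head E f}"
    if "e \<in> arcs E" "f \<in> arcs E" for e f
    using that V tc[OF L] by (simp add: S_adj m_assoc m_closed adj_closed)
  have word_rng: "q (word_rng E lab [lab e]) \<otimes>\<^bsub>A\<^esub> q {head E e} = q {head E e}"
    if e: "e \<in> arcs E" for e
  proof -
    have "word_rng E lab [lab e] \<inter> {head E e} = {head E e}" using e by (auto simp: word_rng_single)
    then show ?thesis using qq[OF word_rng_sets[OF L[OF e]] singletons[of "head E e"]] e by simp
  qed
  \<comment> \<open>The middle factor is the projection of r(a), which is absorbed because r(f) lies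
    in r(a).\<close>
  have same_label: "(?s e)\<^sup>\<star>\<^bsub>A\<^esub> \<otimes>\<^bsub>A\<^esub> ?s f = q {head E e} \<otimes>\<^bsub>A\<^esub> q {head E f}"
    if "e \<in> arcs E" "f \<in> arcs E" "lab e = lab f" for e f
  proof -
    have "(t (lab e))\<^sup>\<star>\<^bsub>A\<^esub> \<otimes>\<^bsub>A\<^esub> t (lab f) = q (word_rng E lab [lab f])" using c that by simp
    then show ?thesis
      using that V qc[OF word_rng_sets[OF L]] word_rng
      unfolding S_adj_S[OF that(1,2)] by (simp add: m_assoc)
  qed
  have S_adj_S_zero: "(?s e)\<^sup>\<star>\<^bsub>A\<^esub> \<otimes>\<^bsub>A\<^esub> ?s f = \<zero>\<^bsub>A\<^esub>"
    if ef: "e \<in> arcs E" "f \<in> arcs E" "e \<noteq> f" for e f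
  proof (cases "lab e = lab f")
    case True
    then have "head E e \<noteq> head E f" using inj_onD[OF inj_on_head, of e f "lab f"] ef by auto
    then show ?thesis using same_label[OF ef(1,2) True] orth ef by simp
  next
    case False
    then have "(t (lab e))\<^sup>\<star>\<^bsub>A\<^esub> \<otimes>\<^bsub>A\<^esub> t (lab f) = \<zero>\<^bsub>A\<^esub>" using c ef by simp
    then show ?thesis
      using ef V by (simp add: S_adj_S mult_zero_left mult_zero_right)
  qed
  have range: "(?s e)\<^sup>\<star>\<^bsub>A\<^esub> \<otimes>\<^bsub>A\<^esub> ?s e = q {head E e}" if "e \<in> arcs E" for e
    using same_label[OF that that refl] V that by simp
  have S_range: "?s e \<otimes>\<^bsub>A\<^esub> q {head E e} = ?s e" if "e \<in> arcs E" for e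
    using that V tc[OF L] by (simp add: m_assoc)
  have pi: "?s e \<otimes>\<^bsub>A\<^esub> (?s e)\<^sup>\<star>\<^bsub>A\<^esub> \<otimes>\<^bsub>A\<^esub> ?s e = ?s e" if "e \<in> arcs E" for e
    using m_assoc[OF S adj_closed[OF S] S, OF that that that] range[OF that] S_range[OF that] by simp
  \<comment> \<open>Moving the source projection past \<open>t (lab e)\<close> turns it into the
    projection of \<open>?R\<close>, which contains r(e) and is therefore absorbed.\<close>
  have tail: "q {tail E e} \<otimes>\<^bsub>A\<^esub> ?s e = ?s e" if e: "e \<in> arcs E" for e
  proof -
    let ?R = "rel_rng E lab {tail E e} [lab e]"
    have v: "{tail E e} \<in> \<C>" using e by (intro singletons) simp
    note R = rel_rng_sets[OF v L[OF e]]
    have "?R \<inter> {head E e} = {head E e}" using e by (auto simp: rel_rng_single)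
    then have RR: "q ?R \<otimes>\<^bsub>A\<^esub> q {head E e} = q {head E e}"
      using qq[OF R singletons[of "head E e"]] e by simp
    have "q {tail E e} \<otimes>\<^bsub>A\<^esub> ?s e = (q {tail E e} \<otimes>\<^bsub>A\<^esub> t (lab e)) \<otimes>\<^bsub>A\<^esub> q {head E e}"
      using e V tc[OF L] by (simp add: m_assoc)
    also have "q {tail E e} \<otimes>\<^bsub>A\<^esub> t (lab e) = t (lab e) \<otimes>\<^bsub>A\<^esub> q ?R" using c v L[OF e] by blast
    also have "\<dots> \<otimes>\<^bsub>A\<^esub> q {head E e} = t (lab e) \<otimes>\<^bsub>A\<^esub> (q ?R \<otimes>\<^bsub>A\<^esub> q {head E e})"
      using e V tc[OF L] qc[OF R] by (simp add: m_assoc)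
    finally show ?thesis unfolding RR .
  qed
  show ?thesis
    unfolding cuntz_krieger_family_def
  proof (intro conjI ballI impI)
    fix v assume v: "v \<in> verts E"
    then show "projection A (q {v})" using V by (simp add: projection_def)
    fix w assume "w \<in> verts E" "v \<noteq> w"
    with v show "q {v} \<otimes>\<^bsub>A\<^esub> q {w} = \<zero>\<^bsub>A\<^esub>" by (rule orth)
  next
    fix e assume e: "e \<in> arcs E"
    note Se = S[OF e] adj_closed[OF S[OF e]]
    show "partial_isometry A (?s e)" using S[OF e] pi[OF e] by (simp add: partial_isometry_def)
    show "(?s e)\<^sup>\<star>\<^bsub>A\<^esub> \<otimes>\<^bsub>A\<^esub> ?s e = q {head E e}" by (rule range[OF e])
    have "projection A (?s e \<otimes>\<^bsub>A\<^esub> (?s e)\<^sup>\<star>\<^bsub>A\<^esub>)"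
      unfolding projection_def
      using Se m_assoc[OF m_closed[OF Se] Se, symmetric] pi[OF e]
      by (simp add: m_closed adj_mult[OF Se] adj_adj[OF Se(1)])
    moreover have "q {tail E e} \<otimes>\<^bsub>A\<^esub> (?s e \<otimes>\<^bsub>A\<^esub> (?s e)\<^sup>\<star>\<^bsub>A\<^esub>) = ?s e \<otimes>\<^bsub>A\<^esub> (?s e)\<^sup>\<star>\<^bsub>A\<^esub>"
      using m_assoc[OF V(1) Se, symmetric] tail[OF e] e by simp
    ultimately show "subprojection A (?s e \<otimes>\<^bsub>A\<^esub> (?s e)\<^sup>\<star>\<^bsub>A\<^esub>) (q {tail E e})"
      using V e by (simp add: subprojection_def projection_def)
    fix f assume f: "f \<in> arcs E" "e \<noteq> f"
    note Sf = S[OF f(1)] adj_closed[OF S[OF f(1)]]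
    have "(?s e \<otimes>\<^bsub>A\<^esub> (?s e)\<^sup>\<star>\<^bsub>A\<^esub>) \<otimes>\<^bsub>A\<^esub> (?s f \<otimes>\<^bsub>A\<^esub> (?s f)\<^sup>\<star>\<^bsub>A\<^esub>)
        = ?s e \<otimes>\<^bsub>A\<^esub> ((?s e)\<^sup>\<star>\<^bsub>A\<^esub> \<otimes>\<^bsub>A\<^esub> ?s f) \<otimes>\<^bsub>A\<^esub> (?s f)\<^sup>\<star>\<^bsub>A\<^esub>"
      using m_assoc[OF Se m_closed[OF Sf]] m_assoc[OF Se(2) Sf] m_assoc[OF Se(1) m_closed[OF Se(2) Sf(1)] Sf(2)]
      by simp
    then show "(?s e \<otimes>\<^bsub>A\<^esub> (?s e)\<^sup>\<star>\<^bsub>A\<^esub>) \<otimes>\<^bsub>A\<^esub> (?s f \<otimes>\<^bsub>A\<^esub> (?s f)\<^sup>\<star>\<^bsub>A\<^esub>) = \<zero>\<^bsub>A\<^esub>"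
      unfolding S_adj_S_zero[OF e f] using Se Sf by (simp add: mult_zero_left mult_zero_right)
  next
    fix v assume v: "v \<in> verts E" and fin: "finite (out_arcs E v) \<and> out_arcs E v \<noteq> {}"
    note vC = singletons[OF v]
    have lf: "letters_from E lab {v} = lab ` out_arcs E v" by (auto simp: letters_from_eq)
    let ?r = "\<lambda>e. ?s e \<otimes>\<^bsub>A\<^esub> (?s e)\<^sup>\<star>\<^bsub>A\<^esub>"
    have r: "?r e \<in> carrier A" if "e \<in> arcs E" for e by (intro m_closed adj_closed S that)
    have r_eq: "?r e = t (lab e) \<otimes>\<^bsub>A\<^esub> q {head E e} \<otimes>\<^bsub>A\<^esub> (t (lab e))\<^sup>\<star>\<^bsub>A\<^esub>" if "e \<in> arcs E" for e
      unfolding S_adj[OF that]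
      using m_assoc[OF S[OF that] V(1) adj_closed[OF tc[OF L[OF that]]], symmetric] S_range[OF that] that
      by simp
    have "q {v} = (\<Oplus>\<^bsub>A\<^esub>a\<in>lab ` out_arcs E v.
        t a \<otimes>\<^bsub>A\<^esub> q (rel_rng E lab {v} [a]) \<otimes>\<^bsub>A\<^esub> (t a)\<^sup>\<star>\<^bsub>A\<^esub>)"
    proof -
      have "{v} \<inter> sinks E = {}" using fin by (auto simp: sinks_def)
      then show ?thesis using c vC fin unfolding lf[symmetric] by (simp add: lf)
    qed
    also have "\<dots> = (\<Oplus>\<^bsub>A\<^esub>a\<in>lab ` out_arcs E v. \<Oplus>\<^bsub>A\<^esub>e\<in>edges_from {v} a. ?r e)"
    proof (rule finsum_cong')
      fix a assume "a \<in> lab ` out_arcs E v"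
      then have a: "a \<in> letters E lab" by (auto simp: letters_eq)
      note R = rel_rng_sets[OF vC a] and ta = tc[OF a]
      have inj: "inj_on (head E) (edges_from {v} a)" by (rule inj_on_subset[OF inj_on_head[of a]]) auto
      have ec: "(\<lambda>e. q {head E e}) \<in> edges_from {v} a \<rightarrow> carrier A" using V by auto
      \<comment> \<open>Splitting this projection into singletons and reindexing by edges, which
        left-resolving permits, breaks the summand of \<open>a\<close> into range projections of
        single edges.\<close>
      have "q (rel_rng E lab {v} [a]) = (\<Oplus>\<^bsub>A\<^esub>w\<in>head E ` edges_from {v} a. q {w})"
        using labelled_representation_eq_sum[OF A lr R] by (simp add: rel_rng_single)
      also have "\<dots> = (\<Oplus>\<^bsub>A\<^esub>e\<in>edges_from {v} a. q {head E e})"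
        using V by (intro finsum_reindex[OF _ inj]) auto
      finally have "t a \<otimes>\<^bsub>A\<^esub> q (rel_rng E lab {v} [a]) \<otimes>\<^bsub>A\<^esub> (t a)\<^sup>\<star>\<^bsub>A\<^esub>
          = (\<Oplus>\<^bsub>A\<^esub>e\<in>edges_from {v} a. t a \<otimes>\<^bsub>A\<^esub> q {head E e}) \<otimes>\<^bsub>A\<^esub> (t a)\<^sup>\<star>\<^bsub>A\<^esub>"
        using finsum_mult_left[OF ec ta] by simp
      also have "\<dots> = (\<Oplus>\<^bsub>A\<^esub>e\<in>edges_from {v} a. t a \<otimes>\<^bsub>A\<^esub> q {head E e} \<otimes>\<^bsub>A\<^esub> (t a)\<^sup>\<star>\<^bsub>A\<^esub>)"
        using V ta by (intro finsum_mult_right adj_closed) (auto simp: m_closed)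
      also have "\<dots> = (\<Oplus>\<^bsub>A\<^esub>e\<in>edges_from {v} a. ?r e)"
        using r r_eq by (intro finsum_cong') auto
      finally show "t a \<otimes>\<^bsub>A\<^esub> q (rel_rng E lab {v} [a]) \<otimes>\<^bsub>A\<^esub> (t a)\<^sup>\<star>\<^bsub>A\<^esub>
          = (\<Oplus>\<^bsub>A\<^esub>e\<in>edges_from {v} a. ?r e)" .
    qed (use r in \<open>auto intro!: finsum_closed\<close>)
    also have "\<dots> = (\<Oplus>\<^bsub>A\<^esub>e\<in>(\<Union>a\<in>lab ` out_arcs E v. edges_from {v} a). ?r e)"
      using fin r by (intro add.finprod_UN_disjoint[folded finsum_def, symmetric]
          finite_edges_from) (auto simp: pairwise_def disjnt_def)
    also have "(\<Union>a\<in>lab ` out_arcs E v. edges_from {v} a) = out_arcs E v" by auto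
    finally show "q {v} = (\<Oplus>\<^bsub>A\<^esub>e\<in>out_arcs E v. ?r e)" .
  qed
qed

text \<open>Contractive maps in both directions come from the two conversions of families; what
  remains is to see that both composites fix the generators.\<close>

theorem labelled_cstar_iso_graph_cstar: "labelled_cstar E lab \<C> \<cong>\<^sub>C graph_cstar E"
proof -
  let ?L = "labelled_cstar E lab \<C>" and ?K = "graph_cstar E"
  let ?q = "\<lambda>X. universal_gen (labelled_gens E lab \<C>) (labelled_rep E lab \<C>) (Inl X)"
    and ?t = "\<lambda>a. universal_gen (labelled_gens E lab \<C>) (labelled_rep E lab \<C>) (Inr a)"
    and ?p = "\<lambda>v. universal_gen (graph_gens E) (graph_rep E) (Inl v)"
    and ?s = "\<lambda>e. universal_gen (graph_gens E) (graph_rep E) (Inr e)"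
  note LU = labelled_cstar_universal[OF accommodating] and KU = graph_cstar_universal[OF wf_digraph_axioms]
  interpret L: cstar_algebra ?L by (rule LU(1))
  interpret K: cstar_algebra ?K by (rule KU(1))
  note lr = LU(2) and ck = KU(2)
  interpret K: cuntz_krieger E ?K ?p ?s
    using K.star_algebra_axioms ck wf_digraph_axioms
    by (simp add: cuntz_krieger_def cuntz_krieger_axioms_def)
  note c = lr[unfolded labelled_representation_def]
  note qc = Pi_memD[OF labelled_representation_closed(1)[OF lr]]
    and tc = Pi_memD[OF labelled_representation_closed(2)[OF lr]]
  obtain h where h: "star_hom ?L ?K h" "contractive ?L ?K h"
    and hq: "\<And>X. X \<in> \<C> \<Longrightarrow> h (?q X) = (\<Oplus>\<^bsub>?K\<^esub>v\<in>X. ?p v)"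
    and ht: "\<And>a. a \<in> letters E lab \<Longrightarrow> h (?t a) = (\<Oplus>\<^bsub>?K\<^esub>e\<in>edges_labelled a. ?s e)"
    using labelled_cstar_contractive_hom[OF accommodating K.cstar_algebra_axioms
        labelled_representation_of_cuntz_krieger[OF K.star_algebra_axioms ck]] by blast
  obtain k where k: "star_hom ?K ?L k" "contractive ?K ?L k"
    and kp: "\<And>v. v \<in> verts E \<Longrightarrow> k (?p v) = ?q {v}"
    and ks: "\<And>e. e \<in> arcs E \<Longrightarrow> k (?s e) = ?t (lab e) \<otimes>\<^bsub>?L\<^esub> ?q {head E e}"
    using graph_cstar_contractive_hom[OF wf_digraph_axioms L.cstar_algebra_axioms
        cuntz_krieger_of_labelled_representation[OF L.star_algebra_axioms lr]] by blast
  note k_sum = star_hom_finsum[OF K.star_algebra_axioms L.star_algebra_axioms k(1)]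
  have kh_q: "k (h (?q X)) = ?q X" if X: "X \<in> \<C>" for X
  proof -
    have "k (h (?q X)) = (\<Oplus>\<^bsub>?L\<^esub>v\<in>X. k (?p v))"
      unfolding hq[OF X] using sets_subset[OF X] by (intro k_sum) auto
    also have "\<dots> = (\<Oplus>\<^bsub>?L\<^esub>v\<in>X. ?q {v})"
      using sets_subset[OF X] kp qc singletons by (intro L.finsum_cong') auto
    also have "\<dots> = ?q X"
      by (rule labelled_representation_eq_sum[OF L.star_algebra_axioms lr X, symmetric])
    finally show ?thesis .
  qed
  have kh_t: "k (h (?t a)) = ?t a" if a: "a \<in> letters E lab" for a
  proof -
    let ?W = "word_rng E lab [a]"
    have W: "?W \<in> \<C>" using a by (rule word_rng_sets)
    have "k (h (?t a)) = (\<Oplus>\<^bsub>?L\<^esub>e\<in>edges_labelled a. k (?s e))"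
      unfolding ht[OF a] by (intro k_sum) auto
    also have "\<dots> = (\<Oplus>\<^bsub>?L\<^esub>e\<in>edges_labelled a. ?t a \<otimes>\<^bsub>?L\<^esub> ?q {head E e})"
      using ks qc[OF singletons] tc[OF a] by (intro L.finsum_cong') (auto intro!: L.m_closed)
    \<comment> \<open>The singleton projections over the ranges of these edges add up to that of
      r(a), the initial projection of \<open>?t a\<close>, so the product is \<open>?t a\<close>
      again.\<close>
    also have "\<dots> = ?t a \<otimes>\<^bsub>?L\<^esub> (\<Oplus>\<^bsub>?L\<^esub>e\<in>edges_labelled a. ?q {head E e})"
      using qc[OF singletons] tc[OF a] by (intro L.finsum_mult_left[symmetric]) auto
    also have "(\<Oplus>\<^bsub>?L\<^esub>e\<in>edges_labelled a. ?q {head E e}) = (\<Oplus>\<^bsub>?L\<^esub>v\<in>?W. ?q {v})"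
      unfolding word_rng_single using qc[OF singletons]
      by (intro L.finsum_reindex[symmetric] inj_on_head) auto
    also have "\<dots> = ?q ?W"
      by (rule labelled_representation_eq_sum[OF L.star_algebra_axioms lr W, symmetric])
    also have "\<dots> = (?t a)\<^sup>\<star>\<^bsub>?L\<^esub> \<otimes>\<^bsub>?L\<^esub> ?t a" using c a by simp
    also have "?t a \<otimes>\<^bsub>?L\<^esub> \<dots> = ?t a \<otimes>\<^bsub>?L\<^esub> (?t a)\<^sup>\<star>\<^bsub>?L\<^esub> \<otimes>\<^bsub>?L\<^esub> ?t a"
      using tc[OF a] by (intro L.m_assoc[symmetric] L.adj_closed)
    also have "\<dots> = ?t a" using c a by (simp add: partial_isometry_def)
    finally show ?thesis .
  qed
  have hk_p: "h (k (?p v)) = ?p v" if v: "v \<in> verts E" for v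
    unfolding kp[OF v] hq[OF singletons[OF v]] using v by simp
  have hk_s: "h (k (?s e)) = ?s e" if e: "e \<in> arcs E" for e
  proof -
    let ?F = "edges_labelled (lab e)"
    have le: "lab e \<in> letters E lab" and v: "{head E e} \<in> \<C>"
      using e by (auto simp: letters_eq intro: singletons)
    have "h (k (?s e)) = h (?t (lab e)) \<otimes>\<^bsub>?K\<^esub> h (?q {head E e})"
      unfolding ks[OF e] by (rule star_homD(3)[OF h(1) tc[OF le] qc[OF v]])
    also have "\<dots> = K.edge_sum ?F \<otimes>\<^bsub>?K\<^esub> K.vertex_sum {head E e}"
      unfolding ht[OF le] hq[OF v] ..
    also have "\<dots> = K.edge_sum {f \<in> ?F. head E f \<in> {head E e}}"
      using e finite_edges_labelled by (intro K.edge_sum_mult_vertex_sum) auto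
    \<comment> \<open>Label and range together determine an edge, so the selected edge sum has one
      term.\<close>
    also have "{f \<in> ?F. head E f \<in> {head E e}} = {e}"
      using e inj_onD[OF inj_on_head, of _ e "lab e"] by auto
    finally show ?thesis using e by simp
  qed
  show ?thesis
  proof (rule cstar_iso_contractive[OF L.cstar_algebra_axioms K.cstar_algebra_axioms h k _ LU(3) _ _ KU(3)])
    show "?q ` \<C> \<union> ?t ` letters E lab \<subseteq> carrier ?L" using qc tc by blast
    show "?p ` verts E \<union> ?s ` arcs E \<subseteq> carrier ?K" using K.vertex_closed K.edge_closed by blast
    show "k (h x) = x" if "x \<in> ?q ` \<C> \<union> ?t ` letters E lab" for x using that kh_q kh_t by blast
    show "h (k y) = y" if "y \<in> ?p ` verts E \<union> ?s ` arcs E" for y using that hk_p hk_s by blast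
  qed
qed

end

section \<open>Finiteness of the sets in the two collections\<close>

lemma path_ends:
  assumes "wf_digraph E" "is_path E u l v"
  shows "hd l \<in> arcs E" "last l \<in> arcs E" "tail E (hd l) = u" "head E (last l) = v"
proof -
  interpret wf_digraph E by fact
  have l: "l \<noteq> []" "awalk u l v" using assms(2) by (auto simp: is_path_def)
  then show "hd l \<in> arcs E" "tail E (hd l) = u" by (cases l; auto simp: awalk_Cons_iff)+
  from l show "last l \<in> arcs E" "head E (last l) = v"
    by (cases l rule: rev_cases; auto simp: awalk_append_iff awalk_Cons_iff)+
qed

text \<open>A path labelled \<alpha> ends where its last edge ends and starts where its first edge
  starts. Those edges carry the last and first letters of \<alpha>, so label-finiteness leaves
  finitely many of them however many paths there are. Relative ranges are subsets of the
  ranges.\<close>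

lemma accommodating_finite_sets:
  fixes E :: "('v, 'e) pre_digraph" and lab :: "'e \<Rightarrow> 'l"
  assumes "labelled_graph E lab alphabet" "label_finite E lab alphabet"
  defines "\<F> \<equiv> {X. X \<subseteq> verts E \<and> finite X}"
  shows "accommodating E lab \<F>"
    and "\<And>\<alpha>. \<alpha> \<in> words E lab \<Longrightarrow> word_rng E lab \<alpha> \<in> \<F>"
    and "\<And>\<alpha>. \<alpha> \<in> words E lab \<Longrightarrow> word_src E lab \<alpha> \<in> \<F>"
proof -
  interpret labelled_graph E lab alphabet by fact
  note fin = finite_edges_with_label[OF assms(2)]
  note ends = path_ends[OF wf_digraph_axioms] and verts = is_path_verts[OF wf_digraph_axioms]
  have nonempty: "l \<noteq> []" if "is_path E u l v" for u l v using that by (simp add: is_path_def)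
  have "word_rng E lab \<alpha> \<subseteq> head E ` {e \<in> arcs E. lab e = last \<alpha>}" for \<alpha>
  proof
    fix v assume "v \<in> word_rng E lab \<alpha>"
    then obtain u l where l: "is_path E u l v" "map lab l = \<alpha>" unfolding word_rng_def by blast
    then have "lab (last l) = last \<alpha>" using nonempty[OF l(1)] by (auto simp: last_map)
    then show "v \<in> head E ` {e \<in> arcs E. lab e = last \<alpha>}" using ends[OF l(1)] by blast
  qed
  then have "finite (word_rng E lab \<alpha>)" for \<alpha> by (rule finite_surj[OF fin])
  then show wr: "word_rng E lab \<alpha> \<in> \<F>" for \<alpha>
    using verts by (auto simp: word_rng_def \<F>_def)
  have "word_src E lab \<alpha> \<subseteq> tail E ` {e \<in> arcs E. lab e = hd \<alpha>}" for \<alpha>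
  proof
    fix u assume "u \<in> word_src E lab \<alpha>"
    then obtain v l where l: "is_path E u l v" "map lab l = \<alpha>" unfolding word_src_def by blast
    then have "lab (hd l) = hd \<alpha>" using nonempty[OF l(1)] by (auto simp: hd_map)
    then show "u \<in> tail E ` {e \<in> arcs E. lab e = hd \<alpha>}" using ends[OF l(1)] by blast
  qed
  then have "finite (word_src E lab \<alpha>)" for \<alpha> by (rule finite_surj[OF fin])
  then show "word_src E lab \<alpha> \<in> \<F>" for \<alpha>
    using verts by (auto simp: word_src_def \<F>_def)
  have "rel_rng E lab X \<alpha> \<subseteq> word_rng E lab \<alpha>" for X \<alpha>
    unfolding rel_rng_def word_rng_def by blast
  then have "rel_rng E lab X \<alpha> \<in> \<F>" for X \<alpha>
    using wr[of \<alpha>] unfolding \<F>_def by (blast intro: finite_subset)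
  with wr show "accommodating E lab \<F>"
    unfolding accommodating_def by (auto simp: \<F>_def)
qed

theorem theorem6p6:
  fixes E :: "('v, 'e) pre_digraph" and lab :: "'e \<Rightarrow> 'l" and alphabet :: "'l set"
  assumes "labelled_graph E lab alphabet"
    and "left_resolving E lab"
    and "row_finite E"
    and "label_finite E lab alphabet"
    and "\<forall>v\<in>verts E. {v} \<in> E_zero E lab"
  shows "labelled_cstar E lab (E_zero E lab) \<cong>\<^sub>C graph_cstar E \<and>
    ((\<forall>v\<in>verts E. {v} \<in> E_zero_minus E lab) \<longrightarrow>
      labelled_cstar E lab (E_zero_minus E lab) \<cong>\<^sub>C graph_cstar E)"
proof -
  interpret labelled_graph E lab alphabet by fact
  let ?F = "{X. X \<subseteq> verts E \<and> finite X}"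
  note fin = accommodating_finite_sets[OF assms(1,4)]
  have vs: "{v} \<in> ?F" if "v \<in> sources E \<union> sinks E" for v
    using that by (auto simp: sources_def sinks_def)
  \<comment> \<open>The finite vertex sets form one of the collections intersected in
    \<open>E_zero\<close>, which therefore contains only finite sets; the same reasoning serves
    \<open>E_zero_minus\<close>.\<close>
  have "?F \<in> {\<C>. accommodating E lab \<C> \<and> (\<forall>v\<in>sources E \<union> sinks E. {v} \<in> \<C>) \<and>
      (\<forall>\<alpha>\<in>words E lab. word_rng E lab \<alpha> \<in> \<C> \<and> word_src E lab \<alpha> \<in> \<C>)}"
    using fin vs by blast
  then have "E_zero E lab \<subseteq> ?F" unfolding E_zero_def by (rule Inter_lower)
  then have "singleton_space E lab alphabet (E_zero E lab)"
    using assms E_zero_accommodating[OF wf_digraph_axioms]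
    by (intro singleton_space.intro singleton_space_axioms.intro) auto
  moreover have "?F \<in> {\<C>. accommodating E lab \<C> \<and> (\<forall>v\<in>sinks E. {v} \<in> \<C>) \<and>
      (\<forall>\<alpha>\<in>words E lab. word_rng E lab \<alpha> \<in> \<C>)}"
    using fin vs by blast
  then have "E_zero_minus E lab \<subseteq> ?F" unfolding E_zero_minus_def by (rule Inter_lower)
  then have "singleton_space E lab alphabet (E_zero_minus E lab)"
    if "\<forall>v\<in>verts E. {v} \<in> E_zero_minus E lab"
    using assms that E_zero_minus_accommodating[OF wf_digraph_axioms]
    by (intro singleton_space.intro singleton_space_axioms.intro) auto
  ultimately show ?thesis by (blast intro: singleton_space.labelled_cstar_iso_graph_cstar)
qed

end
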